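(* Let $\mathcal U_{h,\Lambda}\in\boldsymbol V_{h,\Lambda}\times W_{h,\Lambda}\times W_{h,\Lambda}$ be the stochastic Galerkin mixed finite element approximation of the weak solution, and let $\mathcal U_{h^*,\Lambda}\in\boldsymbol V_{h^*,\Lambda}\times W_{h^*,\Lambda}\times W_{h^*,\Lambda}$ and $\mathcal U_{h,\Lambda^*}\in\boldsymbol V_{h,\Lambda^*}\times W_{h,\Lambda^*}\times W_{h,\Lambda^*}$ be the enhanced approximations obtained with the enriched finite element spaces, respectively the enriched polynomial space. Then $$C_6\,\eta_{h^*,\Lambda}\le|||\mathcal U_{h^*,\Lambda}-\mathcal U_{h,\Lambda}|||\le\frac{\widehat C_7}{\sqrt{1-\gamma^2}}\,\eta_{h^*,\Lambda},$$ $$C_6\,\eta_{h,\mathfrak Q}\le|||\mathcal U_{h,\Lambda^*}-\mathcal U_{h,\Lambda}|||\le\widehat C_7\,\eta_{h,\mathfrak Q},$$ where $C_6:=\big(\sqrt3\,\max\{E_{\max}+\sqrt d,\;1+\sqrt d\}\big)^{-1}$, $\gamma:=\max\{\gamma_1,\gamma_2\}\in[0,1)$ with $\gamma_1,\gamma_2$ the CBS constants, and $$\widehat C_7:=\frac{\widehat C_2}{\widehat C_1\,E_{\min}},\quad \widehat C_1:=\tfrac12\min\Big\{C_K,\frac{(\gamma_h^* )^2}{E_{\max}^2},\frac1{E_{\max}^2}\Big\},\quad \widehat C_2:=\frac{\sqrt{2(E_{\max}^2+(\gamma_h^* )^2+1)}}{E_{\max}},$$ with $\gamma_h^*$ the discrete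 inf-sup constant of the enriched pair $(\boldsymbol V_h^*,W_h^* )$.
   Context: **Data.** $d\in\{2,3\}$; $D\subset\mathbb R^d$ is a bounded Lipschitz polygon ($d=2$) or polyhedron ($d=3$) with $\partial D=\partial D_D\cup\partial D_N$, $\partial D_D\cap\partial D_N=\emptyset$, both parts nonempty. $\Gamma=\prod_{k=1}^\infty[-1,1]$ carries the product probability measure $\pi=\prod_k\pi_k$, each $\pi_k$ being the uniform probability measure on $[-1,1]$. The Young's modulus is $E(\boldsymbol x,\boldsymbol y)=e_0(\boldsymbol x)+\sum_{k=1}^\infty e_k(\boldsymbol x)y_k$, with $E\in L^\infty(D\times\Gamma)$, $0<E_{\min}\le E\le E_{\max}<\infty$ a.e. in $D\times\Gamma$, $0<e_0^{\min}\le e_0\le e_0^{\max}<\infty$ a.e. in $D$, and $\frac1{e_0^{\min}}\sum_{k\ge1}\|e_k\|_{L^\infty(D)}<1$. The Poisson ratio $\nu\in(0,1/2)$ is a fixed constant, $\alpha:=\frac1{1+\nu}$, $\beta:=\frac{\nu}{1-2\nu}$, and $\boldsymbol f\in (L^2(D))^d$. **Spaces.** $\boldsymbol H^1_{E_0}(D)=\{\boldsymbol v\in H^1(D;\mathbb R^d):\boldsymbol v|_{\partial D_D}=\boldsymbol 0\}$, $\boldsymbol{\mathcal V}=L^2_\pi(\Gamma,\boldsymbol H^1_{E_0}(D))$, $\mathcal W=L^2_\pi(\Gamma,L^2(D))$; $\|\cdot\|_{\mathcal W}$ is the norm of $\mathcal W$ and $\|\nabla\boldsymbol v\|_{\boldsymbol{\mathcal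 W}}:=\big(\int_\Gamma\int_D|\nabla\boldsymbol v|^2\,d\boldsymbol x\,d\pi\big)^{1/2}$. The norm on $\boldsymbol{\mathcal V}\times\mathcal W\times\mathcal W$ is $$|||(\boldsymbol v,q,\tilde q)|||^2:=\alpha\|\nabla\boldsymbol v\|^2_{\boldsymbol{\mathcal W}}+(\alpha^{-1}+(\alpha\beta)^{-1})\|q\|^2_{\mathcal W}+(\alpha\beta)^{-1}\|\tilde q\|^2_{\mathcal W}.$$ **Forms.** With $\boldsymbol\varepsilon(\boldsymbol v)=\frac12(\nabla\boldsymbol v+(\nabla\boldsymbol v)^\top)$: $a(\boldsymbol u,\boldsymbol v)=\alpha\int_\Gamma\int_D E\,\boldsymbol\varepsilon(\boldsymbol u):\boldsymbol\varepsilon(\boldsymbol v)$, $b(\boldsymbol v,p)=-\int_\Gamma\int_D p\,\nabla\cdot\boldsymbol v$, $c(p,q)=(\alpha\beta)^{-1}\int_\Gamma\int_D pq$, $d(p,q)=(\alpha\beta)^{-1}\int_\Gamma\int_D E\,pq$, $f(\boldsymbol v)=\int_\Gamma\int_D\boldsymbol f\cdot\boldsymbol v$ (integrals with respect to $d\boldsymbol x\,d\pi(\boldsymbol y)$). Also $\bar a_0(\boldsymbol u,\boldsymbol v):=\alpha\int_\Gamma\int_D\nabla\boldsymbol u:\nabla\boldsymbol v$, $\bar c(p,q):=(\alpha^{-1}+(\alpha\beta)^{-1})\int_\Gamma\int_D pq$, $\bar d_0(p,q):=(\alpha\beta)^{-1}\int_\Gamma\int_D pq$, with induced norms $|\cdot|_{\bar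 a_0}$, $|\cdot|_{\bar c}$, $|\cdot|_{\bar d_0}$ (square roots of the diagonal values). $C_K\in(0,1]$ is the Korn constant: $\int_D\boldsymbol\varepsilon(\boldsymbol v):\boldsymbol\varepsilon(\boldsymbol v)\ge C_K\|\nabla\boldsymbol v\|_{L^2(D)}^2$ for $\boldsymbol v\in\boldsymbol H^1_{E_0}(D)$. **Finite element and polynomial spaces.** $\boldsymbol V_h\subset\boldsymbol H^1_{E_0}(D)$ and $W_h\subset L^2(D)$ are finite-dimensional (conforming finite element) spaces with discrete inf-sup constant $\gamma_h>0$: $\sup_{0\ne\boldsymbol v\in\boldsymbol V_h}\frac{\int_D q\,\nabla\cdot\boldsymbol v}{\|\nabla\boldsymbol v\|_{L^2(D)}}\ge\gamma_h\|q\|_{L^2(D)}$ for all $q\in W_h$, with $\gamma_h$ bounded away from zero uniformly in the mesh size $h$. Enriched spaces: $\boldsymbol V_h^*=\boldsymbol V_h\oplus\widetilde{\boldsymbol V}_h$, $W_h^*=W_h\oplus\widetilde W_h$ with finite-dimensional $\widetilde{\boldsymbol V}_h\subset\boldsymbol H^1_{E_0}(D)$, $\widetilde W_h\subset L^2(D)$, $\boldsymbol V_h\cap\widetilde{\boldsymbol V}_h=\{\boldsymbol0\}$, $W_h\cap\widetilde W_h=\{0\}$; the pair $(\boldsymbol V_h^*,W_h^* )$ is inf-sup stable in the same sense (with $\boldsymbol V_h,W_h$ replaced by $\boldsymbol V_h^*,W_h^*$), with constant $\gamma_h^*>0$. The CBS (strengthened Cauchy-Schwarz) constants $\gamma_1,\gamma_2\in[0,1)$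 satisfy $|\int_D\nabla\boldsymbol v:\nabla\widetilde{\boldsymbol v}|\le\gamma_1\|\nabla\boldsymbol v\|_{L^2(D)}\|\nabla\widetilde{\boldsymbol v}\|_{L^2(D)}$ for $\boldsymbol v\in\boldsymbol V_h$, $\widetilde{\boldsymbol v}\in\widetilde{\boldsymbol V}_h$, and $|\int_D q\,\tilde q|\le\gamma_2\|q\|_{L^2(D)}\|\tilde q\|_{L^2(D)}$ for $q\in W_h$, $\tilde q\in\widetilde W_h$. $\mathfrak I$ is the set of finitely supported sequences in $\mathbb N_0^{\mathbb N}$; $\psi_{\boldsymbol\alpha}(\boldsymbol y)=\prod_i\psi_{\alpha_i}(y_i)$, where $\psi_n$ is the univariate Legendre polynomial of degree $n$ on $[-1,1]$ normalised in $L^2$ for the uniform probability measure ($\psi_0=1$). For finite $\mathfrak J\subset\mathfrak I$, $S_{\mathfrak J}=\mathrm{span}\{\psi_{\boldsymbol\alpha}:\boldsymbol\alpha\in\mathfrak J\}$. $\Lambda,\mathfrak Q\subset\mathfrak I$ are finite and disjoint and $\Lambda^*:=\Lambda\cup\mathfrak Q$. Put $\boldsymbol V_{h,\Lambda}=\boldsymbol V_h\otimes S_\Lambda$, $\boldsymbol V_{h^*,\Lambda}=\boldsymbol V_h^*\otimes S_\Lambda$, $\widetilde{\boldsymbol V}_{h,\Lambda}=\widetilde{\boldsymbol V}_h\otimes S_\Lambda$, $\boldsymbol V_{h,\mathfrak Q}=\boldsymbol V_h\otimes S_{\mathfrak Q}$, $\boldsymbol V_{h,\Lambda^*}=\boldsymbol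 V_h\otimes S_{\Lambda^*}$, and define $W_{h,\Lambda}$, $W_{h^*,\Lambda}$, $\widetilde W_{h,\Lambda}$, $W_{h,\mathfrak Q}$, $W_{h,\Lambda^*}$ likewise from $W_h,W_h^*,\widetilde W_h$. **Galerkin solutions.** For a pair of spaces $(\boldsymbol X,Y)$, the Galerkin solution is $(\boldsymbol u_X,p_X,\tilde p_X)\in\boldsymbol X\times Y\times Y$ with $a(\boldsymbol u_X,\boldsymbol v)+b(\boldsymbol v,p_X)=f(\boldsymbol v)$, $b(\boldsymbol u_X,q)-c(\tilde p_X,q)=0$, $-c(p_X,\tilde q)+d(\tilde p_X,\tilde q)=0$ for all $(\boldsymbol v,q,\tilde q)\in\boldsymbol X\times Y\times Y$. The weak solution corresponds to $(\boldsymbol{\mathcal V},\mathcal W)$; $\mathcal U_{h,\Lambda}=(\boldsymbol u_{h,\Lambda},p_{h,\Lambda},\tilde p_{h,\Lambda})$, $\mathcal U_{h^*,\Lambda}$ and $\mathcal U_{h,\Lambda^*}$ correspond to $(\boldsymbol V_{h,\Lambda},W_{h,\Lambda})$, $(\boldsymbol V_{h^*,\Lambda},W_{h^*,\Lambda})$ and $(\boldsymbol V_{h,\Lambda^*},W_{h,\Lambda^*})$. **Residuals and error reduction proxies.** $\mathcal R^{\boldsymbol u}(\boldsymbol v):=f(\boldsymbol v)-a(\boldsymbol u_{h,\Lambda},\boldsymbol v)-b(\boldsymbol v,p_{h,\Lambda})$, $\mathcal R^p(q):=-b(\boldsymbol u_{h,\Lambda},q)+c(\tilde p_{h,\Lambda},q)$,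 $\mathcal R^{\tilde p}(\tilde q):=c(p_{h,\Lambda},\tilde q)-d(\tilde p_{h,\Lambda},\tilde q)$. Then $\tilde{\boldsymbol e}^{\boldsymbol u}_{h,\Lambda}\in\widetilde{\boldsymbol V}_{h,\Lambda}$ and $\boldsymbol e^{\boldsymbol u}_{h,\mathfrak Q}\in\boldsymbol V_{h,\mathfrak Q}$ solve $\bar a_0(\cdot,\boldsymbol v)=\mathcal R^{\boldsymbol u}(\boldsymbol v)$ for all $\boldsymbol v$ in $\widetilde{\boldsymbol V}_{h,\Lambda}$, respectively $\boldsymbol V_{h,\mathfrak Q}$; $\tilde e^{p}_{h,\Lambda}\in\widetilde W_{h,\Lambda}$ solves $\bar c(\cdot,q)=\mathcal R^p(q)$ for all $q\in\widetilde W_{h,\Lambda}$; $\tilde e^{\tilde p}_{h,\Lambda}\in\widetilde W_{h,\Lambda}$ and $e^{\tilde p}_{h,\mathfrak Q}\in W_{h,\mathfrak Q}$ solve $\bar d_0(\cdot,\tilde q)=\mathcal R^{\tilde p}(\tilde q)$ for all $\tilde q$ in $\widetilde W_{h,\Lambda}$, respectively $W_{h,\mathfrak Q}$. Finally $$\eta_{h^*,\Lambda}:=\big(|\tilde{\boldsymbol e}^{\boldsymbol u}_{h,\Lambda}|^2_{\bar a_0}+|\tilde e^p_{h,\Lambda}|^2_{\bar c}+|\tilde e^{\tilde p}_{h,\Lambda}|^2_{\bar d_0}\big)^{1/2},\qquad \eta_{h,\mathfrak Q}:=\big(|\boldsymbol e^{\boldsymbol u}_{h,\mathfrak Q}|^2_{\bar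 a_0}+|e^{\tilde p}_{h,\mathfrak Q}|^2_{\bar d_0}\big)^{1/2}.$$
   Formalization: In the last upper bound (for the enriched polynomial space) the constant Ĉ₇ is evaluated at min{γ_h, γ_h^*} instead of γ_h^*, since the printed bound fails when γ_h is much smaller than γ_h^* and ν is close to 1/2. *)

theory Defs
  imports "HOL-Probability.Probability"
begin

definition lipschitz_boundary :: "(real ^ 'd) set \<Rightarrow> bool" where
  "lipschitz_boundary D \<longleftrightarrow>
     (\<forall>z \<in> frontier D. \<exists>U n L \<phi>. open U \<and> z \<in> U \<and> norm n = 1 \<and> L-lipschitz_on UNIV \<phi> \<and>
        D \<inter> U = {x \<in> U. \<phi> (x - (x \<bullet> n) *\<^sub>R n) < x \<bullet> n})"
  \<comment> \<open>Near each boundary point, and in the direction of some unit vector \<open>n\<close>, the set \<open>D\<close> lies strictly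
      above the graph of a real Lipschitz function of the component orthogonal to \<open>n\<close>.\<close>

definition lipschitz_polytopal_domain :: "(real ^ 'd) set \<Rightarrow> bool" where
  "lipschitz_polytopal_domain D \<longleftrightarrow>
     D \<noteq> {} \<and> open D \<and> connected D \<and> bounded D \<and> lipschitz_boundary D \<and>
     (\<exists>\<P>. finite \<P> \<and> (\<forall>P \<in> \<P>. polytope P) \<and> closure D = \<Union>\<P>)"

abbreviation vol :: "(real ^ 'd) set \<Rightarrow> (real ^ 'd) measure" where
  "vol D \<equiv> restrict_space lborel D"

definition hausdorff_content :: "nat \<Rightarrow> real \<Rightarrow> 'a::metric_space set \<Rightarrow> ennreal" where
  "hausdorff_content s \<delta> A =
     (INF C \<in> {C :: nat \<Rightarrow> 'a set. A \<subseteq> (\<Union>n. C n) \<and> (\<forall>n. bounded (C n) \<and> diameter (C n) \<le> \<delta>)}.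
        \<Sum>n. ennreal (unit_ball_vol (real s) * (diameter (C n) / 2) ^ s))"

definition hausdorff_measure :: "nat \<Rightarrow> 'a::metric_space measure" where
  "hausdorff_measure s = measure_of UNIV (sets borel) (\<lambda>A. SUP \<delta> \<in> {0<..}. hausdorff_content s \<delta> A)"
  \<comment> \<open>The set function is a metric outer measure, hence countably additive on the Borel sets,
      as \<open>measure_of\<close> requires.\<close>

definition surface_measure :: "(real ^ 'd) set \<Rightarrow> (real ^ 'd) measure" where
  "surface_measure D = restrict_space (hausdorff_measure (CARD('d) - 1)) (frontier D)"

text \<open>Elements of \<open>L\<^sup>2\<close> and \<open>H\<^sup>1\<close> are represented by functions; equality in these spaces is equality
  almost everywhere.\<close>

definition L2 :: "'a measure \<Rightarrow> ('a \<Rightarrow> 'b::euclidean_space) set" where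
  "L2 M = {f \<in> borel_measurable M. integrable M (\<lambda>x. (norm (f x))\<^sup>2)}"

definition L2_norm :: "'a measure \<Rightarrow> ('a \<Rightarrow> 'b::euclidean_space) \<Rightarrow> real" where
  "L2_norm M f = sqrt (\<integral>x. (norm (f x))\<^sup>2 \<partial>M)"

definition Linf :: "'a measure \<Rightarrow> ('a \<Rightarrow> real) set" where
  "Linf M = {f \<in> borel_measurable M. esssup M (\<lambda>x. ereal \<bar>f x\<bar>) < \<infinity>}"

definition Linf_norm :: "'a measure \<Rightarrow> ('a \<Rightarrow> real) \<Rightarrow> real" where
  "Linf_norm M f = real_of_ereal (esssup M (\<lambda>x. ereal \<bar>f x\<bar>))"

definition partial :: "'d \<Rightarrow> (real ^ 'd \<Rightarrow> real) \<Rightarrow> real ^ 'd \<Rightarrow> real" where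
  "partial i f x = frechet_derivative f (at x) (axis i 1)"

primrec Ck :: "nat \<Rightarrow> (real ^ 'd \<Rightarrow> real) \<Rightarrow> bool" where
  "Ck 0 f \<longleftrightarrow> continuous_on UNIV f"
| "Ck (Suc k) f \<longleftrightarrow> (\<forall>x. f differentiable (at x)) \<and> (\<forall>i. Ck k (partial i f))"

definition smooth :: "(real ^ 'd \<Rightarrow> real) \<Rightarrow> bool" where
  "smooth f \<longleftrightarrow> (\<forall>k. Ck k f)"

definition test_function :: "(real ^ 'd) set \<Rightarrow> (real ^ 'd \<Rightarrow> real) \<Rightarrow> bool" where
  "test_function D \<phi> \<longleftrightarrow>
     smooth \<phi> \<and> compact (closure {x. \<phi> x \<noteq> 0}) \<and> closure {x. \<phi> x \<noteq> 0} \<subseteq> D"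

definition is_weak_gradient ::
  "(real ^ 'd) set \<Rightarrow> (real ^ 'd \<Rightarrow> real) \<Rightarrow> (real ^ 'd \<Rightarrow> real ^ 'd) \<Rightarrow> bool" where
  "is_weak_gradient D f g \<longleftrightarrow> g \<in> L2 (vol D) \<and>
     (\<forall>\<phi> i. test_function D \<phi> \<longrightarrow>
        (\<integral>x. f x * partial i \<phi> x \<partial>vol D) = - (\<integral>x. g x $ i * \<phi> x \<partial>vol D))"

definition weak_gradient :: "(real ^ 'd) set \<Rightarrow> (real ^ 'd \<Rightarrow> real) \<Rightarrow> real ^ 'd \<Rightarrow> real ^ 'd" where
  "weak_gradient D f = (SOME g. is_weak_gradient D f g)"
  \<comment> \<open>Determined up to a null set of \<open>D\<close>.\<close>

definition H1 :: "(real ^ 'd) set \<Rightarrow> (real ^ 'd \<Rightarrow> real) set" where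
  "H1 D = {f \<in> L2 (vol D). \<exists>g. is_weak_gradient D f g}"

text \<open>The boundary trace is the continuous extension to \<open>H\<^sup>1(D)\<close> of the restriction to \<open>\<partial>D\<close> of functions
  that are smooth up to the boundary.\<close>

definition has_trace :: "(real ^ 'd) set \<Rightarrow> (real ^ 'd \<Rightarrow> real) \<Rightarrow> (real ^ 'd \<Rightarrow> real) \<Rightarrow> bool" where
  "has_trace D f g \<longleftrightarrow> g \<in> borel_measurable (surface_measure D) \<and>
     (\<exists>\<phi>. (\<forall>n::nat. smooth (\<phi> n)) \<and>
        (\<lambda>n. \<integral>\<^sup>+x. ennreal ((\<phi> n x - f x)\<^sup>2) \<partial>vol D) \<longlonglongrightarrow> 0 \<and>
        (\<forall>i. (\<lambda>n. \<integral>\<^sup>+x. ennreal ((partial i (\<phi> n) x - weak_gradient D f x $ i)\<^sup>2) \<partial>vol D) \<longlonglongrightarrow> 0) \<and>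
        (\<lambda>n. \<integral>\<^sup>+x. ennreal ((\<phi> n x - g x)\<^sup>2) \<partial>surface_measure D) \<longlonglongrightarrow> 0)"

definition H1_E0 :: "(real ^ 'd) set \<Rightarrow> (real ^ 'd) set \<Rightarrow> (real ^ 'd \<Rightarrow> real ^ 'd) set" where
  "H1_E0 D \<Gamma>\<^sub>D = {v. \<forall>i. (\<lambda>x. v x $ i) \<in> H1 D \<and>
     (\<exists>g. has_trace D (\<lambda>x. v x $ i) g \<and> (AE x in surface_measure D. x \<in> \<Gamma>\<^sub>D \<longrightarrow> g x = 0))}"

definition grad :: "(real ^ 'd) set \<Rightarrow> (real ^ 'd \<Rightarrow> real ^ 'd) \<Rightarrow> real ^ 'd \<Rightarrow> real ^ 'd ^ 'd" where
  "grad D v x = (\<chi> i. weak_gradient D (\<lambda>z. v z $ i) x)"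

definition strain :: "(real ^ 'd) set \<Rightarrow> (real ^ 'd \<Rightarrow> real ^ 'd) \<Rightarrow> real ^ 'd \<Rightarrow> real ^ 'd ^ 'd" where
  "strain D v x = (1 / 2) *\<^sub>R (grad D v x + transpose (grad D v x))"

definition dvg :: "(real ^ 'd) set \<Rightarrow> (real ^ 'd \<Rightarrow> real ^ 'd) \<Rightarrow> real ^ 'd \<Rightarrow> real" where
  "dvg D v x = trace (grad D v x)"

text \<open>The parameters \<open>y\<^sub>1, y\<^sub>2, \<dots>\<close> are indexed from \<open>0\<close>: \<open>y k\<close> stands for \<open>y\<^sub>k\<^sub>+\<^sub>1\<close>.\<close>

definition param_measure :: "(nat \<Rightarrow> real) measure" where
  "param_measure = PiM UNIV (\<lambda>_. uniform_measure (restrict_space lborel {-1..1}) {-1..1})"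

definition modulus :: "(nat \<Rightarrow> real ^ 'd \<Rightarrow> real) \<Rightarrow> real ^ 'd \<Rightarrow> (nat \<Rightarrow> real) \<Rightarrow> real" where
  "modulus e x y = e 0 x + (\<Sum>k. e (Suc k) x * y k)"

definition multi_indices :: "(nat \<Rightarrow> nat) set" where
  "multi_indices = {\<mu>. finite {i. \<mu> i \<noteq> 0}}"

definition legendre :: "nat \<Rightarrow> real poly" where
  "legendre n = smult (1 / (2 ^ n * fact n)) ((pderiv ^^ n) ([:-1, 0, 1:] ^ n))"
  \<comment> \<open>Rodrigues' formula. Under the uniform probability measure on \<open>[-1,1]\<close> the mean square of this
      polynomial is \<open>1 / (2 n + 1)\<close>.\<close>

definition psi :: "nat \<Rightarrow> real \<Rightarrow> real" where
  "psi n t = sqrt (2 * real n + 1) * poly (legendre n) t"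

definition Psi :: "(nat \<Rightarrow> nat) \<Rightarrow> (nat \<Rightarrow> real) \<Rightarrow> real" where
  "Psi \<mu> y = (\<Prod>i \<in> {i. \<mu> i \<noteq> 0}. psi (\<mu> i) (y i))"

definition poly_space :: "(nat \<Rightarrow> nat) set \<Rightarrow> ((nat \<Rightarrow> real) \<Rightarrow> real) set" where
  "poly_space J = {\<lambda>y. \<Sum>\<mu> \<in> J. c \<mu> * Psi \<mu> y | c. True}"

definition finite_dim_space :: "(real ^ 'd \<Rightarrow> 'b::real_vector) set \<Rightarrow> bool" where
  "finite_dim_space X \<longleftrightarrow> (\<exists>B. finite B \<and> X = {\<lambda>x. \<Sum>b \<in> B. c b *\<^sub>R b x | c. True})"

definition sum_space ::
  "(real ^ 'd \<Rightarrow> 'b::real_vector) set \<Rightarrow> (real ^ 'd \<Rightarrow> 'b) set \<Rightarrow> (real ^ 'd \<Rightarrow> 'b) set" where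
  "sum_space X Z = {\<lambda>x. v x + z x | v z. v \<in> X \<and> z \<in> Z}"

definition trivial_intersection ::
  "(real ^ 'd) set \<Rightarrow> (real ^ 'd \<Rightarrow> 'b::real_vector) set \<Rightarrow> (real ^ 'd \<Rightarrow> 'b) set \<Rightarrow> bool" where
  "trivial_intersection D X Z \<longleftrightarrow>
     (\<forall>v \<in> X. \<forall>z \<in> Z. (AE x in vol D. v x = z x) \<longrightarrow> (AE x in vol D. v x = 0))"

definition tensor :: "(real ^ 'd \<Rightarrow> 'b::real_vector) set \<Rightarrow> ((nat \<Rightarrow> real) \<Rightarrow> real) set \<Rightarrow>
    ((nat \<Rightarrow> real) \<Rightarrow> real ^ 'd \<Rightarrow> 'b) set" where
  "tensor X S = {\<lambda>y x. \<Sum>i<n. s i y *\<^sub>R v i x | (n::nat) s v. \<forall>i<n. s i \<in> S \<and> v i \<in> X}"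

definition inf_sup_stable ::
  "(real ^ 'd) set \<Rightarrow> (real ^ 'd \<Rightarrow> real ^ 'd) set \<Rightarrow> (real ^ 'd \<Rightarrow> real) set \<Rightarrow> real \<Rightarrow> bool" where
  "inf_sup_stable D V W g \<longleftrightarrow> g > 0 \<and>
     (\<forall>q \<in> W. ereal (g * L2_norm (vol D) q) \<le>
        (SUP v \<in> {v \<in> V. \<not> (AE x in vol D. v x = 0)}.
           ereal ((\<integral>x. q x * dvg D v x \<partial>vol D) / L2_norm (vol D) (grad D v))))"

definition korn_constant :: "(real ^ 'd) set \<Rightarrow> (real ^ 'd) set \<Rightarrow> real \<Rightarrow> bool" where
  "korn_constant D \<Gamma>\<^sub>D C \<longleftrightarrow> 0 < C \<and> C \<le> 1 \<and>
     (\<forall>v \<in> H1_E0 D \<Gamma>\<^sub>D.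
        (\<integral>x. strain D v x \<bullet> strain D v x \<partial>vol D) \<ge> C * (L2_norm (vol D) (grad D v))\<^sup>2)"
  \<comment> \<open>Here and below \<open>\<bullet>\<close> on matrices is the Frobenius product \<open>A : B\<close>.\<close>

definition cbs_vector :: "(real ^ 'd) set \<Rightarrow> (real ^ 'd \<Rightarrow> real ^ 'd) set \<Rightarrow>
    (real ^ 'd \<Rightarrow> real ^ 'd) set \<Rightarrow> real \<Rightarrow> bool" where
  "cbs_vector D V V' g \<longleftrightarrow> 0 \<le> g \<and> g < 1 \<and>
     (\<forall>v \<in> V. \<forall>v' \<in> V'. \<bar>\<integral>x. grad D v x \<bullet> grad D v' x \<partial>vol D\<bar>
        \<le> g * L2_norm (vol D) (grad D v) * L2_norm (vol D) (grad D v'))"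

definition cbs_scalar :: "(real ^ 'd) set \<Rightarrow> (real ^ 'd \<Rightarrow> real) set \<Rightarrow>
    (real ^ 'd \<Rightarrow> real) set \<Rightarrow> real \<Rightarrow> bool" where
  "cbs_scalar D W W' g \<longleftrightarrow> 0 \<le> g \<and> g < 1 \<and>
     (\<forall>q \<in> W. \<forall>q' \<in> W'. \<bar>\<integral>x. q x * q' x \<partial>vol D\<bar>
        \<le> g * L2_norm (vol D) q * L2_norm (vol D) q')"

text \<open>A random field is a function of the parameter \<open>y\<close> and then of the point \<open>x\<close>; the gradient acts on
  the slice at fixed \<open>y\<close>.\<close>

type_synonym 'd vfield = "(nat \<Rightarrow> real) \<Rightarrow> real ^ 'd \<Rightarrow> real ^ 'd"
type_synonym 'd sfield = "(nat \<Rightarrow> real) \<Rightarrow> real ^ 'd \<Rightarrow> real"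

abbreviation double_integral ::
  "(real ^ 'd) set \<Rightarrow> ((nat \<Rightarrow> real) \<Rightarrow> real ^ 'd \<Rightarrow> real) \<Rightarrow> real" where
  "double_integral D F \<equiv> (\<integral>y. (\<integral>x. F y x \<partial>vol D) \<partial>param_measure)"

definition form_a :: "(real ^ 'd) set \<Rightarrow> real \<Rightarrow> (real ^ 'd \<Rightarrow> (nat \<Rightarrow> real) \<Rightarrow> real) \<Rightarrow>
    'd vfield \<Rightarrow> 'd vfield \<Rightarrow> real" where
  "form_a D \<alpha> E u v =
     \<alpha> * double_integral D (\<lambda>y x. E x y * (strain D (u y) x \<bullet> strain D (v y) x))"

definition form_b :: "(real ^ 'd) set \<Rightarrow> 'd vfield \<Rightarrow> 'd sfield \<Rightarrow> real" where
  "form_b D v p = - double_integral D (\<lambda>y x. p y x * dvg D (v y) x)"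

definition form_c :: "(real ^ 'd) set \<Rightarrow> real \<Rightarrow> real \<Rightarrow> 'd sfield \<Rightarrow> 'd sfield \<Rightarrow> real" where
  "form_c D \<alpha> \<beta> p q = 1 / (\<alpha> * \<beta>) * double_integral D (\<lambda>y x. p y x * q y x)"

definition form_d :: "(real ^ 'd) set \<Rightarrow> real \<Rightarrow> real \<Rightarrow> (real ^ 'd \<Rightarrow> (nat \<Rightarrow> real) \<Rightarrow> real) \<Rightarrow>
    'd sfield \<Rightarrow> 'd sfield \<Rightarrow> real" where
  "form_d D \<alpha> \<beta> E p q = 1 / (\<alpha> * \<beta>) * double_integral D (\<lambda>y x. E x y * p y x * q y x)"

definition load :: "(real ^ 'd) set \<Rightarrow> (real ^ 'd \<Rightarrow> real ^ 'd) \<Rightarrow> 'd vfield \<Rightarrow> real" where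
  "load D f v = double_integral D (\<lambda>y x. f x \<bullet> v y x)"

definition form_a0 :: "(real ^ 'd) set \<Rightarrow> real \<Rightarrow> 'd vfield \<Rightarrow> 'd vfield \<Rightarrow> real" where
  "form_a0 D \<alpha> u v = \<alpha> * double_integral D (\<lambda>y x. grad D (u y) x \<bullet> grad D (v y) x)"

definition form_cbar :: "(real ^ 'd) set \<Rightarrow> real \<Rightarrow> real \<Rightarrow> 'd sfield \<Rightarrow> 'd sfield \<Rightarrow> real" where
  "form_cbar D \<alpha> \<beta> p q =
     (1 / \<alpha> + 1 / (\<alpha> * \<beta>)) * double_integral D (\<lambda>y x. p y x * q y x)"

definition form_d0 :: "(real ^ 'd) set \<Rightarrow> real \<Rightarrow> real \<Rightarrow> 'd sfield \<Rightarrow> 'd sfield \<Rightarrow> real" where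
  "form_d0 D \<alpha> \<beta> p q = 1 / (\<alpha> * \<beta>) * double_integral D (\<lambda>y x. p y x * q y x)"

definition W_norm :: "(real ^ 'd) set \<Rightarrow> 'd sfield \<Rightarrow> real" where
  "W_norm D q = sqrt (double_integral D (\<lambda>y x. (q y x)\<^sup>2))"

definition grad_W_norm :: "(real ^ 'd) set \<Rightarrow> 'd vfield \<Rightarrow> real" where
  "grad_W_norm D v = sqrt (double_integral D (\<lambda>y x. (norm (grad D (v y) x))\<^sup>2))"

definition triple_norm :: "(real ^ 'd) set \<Rightarrow> real \<Rightarrow> real \<Rightarrow>
    'd vfield \<Rightarrow> 'd sfield \<Rightarrow> 'd sfield \<Rightarrow> real" where
  "triple_norm D \<alpha> \<beta> v q r = sqrt (\<alpha> * (grad_W_norm D v)\<^sup>2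
     + (1 / \<alpha> + 1 / (\<alpha> * \<beta>)) * (W_norm D q)\<^sup>2 + 1 / (\<alpha> * \<beta>) * (W_norm D r)\<^sup>2)"

definition galerkin_solution :: "(real ^ 'd) set \<Rightarrow> real \<Rightarrow> real \<Rightarrow>
    (real ^ 'd \<Rightarrow> (nat \<Rightarrow> real) \<Rightarrow> real) \<Rightarrow> (real ^ 'd \<Rightarrow> real ^ 'd) \<Rightarrow>
    'd vfield set \<Rightarrow> 'd sfield set \<Rightarrow> 'd vfield \<Rightarrow> 'd sfield \<Rightarrow> 'd sfield \<Rightarrow> bool" where
  "galerkin_solution D \<alpha> \<beta> E f X Y u p pt \<longleftrightarrow> u \<in> X \<and> p \<in> Y \<and> pt \<in> Y \<and>
     (\<forall>v \<in> X. form_a D \<alpha> E u v + form_b D v p = load D f v) \<and>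
     (\<forall>q \<in> Y. form_b D u q - form_c D \<alpha> \<beta> pt q = 0) \<and>
     (\<forall>q \<in> Y. - form_c D \<alpha> \<beta> p q + form_d D \<alpha> \<beta> E pt q = 0)"

definition res_u :: "(real ^ 'd) set \<Rightarrow> real \<Rightarrow> (real ^ 'd \<Rightarrow> (nat \<Rightarrow> real) \<Rightarrow> real) \<Rightarrow>
    (real ^ 'd \<Rightarrow> real ^ 'd) \<Rightarrow> 'd vfield \<Rightarrow> 'd sfield \<Rightarrow> 'd vfield \<Rightarrow> real" where
  "res_u D \<alpha> E f u p v = load D f v - form_a D \<alpha> E u v - form_b D v p"

definition res_p :: "(real ^ 'd) set \<Rightarrow> real \<Rightarrow> real \<Rightarrow>
    'd vfield \<Rightarrow> 'd sfield \<Rightarrow> 'd sfield \<Rightarrow> real" where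
  "res_p D \<alpha> \<beta> u pt q = - form_b D u q + form_c D \<alpha> \<beta> pt q"

definition res_pt :: "(real ^ 'd) set \<Rightarrow> real \<Rightarrow> real \<Rightarrow> (real ^ 'd \<Rightarrow> (nat \<Rightarrow> real) \<Rightarrow> real) \<Rightarrow>
    'd sfield \<Rightarrow> 'd sfield \<Rightarrow> 'd sfield \<Rightarrow> real" where
  "res_pt D \<alpha> \<beta> E p pt q = form_c D \<alpha> \<beta> p q - form_d D \<alpha> \<beta> E pt q"

definition represents_on ::
  "('f \<Rightarrow> 'f \<Rightarrow> real) \<Rightarrow> ('f \<Rightarrow> real) \<Rightarrow> 'f set \<Rightarrow> 'f \<Rightarrow> bool" where
  "represents_on B R X z \<longleftrightarrow> z \<in> X \<and> (\<forall>v \<in> X. B z v = R v)"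

definition induced_norm :: "('f \<Rightarrow> 'f \<Rightarrow> real) \<Rightarrow> 'f \<Rightarrow> real" where
  "induced_norm B v = sqrt (B v v)"

definition eta_spatial :: "(real ^ 'd) set \<Rightarrow> real \<Rightarrow> real \<Rightarrow>
    'd vfield \<Rightarrow> 'd sfield \<Rightarrow> 'd sfield \<Rightarrow> real" where
  "eta_spatial D \<alpha> \<beta> zu zp zpt = sqrt ((induced_norm (form_a0 D \<alpha>) zu)\<^sup>2
     + (induced_norm (form_cbar D \<alpha> \<beta>) zp)\<^sup>2 + (induced_norm (form_d0 D \<alpha> \<beta>) zpt)\<^sup>2)"

definition eta_parametric :: "(real ^ 'd) set \<Rightarrow> real \<Rightarrow> real \<Rightarrow> 'd vfield \<Rightarrow> 'd sfield \<Rightarrow> real" where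
  "eta_parametric D \<alpha> \<beta> zu zpt = sqrt ((induced_norm (form_a0 D \<alpha>) zu)\<^sup>2
     + (induced_norm (form_d0 D \<alpha> \<beta>) zpt)\<^sup>2)"

definition const_C6 :: "nat \<Rightarrow> real \<Rightarrow> real" where
  "const_C6 d Emax = inverse (sqrt 3 * max (Emax + sqrt (real d)) (1 + sqrt (real d)))"

text \<open>In the next three constants \<open>g\<close> is an inf-sup constant.\<close>

definition const_C1 :: "real \<Rightarrow> real \<Rightarrow> real \<Rightarrow> real" where
  "const_C1 CK g Emax = 1 / 2 * Min {CK, g\<^sup>2 / Emax\<^sup>2, 1 / Emax\<^sup>2}"

definition const_C2 :: "real \<Rightarrow> real \<Rightarrow> real" where
  "const_C2 g Emax = sqrt (2 * (Emax\<^sup>2 + g\<^sup>2 + 1)) / Emax"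

definition const_C7 :: "real \<Rightarrow> real \<Rightarrow> real \<Rightarrow> real \<Rightarrow> real" where
  "const_C7 CK g Emin Emax = const_C2 g Emax / (const_C1 CK g Emax * Emin)"
  \<comment> \<open>The parametric enrichment leaves the finite element pair unchanged, so its upper bound needs an
      inf-sup constant of the original pair. The bound is stated with \<open>g = min \<gamma>\<^sub>h \<gamma>\<^sub>h\<^sup>*\<close>, which is
      \<open>\<gamma>\<^sub>h\<^sup>*\<close> as soon as \<open>\<gamma>\<^sub>h\<^sup>*\<close> is no larger than the constant \<open>\<gamma>\<^sub>h\<close>
      of the original pair; it is false with \<open>g = \<gamma>\<^sub>h\<^sup>*\<close> if \<open>\<gamma>\<^sub>h\<close> is much smaller than \<open>\<gamma>\<^sub>h\<^sup>*\<close>.\<close>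

end

theory Submission
  imports Defs "HOL-Library.Function_Algebras" "HOL-Real_Asymp.Real_Asymp"
begin

text \<open>For an enriched pair of spaces the error between the enhanced and the original Galerkin solution
  tested with \<open>(v, q, t)\<close> equals the residual of the original solution at \<open>(v, q, t)\<close>. The lower bounds
  follow by testing with the proxies and using continuity of the forms. For the upper bounds, the error
  \<open>(w, r, s)\<close> is tested with \<open>(w + \<delta> v', - r, s - \<epsilon> r)\<close>, where \<open>v'\<close> realises the inf-sup condition for \<open>r\<close>.
  The residual vanishes on the original spaces, so only the component of the test function in
  the added spaces matters. Its norm is controlled by the strengthened Cauchy-Schwarz inequality
  at each parameter value (spatial enrichment) or by orthogonality of the Legendre polynomials
  (parametric enrichment). The inf-sup condition passes to the tensor product spaces by applying
  at each parameter value the Riesz representer of \<open>v \<mapsto> \<integral> q div v\<close>.\<close>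

subsection \<open>Bilinear forms and the saddle point estimate\<close>

text \<open>Without the two shifts the couplings cancel: the energies of \<open>w\<close> and
  \<open>s\<close> remain, but \<open>r\<close> has no diagonal term. The shift by \<open>v'\<close>
  recovers the part of the norm of \<open>r\<close> with weight 1/\<alpha>, the shift by
  \<open>r\<close> in the third component the part with weight 1/(\<alpha>\<beta>). The three
  entries of the minimum in \<open>const_C1\<close> stem from Korn's inequality and these two
  shifts, its factor 1/2 from absorbing cross terms by Young's inequality; \<open>const_C2\<close>
  bounds the size of the test triple relative to the error. Neither \<alpha> nor \<beta> enters the
  constants, as each weight is matched by a contribution of the same weight. The analytic obstacle
  is that fields are functions rather than classes: the forms are only semidefinite, and the weak
  gradient is an arbitrary choice on each slice, linear only up to null sets. The products are
  therefore first identified, on suitable subspaces, with weighted integrals over the product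
  measure, and the algebra is done for abstract semidefinite forms.\<close>

instantiation "fun" :: (type, real_vector) real_vector
begin
definition scaleR_fun_def: "c *\<^sub>R f = (\<lambda>x. c *\<^sub>R f x)"
instance
  by standard (auto simp: scaleR_fun_def fun_eq_iff scaleR_add_right scaleR_add_left)
end

lemma scaleR_fun_apply [simp]: "(c *\<^sub>R f) x = c *\<^sub>R f x"
  by (simp add: scaleR_fun_def)

text \<open>Relative to carrier sets, because the integrals behind the forms are additive on square
  integrable fields and not on the whole function type.\<close>

definition bilinear_on ::
  "'a::real_vector set \<Rightarrow> 'b::real_vector set \<Rightarrow> ('a \<Rightarrow> 'b \<Rightarrow> real) \<Rightarrow> bool" where
  "bilinear_on U W B \<longleftrightarrow>
     (\<forall>x\<in>U. \<forall>x'\<in>U. \<forall>y\<in>W. B (x + x') y = B x y + B x' y) \<and>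
     (\<forall>c. \<forall>x\<in>U. \<forall>y\<in>W. B (c *\<^sub>R x) y = c * B x y) \<and>
     (\<forall>x\<in>U. \<forall>y\<in>W. \<forall>y'\<in>W. B x (y + y') = B x y + B x y') \<and>
     (\<forall>c. \<forall>x\<in>U. \<forall>y\<in>W. B x (c *\<^sub>R y) = c * B x y)"

lemma bilinear_on_add_left: "bilinear_on U W B \<Longrightarrow> x \<in> U \<Longrightarrow> x' \<in> U \<Longrightarrow> y \<in> W \<Longrightarrow> B (x + x') y = B x y + B x' y"
  and bilinear_on_scale_left: "bilinear_on U W B \<Longrightarrow> x \<in> U \<Longrightarrow> y \<in> W \<Longrightarrow> B (c *\<^sub>R x) y = c * B x y"
  and bilinear_on_add_right: "bilinear_on U W B \<Longrightarrow> x \<in> U \<Longrightarrow> y \<in> W \<Longrightarrow> y' \<in> W \<Longrightarrow> B x (y + y') = B x y + B x y'"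
  and bilinear_on_scale_right: "bilinear_on U W B \<Longrightarrow> x \<in> U \<Longrightarrow> y \<in> W \<Longrightarrow> B x (c *\<^sub>R y) = c * B x y"
  by (auto simp: bilinear_on_def)

lemma bilinear_on_subset: "bilinear_on U W B \<Longrightarrow> U' \<subseteq> U \<Longrightarrow> W' \<subseteq> W \<Longrightarrow> bilinear_on U' W' B"
  by (auto simp: bilinear_on_def subset_iff)

lemma bilinear_on_diff_left:
  assumes "bilinear_on U W B" "subspace U" "x \<in> U" "x' \<in> U" "y \<in> W"
  shows "B (x - x') y = B x y - B x' y"
  using bilinear_on_add_left[OF assms(1,3), of "(-1) *\<^sub>R x'" y]
    bilinear_on_scale_left[OF assms(1,4,5), of "-1"] assms
  by (simp add: subspace_neg)

lemma bilinear_on_zero_left: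
  assumes "bilinear_on U W B" "subspace U" "y \<in> W"
  shows "B 0 y = 0"
  using bilinear_on_scale_left[OF assms(1), of 0 y 0] assms by (simp add: subspace_0)

lemma bilinear_on_zero_right:
  assumes "bilinear_on U W B" "subspace W" "x \<in> U"
  shows "B x 0 = 0"
  using bilinear_on_scale_right[OF assms(1), of x 0 0] assms by (simp add: subspace_0)

text \<open>Only semidefinite: a field that vanishes almost everywhere has norm 0 without being the
  zero function.\<close>

locale psd_form =
  fixes U :: "'a::real_vector set" and B :: "'a \<Rightarrow> 'a \<Rightarrow> real"
  assumes sub: "subspace U"
    and bil: "bilinear_on U U B"
    and sym: "\<And>x y. x \<in> U \<Longrightarrow> y \<in> U \<Longrightarrow> B x y = B y x"
    and nonneg: "\<And>x. x \<in> U \<Longrightarrow> 0 \<le> B x x"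
begin

lemma expand:
  assumes "x \<in> U" "y \<in> U"
  shows "B (x + c *\<^sub>R y) (x + c *\<^sub>R y) = B x x + 2 * c * B x y + c\<^sup>2 * B y y"
proof -
  have "c *\<^sub>R y \<in> U" "x + c *\<^sub>R y \<in> U"
    using sub assms by (auto intro: subspace_add subspace_scale)
  then show ?thesis
    using assms sym[OF assms]
    by (simp add: bilinear_on_add_left[OF bil] bilinear_on_add_right[OF bil]
        bilinear_on_scale_left[OF bil] bilinear_on_scale_right[OF bil] algebra_simps power2_eq_square)
qed

lemma Cauchy_Schwarz:
  assumes "x \<in> U" "y \<in> U"
  shows "(B x y)\<^sup>2 \<le> B x x * B y y"
proof (cases "B y y = 0")
  case True
  have "B x y = 0"
  proof (rule ccontr)
    assume *: "B x y \<noteq> 0"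
    \<comment> \<open>The quadratic polynomial in \<open>c\<close> is affine here; this argument
      gives it the value -1.\<close>
    define c where "c = - (B x x + 1) / (2 * B x y)"
    have "0 \<le> B (x + c *\<^sub>R y) (x + c *\<^sub>R y)"
      using sub assms by (auto intro!: nonneg subspace_add subspace_scale)
    also have "\<dots> = B x x + 2 * c * B x y"
      by (simp add: expand assms True)
    also have "\<dots> = -1"
      using * by (simp add: c_def field_simps)
    finally show False by simp
  qed
  with True show ?thesis by simp
next
  case False
  with nonneg[OF assms(2)] have pos: "B y y > 0" by simp
  \<comment> \<open>The minimiser of the quadratic polynomial in \<open>c\<close>.\<close>
  define c where "c = - B x y / B y y"
  have "0 \<le> B (x + c *\<^sub>R y) (x + c *\<^sub>R y)"
    using sub assms by (auto intro!: nonneg subspace_add subspace_scale)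
  also have "\<dots> = B x x - (B x y)\<^sup>2 / B y y"
    unfolding expand[OF assms] using pos by (simp add: c_def power2_eq_square field_simps)
  finally show ?thesis
    using pos by (simp add: field_simps)
qed

lemma Cauchy_Schwarz_sqrt:
  assumes "x \<in> U" "y \<in> U"
  shows "\<bar>B x y\<bar> \<le> sqrt (B x x) * sqrt (B y y)"
  using real_sqrt_le_mono[OF Cauchy_Schwarz[OF assms]] by (simp add: real_sqrt_mult)

text \<open>The weight is shared evenly by both factors, to match the weighted summands of
  \<open>energy\<close>.\<close>

lemma Cauchy_Schwarz_scaled:
  assumes "0 \<le> c" "x \<in> U" "y \<in> U"
  shows "\<bar>c * B x y\<bar> \<le> sqrt (c * B x x) * sqrt (c * B y y)"
proof -
  have "\<bar>c * B x y\<bar> \<le> c * (sqrt (B x x) * sqrt (B y y))"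
    using mult_left_mono[OF Cauchy_Schwarz_sqrt[OF assms(2,3)] assms(1)] assms(1)
    by (simp add: abs_mult)
  also have "\<dots> = (sqrt c * sqrt c) * (sqrt (B x x) * sqrt (B y y))"
    using assms by simp
  also have "\<dots> = sqrt (c * B x x) * sqrt (c * B y y)"
    by (simp only: real_sqrt_mult mult_ac)
  finally show ?thesis .
qed

text \<open>Nonnegativity at \<open>x - c y\<close> bounds the mixed term by the two
  squares.\<close>

lemma norm_add_le:
  assumes "x \<in> U" "y \<in> U"
  shows "B (x + c *\<^sub>R y) (x + c *\<^sub>R y) \<le> 2 * B x x + 2 * c\<^sup>2 * B y y"
proof -
  have "0 \<le> B (x + (-c) *\<^sub>R y) (x + (-c) *\<^sub>R y)"
    using sub assms by (intro nonneg subspace_add subspace_scale)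
  then show ?thesis
    unfolding expand[OF assms] by (simp add: algebra_simps)
qed

text \<open>Nonnegativity at \<open>x + c y\<close>. The mixed term costs half of
  \<open>B x x\<close>, whence the factor 1/2 in \<open>const_C1\<close>.\<close>

lemma Young:
  assumes "x \<in> U" "y \<in> U"
  shows "- (B x x / 2) - c\<^sup>2 / 2 * B y y \<le> c * B x y"
proof -
  have "0 \<le> B (x + c *\<^sub>R y) (x + c *\<^sub>R y)"
    using sub assms by (intro nonneg subspace_add subspace_scale)
  then show ?thesis
    unfolding expand[OF assms] by simp
qed

end

section \<open>The abstract mixed problem and its stability\<close>

lemma sum3_le_sqrt:
  fixes a b c x y z :: real
  shows "a * x + b * y + c * z \<le> sqrt (a\<^sup>2 + b\<^sup>2 + c\<^sup>2) * sqrt (x\<^sup>2 + y\<^sup>2 + z\<^sup>2)"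
proof -
  have "inner (a, b, c) (x, y, z) \<le> norm (a, b, c) * norm (x, y, z)"
    by (rule norm_cauchy_schwarz)
  then show ?thesis
    by (simp add: norm_Pair add.assoc)
qed

text \<open>The carriers are meant to be the spaces of the enriched problem. \<open>g\<close> and
  \<open>m\<close> stand for the gradient and L2 products, \<open>a\<close> and \<open>d\<close> for
  their counterparts weighted with the modulus (\<open>a\<close> with strains in place of
  gradients), \<open>\<kappa>\<close> for 1/(\<alpha>\<beta>) and \<open>n\<close> for sqrt d, the
  bound of the divergence by the gradient. Korn's inequality is built into
  \<open>a_lower\<close>.\<close>

locale mixed_problem =
  V: psd_form V g + V_E: psd_form V a + W: psd_form W m + W_E: psd_form W d
  for V :: "'v::real_vector set" and g a and W :: "'w::real_vector set" and m d +
  fixes b :: "'v \<Rightarrow> 'w \<Rightarrow> real" and \<alpha> \<kappa> Emin Emax CK n :: real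
  assumes b_bil: "bilinear_on V W b"
    and pos: "0 < \<alpha>" "0 < \<kappa>" "0 < Emin" "0 < CK" "CK \<le> 1" "1 \<le> n"
    and Emin_le: "Emin \<le> Emax"
    and a_lower: "\<And>v. v \<in> V \<Longrightarrow> Emin * CK * g v v \<le> a v v"
    and a_upper: "\<And>v. v \<in> V \<Longrightarrow> a v v \<le> Emax * g v v"
    and d_lower: "\<And>q. q \<in> W \<Longrightarrow> Emin * m q q \<le> d q q"
    and d_upper: "\<And>q. q \<in> W \<Longrightarrow> d q q \<le> Emax * m q q"
    and b_bound: "\<And>v q. v \<in> V \<Longrightarrow> q \<in> W \<Longrightarrow> \<bar>b v q\<bar> \<le> n * sqrt (g v v) * sqrt (m q q)"
begin

text \<open>The square of the triple norm.\<close>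

definition energy :: "'v \<Rightarrow> 'w \<Rightarrow> 'w \<Rightarrow> real" where
  "energy v q t = \<alpha> * g v v + (1 / \<alpha> + \<kappa>) * m q q + \<kappa> * m t t"

text \<open>The left sides of the three Galerkin equations added up, with trial triple
  \<open>(w, r, s)\<close> and test triple \<open>(v, q, t)\<close>.\<close>

definition total_form :: "'v \<Rightarrow> 'w \<Rightarrow> 'w \<Rightarrow> 'v \<Rightarrow> 'w \<Rightarrow> 'w \<Rightarrow> real" where
  "total_form w r s v q t =
     (\<alpha> * a w v + b v r) + (b w q - \<kappa> * m s q) + (- \<kappa> * m r t + \<kappa> * d s t)"

lemma Emax_pos: "0 < Emax"
  using pos Emin_le by simp

lemma energy_nonneg: "v \<in> V \<Longrightarrow> q \<in> W \<Longrightarrow> t \<in> W \<Longrightarrow> 0 \<le> energy v q t"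
  using pos V.nonneg W.nonneg by (simp add: energy_def)

lemma energy_Cauchy_Schwarz:
  assumes "z \<in> V" "zp \<in> W" "zt \<in> W" "v \<in> V" "q \<in> W" "t \<in> W"
  shows "\<alpha> * g z v + (1 / \<alpha> + \<kappa>) * m zp q + \<kappa> * m zt t \<le> sqrt (energy z zp zt) * sqrt (energy v q t)"
proof -
  let ?k = "1 / \<alpha> + \<kappa>"
  have k: "0 \<le> ?k" using pos by simp
  have "\<alpha> * g z v \<le> sqrt (\<alpha> * g z z) * sqrt (\<alpha> * g v v)"
    using V.Cauchy_Schwarz_scaled[OF _ assms(1,4), of \<alpha>] pos by simp
  moreover have "?k * m zp q \<le> sqrt (?k * m zp zp) * sqrt (?k * m q q)"
    using W.Cauchy_Schwarz_scaled[OF k assms(2,5)] by simp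
  moreover have "\<kappa> * m zt t \<le> sqrt (\<kappa> * m zt zt) * sqrt (\<kappa> * m t t)"
    using W.Cauchy_Schwarz_scaled[OF _ assms(3,6), of \<kappa>] pos by simp
  ultimately have "\<alpha> * g z v + ?k * m zp q + \<kappa> * m zt t
      \<le> sqrt (\<alpha> * g z z) * sqrt (\<alpha> * g v v) + sqrt (?k * m zp zp) * sqrt (?k * m q q)
         + sqrt (\<kappa> * m zt zt) * sqrt (\<kappa> * m t t)"
    by simp
  also note sum3_le_sqrt
  finally show ?thesis
    using pos k V.nonneg W.nonneg assms by (simp add: energy_def)
qed

text \<open>The shifts of the test triple produce \<open>\<delta> * b v' r\<close> and
  \<open>\<epsilon> * \<kappa> * m r r\<close>. Their price is the cross terms \<open>a w v'\<close>
  and \<open>d s r\<close>, which \<open>Young\<close> absorbs into half of \<open>a w w\<close> and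
  \<open>d s s\<close>.\<close>

lemma stability:
  assumes X: "subspace X" "X \<subseteq> V" and Y: "subspace Y" "Y \<subseteq> W"
    and inf_sup: "\<And>r. r \<in> Y \<Longrightarrow> \<exists>v\<in>X. g v v \<le> m r r \<and> \<gamma> * m r r \<le> b v r"
    and \<gamma>: "0 < \<gamma>"
    and w: "w \<in> X" and r: "r \<in> Y" and s: "s \<in> Y"
  obtains v q t where "v \<in> X" "q \<in> Y" "t \<in> Y"
    "const_C1 CK \<gamma> Emax * Emin * energy w r s \<le> total_form w r s v q t"
    "energy v q t \<le> (const_C2 \<gamma> Emax)\<^sup>2 * energy w r s"
proof -
  obtain v' where v': "v' \<in> X" "g v' v' \<le> m r r" "\<gamma> * m r r \<le> b v' r"
    using inf_sup[OF r] by auto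
  have inV: "w \<in> V" "v' \<in> V" "r \<in> W" "s \<in> W"
    using w v' r s X Y by auto
  \<comment> \<open>Both parameters maximise the net gain for \<open>r\<close>, which is
    \<open>\<delta> * \<gamma> - \<alpha> * \<delta>\<^sup>2 * Emax / 2\<close> and
    \<open>\<kappa> * (\<epsilon> - \<epsilon>\<^sup>2 * Emax / 2)\<close> respectively.\<close>
  define \<delta> where "\<delta> = \<gamma> / (\<alpha> * Emax)"
  define \<epsilon> where "\<epsilon> = 1 / Emax"
  have E: "Emax > 0" by (rule Emax_pos)
  have \<delta>: "\<delta> > 0" using \<gamma> pos E by (simp add: \<delta>_def)
  define v where "v = w + \<delta> *\<^sub>R v'"
  define q where "q = (-1) *\<^sub>R r"
  define t where "t = s + (- \<epsilon>) *\<^sub>R r"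
  define A P S where "A = g w w" and "P = m r r" and "S = m s s"
  have nn: "A \<ge> 0" "P \<ge> 0" "S \<ge> 0"
    using V.nonneg W.nonneg inV by (auto simp: A_def P_def S_def)
  have mem: "v \<in> X" "q \<in> Y" "t \<in> Y"
    unfolding v_def q_def t_def using X Y w r s v' by (blast intro: subspace_add subspace_scale)+
  have scl: "\<delta> *\<^sub>R v' \<in> V" "(- \<epsilon>) *\<^sub>R r \<in> W"
    using X Y v' r by (blast intro: subspace_scale)+
  \<comment> \<open>The terms \<open>b w r\<close> and \<open>\<kappa> * m s r\<close> occur with
    both signs and cancel.\<close>
  have "total_form w r s v q t = \<alpha> * a w w + \<alpha> * (\<delta> * a w v') + \<delta> * b v' r + \<kappa> * d s s
      + \<kappa> * ((- \<epsilon>) * d s r) + \<epsilon> * \<kappa> * P"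
    unfolding total_form_def v_def q_def t_def P_def
    using inV scl W.sym[of s r]
    by (simp only: bilinear_on_add_left[OF b_bil] bilinear_on_scale_left[OF b_bil]
        bilinear_on_scale_right[OF b_bil]
        bilinear_on_add_right[OF V_E.bil] bilinear_on_scale_right[OF V_E.bil]
        bilinear_on_add_right[OF W_E.bil] bilinear_on_scale_right[OF W_E.bil]
        bilinear_on_add_right[OF W.bil] bilinear_on_scale_right[OF W.bil])
      (simp add: algebra_simps)
  moreover have "\<alpha> * (- (a w w / 2) - \<delta>\<^sup>2 / 2 * (Emax * P)) \<le> \<alpha> * (\<delta> * a w v')"
  proof (rule mult_left_mono)
    have "a v' v' \<le> Emax * P"
      using order_trans[OF a_upper[OF inV(2)] mult_left_mono[OF v'(2), of Emax]] E by (simp add: P_def)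
    then have "\<delta>\<^sup>2 / 2 * a v' v' \<le> \<delta>\<^sup>2 / 2 * (Emax * P)"
      by (intro mult_left_mono) auto
    then show "- (a w w / 2) - \<delta>\<^sup>2 / 2 * (Emax * P) \<le> \<delta> * a w v'"
      using V_E.Young[OF inV(1,2), of \<delta>] by linarith
  qed (use pos in simp)
  moreover have "\<delta> * (\<gamma> * P) \<le> \<delta> * b v' r"
    using v' \<delta> by (simp add: P_def)
  moreover have "\<kappa> * (- (d s s / 2) - \<epsilon>\<^sup>2 / 2 * (Emax * P)) \<le> \<kappa> * ((- \<epsilon>) * d s r)"
  proof (rule mult_left_mono)
    have "\<epsilon>\<^sup>2 / 2 * d r r \<le> \<epsilon>\<^sup>2 / 2 * (Emax * P)"
      using d_upper[OF inV(3)] by (intro mult_left_mono) (auto simp: P_def)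
    then show "- (d s s / 2) - \<epsilon>\<^sup>2 / 2 * (Emax * P) \<le> (- \<epsilon>) * d s r"
      using W_E.Young[OF inV(4,3), of "- \<epsilon>"] by simp
  qed (use pos in simp)
  ultimately have "\<alpha> * a w w / 2 + \<kappa> * d s s / 2 + (\<delta> * \<gamma> - \<alpha> * \<delta>\<^sup>2 * Emax / 2) * P
      + (\<epsilon> * \<kappa> - \<kappa> * \<epsilon>\<^sup>2 * Emax / 2) * P \<le> total_form w r s v q t"
    by (simp add: algebra_simps)
  moreover have "\<delta> * \<gamma> - \<alpha> * \<delta>\<^sup>2 * Emax / 2 = \<gamma>\<^sup>2 / Emax / \<alpha> / 2"
    using E pos by (simp add: \<delta>_def power2_eq_square field_simps)
  moreover have "\<epsilon> * \<kappa> - \<kappa> * \<epsilon>\<^sup>2 * Emax / 2 = 1 / Emax * \<kappa> / 2"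
    using E pos by (simp add: \<epsilon>_def power2_eq_square field_simps)
  moreover have "\<alpha> * (Emin * CK * A) \<le> \<alpha> * a w w" "\<kappa> * (Emin * S) \<le> \<kappa> * d s s"
    unfolding A_def S_def using a_lower d_lower inV pos by (blast intro: mult_left_mono less_imp_le)+
  ultimately have low: "\<alpha> * A * (Emin * CK) / 2 + \<kappa> * S * Emin / 2 + P / \<alpha> * (\<gamma>\<^sup>2 / Emax) / 2
      + \<kappa> * P * (1 / Emax) / 2 \<le> total_form w r s v q t"
    by (simp add: algebra_simps)
  \<comment> \<open>\<open>Emin * M\<close> has to stay below the four coefficients in
    \<open>low\<close>. For the two coefficients of \<open>P\<close> this rests on
    \<open>Emin \<le> Emax\<close>, which is why \<open>const_C1\<close> carries the square of
    \<open>Emax\<close>.\<close>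
  define M where "M = Min {CK, \<gamma>\<^sup>2 / Emax\<^sup>2, 1 / Emax\<^sup>2}"
  have M: "M \<le> CK" "M \<le> \<gamma>\<^sup>2 / Emax\<^sup>2" "M \<le> 1 / Emax\<^sup>2"
    unfolding M_def by auto
  have M1: "Emin * M \<le> Emin * CK" "Emin * M \<le> Emin"
    using M pos by (auto intro: order_trans[OF mult_left_mono[of M CK Emin]])
  have M2: "Emin * M \<le> \<gamma>\<^sup>2 / Emax"
  proof -
    have "Emin * M \<le> Emin * (\<gamma>\<^sup>2 / Emax\<^sup>2)"
      using M pos by (intro mult_left_mono) auto
    also have "\<dots> \<le> Emax * (\<gamma>\<^sup>2 / Emax\<^sup>2)"
      using Emin_le by (intro mult_right_mono) auto
    finally show ?thesis using E by (simp add: power2_eq_square)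
  qed
  have M3: "Emin * M \<le> 1 / Emax"
  proof -
    have "Emin * M \<le> Emin * (1 / Emax\<^sup>2)"
      using M pos by (intro mult_left_mono) auto
    also have "\<dots> \<le> Emax * (1 / Emax\<^sup>2)"
      using Emin_le by (intro mult_right_mono) auto
    finally show ?thesis using E by (simp add: power2_eq_square)
  qed
  have "const_C1 CK \<gamma> Emax * Emin * energy w r s
      = \<alpha> * A * (Emin * M) / 2 + \<kappa> * S * (Emin * M) / 2 + P / \<alpha> * (Emin * M) / 2 + \<kappa> * P * (Emin * M) / 2"
    unfolding const_C1_def M_def[symmetric] energy_def A_def[symmetric] P_def[symmetric] S_def[symmetric]
    by (simp add: algebra_simps)
  also have "\<dots> \<le> \<alpha> * A * (Emin * CK) / 2 + \<kappa> * S * Emin / 2 + P / \<alpha> * (\<gamma>\<^sup>2 / Emax) / 2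
      + \<kappa> * P * (1 / Emax) / 2"
    using nn pos by (intro add_mono divide_right_mono mult_left_mono M1 M2 M3) auto
  also note low
  finally have 1: "const_C1 CK \<gamma> Emax * Emin * energy w r s \<le> total_form w r s v q t" .
  \<comment> \<open>The size of the test triple; the factor 2 from \<open>norm_add_le\<close>
    reappears in \<open>const_C2\<close>.\<close>
  have "g v v \<le> 2 * A + 2 * \<delta>\<^sup>2 * P"
    using V.norm_add_le[OF inV(1,2), of \<delta>] mult_left_mono[OF v'(2), of "2 * \<delta>\<^sup>2"]
    by (simp add: v_def A_def P_def)
  moreover have "m q q = P"
    unfolding q_def P_def
    using inV W.sub by (simp only: bilinear_on_scale_left[OF W.bil] bilinear_on_scale_right[OF W.bil] subspace_scale)
  moreover have "m t t \<le> 2 * S + 2 * \<epsilon>\<^sup>2 * P"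
    using W.norm_add_le[OF inV(4,3), of "- \<epsilon>"] by (simp add: t_def S_def P_def)
  ultimately have "energy v q t \<le> \<alpha> * (2 * A + 2 * \<delta>\<^sup>2 * P) + (1 / \<alpha> + \<kappa>) * P + \<kappa> * (2 * S + 2 * \<epsilon>\<^sup>2 * P)"
    unfolding energy_def using pos by (intro add_mono mult_left_mono) auto
  also have "\<dots> = \<alpha> * A * 2 + P / \<alpha> * (1 + 2 * \<gamma>\<^sup>2 / Emax\<^sup>2) + \<kappa> * P * (1 + 2 / Emax\<^sup>2) + \<kappa> * S * 2"
    using pos E by (simp add: \<delta>_def \<epsilon>_def field_simps power2_eq_square)
  also have "\<dots> \<le> \<alpha> * A * (const_C2 \<gamma> Emax)\<^sup>2 + P / \<alpha> * (const_C2 \<gamma> Emax)\<^sup>2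
      + \<kappa> * P * (const_C2 \<gamma> Emax)\<^sup>2 + \<kappa> * S * (const_C2 \<gamma> Emax)\<^sup>2"
  proof -
    \<comment> \<open>The coefficients to be dominated are \<open>2\<close>,
      \<open>1 + 2 * \<gamma>\<^sup>2 / Emax\<^sup>2\<close>, \<open>1 + 2 / Emax\<^sup>2\<close>
      and \<open>2\<close>; none exceeds this sum.\<close>
    have "(const_C2 \<gamma> Emax)\<^sup>2 = 2 + 2 * \<gamma>\<^sup>2 / Emax\<^sup>2 + 2 / Emax\<^sup>2"
      using E by (simp add: const_C2_def power_divide field_simps)
    then show ?thesis
      using nn pos by (intro add_mono mult_left_mono) auto
  qed
  also have "\<dots> = (const_C2 \<gamma> Emax)\<^sup>2 * energy w r s"
    by (simp add: energy_def A_def P_def S_def algebra_simps)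
  finally show ?thesis
    using that mem 1 by blast
qed

text \<open>\<open>K\<close> bounds the residual in the dual norm. With N the norm of the error,
  stability gives C1 Emin N^2 <= K C2 N, and cancelling N leaves the quotient
  \<open>const_C7\<close>.\<close>

lemma error_upper_bound:
  assumes X: "subspace X" "X \<subseteq> V" and Y: "subspace Y" "Y \<subseteq> W"
    and inf_sup: "\<And>r. r \<in> Y \<Longrightarrow> \<exists>v\<in>X. g v v \<le> m r r \<and> \<gamma> * m r r \<le> b v r"
    and \<gamma>: "0 < \<gamma>"
    and e: "w \<in> X" "r \<in> Y" "s \<in> Y"
    and K: "0 \<le> K"
      "\<And>v q t. v \<in> X \<Longrightarrow> q \<in> Y \<Longrightarrow> t \<in> Y \<Longrightarrow> total_form w r s v q t \<le> K * sqrt (energy v q t)"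
  shows "sqrt (energy w r s) \<le> const_C7 CK \<gamma> Emin Emax * K"
proof -
  obtain v q t where *: "v \<in> X" "q \<in> Y" "t \<in> Y"
    "const_C1 CK \<gamma> Emax * Emin * energy w r s \<le> total_form w r s v q t"
    "energy v q t \<le> (const_C2 \<gamma> Emax)\<^sup>2 * energy w r s"
    by (rule stability[OF X Y inf_sup \<gamma> e])
  define N where "N = sqrt (energy w r s)"
  have N: "N \<ge> 0" "N\<^sup>2 = energy w r s"
    using energy_nonneg[of w r s] e X Y by (auto simp: N_def)
  have C1: "0 < const_C1 CK \<gamma> Emax"
    using pos \<gamma> Emax_pos by (simp add: const_C1_def)
  have C2: "0 < const_C2 \<gamma> Emax"
    using Emax_pos by (auto simp: const_C2_def intro!: divide_pos_pos add_pos_nonneg)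
  have "sqrt (energy v q t) \<le> const_C2 \<gamma> Emax * N"
    using real_sqrt_le_mono[OF *(5)] C2 by (simp add: real_sqrt_mult N_def)
  with * K have "const_C1 CK \<gamma> Emax * Emin * N\<^sup>2 \<le> K * (const_C2 \<gamma> Emax * N)"
    unfolding N(2) by (meson mult_left_mono order_trans)
  then have "N * (const_C1 CK \<gamma> Emax * Emin * N) \<le> N * (K * const_C2 \<gamma> Emax)"
    by (simp add: power2_eq_square algebra_simps)
  moreover have "0 \<le> K * const_C2 \<gamma> Emax"
    using K C2 by simp
  \<comment> \<open>At \<open>N = 0\<close> nothing can be cancelled, but then the left side is 0
    and the right side nonnegative.\<close>
  ultimately have "const_C1 CK \<gamma> Emax * Emin * N \<le> K * const_C2 \<gamma> Emax"
    using N(1) by (cases "N = 0") (auto simp: mult_le_cancel_left)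
  then show ?thesis
    using C1 pos unfolding N_def[symmetric] const_C7_def by (simp add: field_simps)
qed

text \<open>Each equation in \<open>eq\<close> is the error equation tested with one proxy alone. It
  bounds the corresponding summand of the energy by \<open>K\<^sup>2 * N\<^sup>2\<close>, and the
  three equal bounds add up to the factor sqrt 3.\<close>

lemma error_lower_bound:
  assumes e: "w \<in> V" "r \<in> W" "s \<in> W" and z: "z \<in> V" "q \<in> W" "t \<in> W"
    and eq: "\<alpha> * g z z = \<alpha> * a w z + b z r"
      "(1 / \<alpha> + \<kappa>) * m q q = b w q - \<kappa> * m s q"
      "\<kappa> * m t t = - \<kappa> * m r t + \<kappa> * d s t"
  shows "inverse (sqrt 3 * max (Emax + n) (1 + n)) * sqrt (energy z q t) \<le> sqrt (energy w r s)"
proof -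
  define K where "K = max (Emax + n) (1 + n)"
  define N where "N = sqrt (energy w r s)"
  have E: "Emax > 0" by (rule Emax_pos)
  have K: "K > 0" using E pos by (simp add: K_def)
  have N: "N \<ge> 0" "N\<^sup>2 = energy w r s"
    using energy_nonneg[of w r s] e by (auto simp: N_def)
  have nn: "0 \<le> g w w" "0 \<le> m r r" "0 \<le> m s s" "0 \<le> g z z" "0 \<le> m q q" "0 \<le> m t t"
    using V.nonneg W.nonneg e z by auto
  have x1: "sqrt (\<alpha> * g w w) \<le> N" and x2: "sqrt (1 / \<alpha> * m r r) \<le> N"
    and x2': "sqrt (\<kappa> * m r r) \<le> N" and x3: "sqrt (\<kappa> * m s s) \<le> N"
    using pos nn by (auto simp: N_def energy_def algebra_simps)
  \<comment> \<open>Cancels one root of \<open>y\<close> on both sides; for \<open>y = 0\<close> the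
    claim is trivial.\<close>
  have aux: "y \<le> (c * N)\<^sup>2" if "0 \<le> c" "0 \<le> y" "y \<le> sqrt y * c * N" for y c :: real
  proof -
    have "sqrt y * sqrt y \<le> sqrt y * (c * N)"
      using that by simp
    then have "sqrt y \<le> c * N"
      using that N by (cases "y = 0") (auto simp: mult_le_cancel_left simp del: real_sqrt_mult_self)
    then show ?thesis
      using that by (metis real_sqrt_ge_0_iff real_sqrt_pow2 power_mono)
  qed
  have le_K: "(c * N)\<^sup>2 \<le> K\<^sup>2 * N\<^sup>2" if "0 \<le> c" "c \<le> K" for c
    using power_mono[of c K 2] that by (simp add: power_mult_distrib mult_right_mono)
  have split: "sqrt \<alpha> * sqrt (1 / \<alpha>) = 1"
    using pos by (simp flip: real_sqrt_mult)
  have sq\<kappa>: "sqrt \<kappa> * sqrt \<kappa> = \<kappa>" and sq\<alpha>: "sqrt \<alpha> * sqrt \<alpha> = \<alpha>" and sqE: "sqrt Emax * sqrt Emax = Emax"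
    using pos E by auto
  have ab: "\<alpha> * a w z \<le> Emax * sqrt (\<alpha> * g w w) * sqrt (\<alpha> * g z z)"
  proof -
    have "a w z \<le> sqrt (a w w) * sqrt (a z z)"
      using V_E.Cauchy_Schwarz_sqrt[OF e(1) z(1)] by simp
    also have "\<dots> \<le> sqrt (Emax * g w w) * sqrt (Emax * g z z)"
      using a_upper e z V_E.nonneg by (intro mult_mono real_sqrt_le_mono) (auto simp: E nn less_imp_le)
    also have "\<dots> = Emax * sqrt (g w w) * sqrt (g z z)"
      unfolding real_sqrt_mult by (subst sqE[symmetric]) (simp only: mult_ac)
    finally have "\<alpha> * a w z \<le> \<alpha> * (Emax * sqrt (g w w) * sqrt (g z z))"
      using pos by simp
    also have "\<dots> = Emax * sqrt (\<alpha> * g w w) * sqrt (\<alpha> * g z z)"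
      unfolding real_sqrt_mult by (subst sq\<alpha>[symmetric]) (simp only: mult_ac)
    finally show ?thesis .
  qed
  \<comment> \<open>The weights \<alpha> and 1/\<alpha> cancel, so the coupling is measured by the
    first summand of \<open>energy\<close> and the 1/\<alpha> part of the second.\<close>
  have bb: "\<bar>b v p\<bar> \<le> n * sqrt (\<alpha> * g v v) * sqrt (1 / \<alpha> * m p p)" if "v \<in> V" "p \<in> W" for v p
  proof -
    have "n * sqrt (\<alpha> * g v v) * sqrt (1 / \<alpha> * m p p) = (sqrt \<alpha> * sqrt (1 / \<alpha>)) * (n * sqrt (g v v) * sqrt (m p p))"
      by (simp only: real_sqrt_mult mult_ac)
    also have "\<dots> = n * sqrt (g v v) * sqrt (m p p)"
      unfolding split by simp
    finally have eq: "n * sqrt (\<alpha> * g v v) * sqrt (1 / \<alpha> * m p p) = n * sqrt (g v v) * sqrt (m p p)" .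
    show ?thesis
      unfolding eq by (rule b_bound[OF that])
  qed
  have mb: "\<bar>\<kappa> * m p p'\<bar> \<le> sqrt (\<kappa> * m p p) * sqrt (\<kappa> * m p' p')" if "p \<in> W" "p' \<in> W" for p p'
    using W.Cauchy_Schwarz_scaled[OF _ that] pos by simp
  have db: "\<kappa> * d s t \<le> Emax * sqrt (\<kappa> * m s s) * sqrt (\<kappa> * m t t)"
  proof -
    have "d s t \<le> sqrt (d s s) * sqrt (d t t)"
      using W_E.Cauchy_Schwarz_sqrt[OF e(3) z(3)] by simp
    also have "\<dots> \<le> sqrt (Emax * m s s) * sqrt (Emax * m t t)"
      using d_upper e z W_E.nonneg by (intro mult_mono real_sqrt_le_mono) (auto simp: E nn less_imp_le)
    also have "\<dots> = Emax * sqrt (m s s) * sqrt (m t t)"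
      unfolding real_sqrt_mult by (subst sqE[symmetric]) (simp only: mult_ac)
    finally have "\<kappa> * d s t \<le> \<kappa> * (Emax * sqrt (m s s) * sqrt (m t t))"
      using pos by simp
    also have "\<dots> = Emax * sqrt (\<kappa> * m s s) * sqrt (\<kappa> * m t t)"
      unfolding real_sqrt_mult by (subst sq\<kappa>[symmetric]) (simp only: mult_ac)
    finally show ?thesis .
  qed
  have "\<alpha> * g z z \<le> sqrt (\<alpha> * g z z) * (Emax + n) * N"
  proof -
    have "\<alpha> * g z z \<le> Emax * sqrt (\<alpha> * g w w) * sqrt (\<alpha> * g z z) + n * sqrt (\<alpha> * g z z) * sqrt (1 / \<alpha> * m r r)"
      using eq(1) ab bb[OF z(1) e(2)] by linarith
    also have "\<dots> \<le> Emax * N * sqrt (\<alpha> * g z z) + n * sqrt (\<alpha> * g z z) * N"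
      using x1 x2 E pos nn by (intro add_mono mult_right_mono mult_left_mono) auto
    finally show ?thesis by (simp add: algebra_simps)
  qed
  then have 1: "\<alpha> * g z z \<le> K\<^sup>2 * N\<^sup>2"
    using E pos nn by (intro order_trans[OF aux[where c = "Emax + n"] le_K]) (auto simp: K_def)
  have "(1 / \<alpha> + \<kappa>) * m q q \<le> sqrt ((1 / \<alpha> + \<kappa>) * m q q) * (1 + n) * N"
  proof -
    let ?y = "sqrt ((1 / \<alpha> + \<kappa>) * m q q)"
    \<comment> \<open>The root with the full weight dominates both partial ones, so the two terms of
      the equation share the factor \<open>?y\<close>.\<close>
    have y: "sqrt (1 / \<alpha> * m q q) \<le> ?y" "sqrt (\<kappa> * m q q) \<le> ?y"
      using pos nn by (auto simp: algebra_simps)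
    have "(1 / \<alpha> + \<kappa>) * m q q \<le> n * sqrt (\<alpha> * g w w) * sqrt (1 / \<alpha> * m q q) + sqrt (\<kappa> * m s s) * sqrt (\<kappa> * m q q)"
      using eq(2) bb[OF e(1) z(2)] mb[OF e(3) z(2)] by linarith
    also have "\<dots> \<le> n * N * ?y + N * ?y"
      using x1 x3 y pos nn N by (intro add_mono mult_mono) auto
    finally show ?thesis by (simp add: algebra_simps)
  qed
  then have 2: "(1 / \<alpha> + \<kappa>) * m q q \<le> K\<^sup>2 * N\<^sup>2"
    using E pos nn by (intro order_trans[OF aux[where c = "1 + n"] le_K]) (auto simp: K_def)
  have "\<kappa> * m t t \<le> sqrt (\<kappa> * m t t) * (1 + Emax) * N"
  proof -
    have "\<kappa> * m t t \<le> sqrt (\<kappa> * m r r) * sqrt (\<kappa> * m t t) + Emax * sqrt (\<kappa> * m s s) * sqrt (\<kappa> * m t t)"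
      using eq(3) mb[OF e(2) z(3)] db by linarith
    also have "\<dots> \<le> N * sqrt (\<kappa> * m t t) + Emax * N * sqrt (\<kappa> * m t t)"
      using x2' x3 E pos nn by (intro add_mono mult_right_mono mult_left_mono) auto
    finally show ?thesis by (simp add: algebra_simps)
  qed
  \<comment> \<open>\<open>1 + Emax\<close> is at most \<open>Emax + n\<close> because
    \<open>1 \<le> n\<close>.\<close>
  then have 3: "\<kappa> * m t t \<le> K\<^sup>2 * N\<^sup>2"
    using E pos nn by (intro order_trans[OF aux[where c = "1 + Emax"] le_K]) (auto simp: K_def)
  have "energy z q t \<le> 3 * K\<^sup>2 * N\<^sup>2"
    using 1 2 3 unfolding energy_def by linarith
  then have "sqrt (energy z q t) \<le> sqrt 3 * K * N"
    using K N by (metis real_sqrt_le_mono real_sqrt_mult real_sqrt_abs abs_of_nonneg less_imp_le)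
  then show ?thesis
    using K unfolding K_def[symmetric] N_def[symmetric] by (simp add: field_simps)
qed

end

subsection \<open>Test functions and the fundamental lemma of the calculus of variations\<close>

lemma frechet_derivative_eqI: "(f has_derivative f') (at x) \<Longrightarrow> frechet_derivative f (at x) = f'"
  using frechet_derivative_at by blast

lemma partial_eqI: "(f has_derivative f') (at x) \<Longrightarrow> partial i f x = f' (axis i 1)"
  by (simp add: partial_def frechet_derivative_eqI)

lemma partial_add:
  assumes "\<And>x. f differentiable (at x)" "\<And>x. g differentiable (at x)"
  shows "partial i (\<lambda>x. f x + g x) = (\<lambda>x. partial i f x + partial i g x)"
proof
  fix x
  show "partial i (\<lambda>x. f x + g x) x = partial i f x + partial i g x"
    unfolding partial_def[of i f] partial_def[of i g]
    by (subst partial_eqI[OF has_derivative_add[OF frechet_derivative_works[THEN iffD1] frechet_derivative_works[THEN iffD1]]])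
      (use assms in auto)
qed

lemma partial_mult:
  assumes "\<And>x. f differentiable (at x)" "\<And>x. g differentiable (at x)"
  shows "partial i (\<lambda>x. f x * g x) = (\<lambda>x. f x * partial i g x + partial i f x * g x)"
proof
  fix x
  show "partial i (\<lambda>x. f x * g x) x = f x * partial i g x + partial i f x * g x"
    unfolding partial_def[of i f] partial_def[of i g]
    by (subst partial_eqI[OF has_derivative_mult[OF frechet_derivative_works[THEN iffD1] frechet_derivative_works[THEN iffD1]]])
      (use assms in auto)
qed

lemma Ck_continuous: "Ck k f \<Longrightarrow> continuous_on UNIV f"
  by (cases k) (auto simp: continuous_on_eq_continuous_at differentiable_imp_continuous_within)

lemma Ck_Suc_imp_Ck: "Ck (Suc k) f \<Longrightarrow> Ck k f"
proof (induction k arbitrary: f)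
  case 0
  then show ?case using Ck_continuous[of "Suc 0" f] by simp
next
  case (Suc k)
  then show ?case by (metis Ck.simps(2))
qed

lemma Ck_add: "Ck k f \<Longrightarrow> Ck k g \<Longrightarrow> Ck k (\<lambda>x. f x + g x)"
  by (induction k arbitrary: f g) (auto intro: continuous_on_add simp: partial_add)

lemma Ck_mult: "Ck k f \<Longrightarrow> Ck k g \<Longrightarrow> Ck k (\<lambda>x. f x * g x)"
proof (induction k arbitrary: f g)
  case 0
  then show ?case by (auto intro: continuous_on_mult)
next
  case (Suc k)
  then show ?case
    using Ck_Suc_imp_Ck[OF Suc.prems(1)] Ck_Suc_imp_Ck[OF Suc.prems(2)]
    by (auto simp: partial_mult intro!: Ck_add)
qed

lemma Ck_const: "Ck k (\<lambda>x. c)"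
proof (induction k arbitrary: c)
  case (Suc k)
  have "partial i (\<lambda>x. c) = (\<lambda>x. 0)" for i :: 'a
    by (rule ext) (simp add: partial_eqI[OF has_derivative_const])
  with Suc show ?case by auto
qed auto

lemma smooth_mult: "smooth f \<Longrightarrow> smooth g \<Longrightarrow> smooth (\<lambda>x. f x * g x)"
  by (simp add: smooth_def Ck_mult)

lemma smooth_prod: "(\<And>i. i \<in> I \<Longrightarrow> smooth (f i)) \<Longrightarrow> smooth (\<lambda>x. \<Prod>i\<in>I. f i x)"
  by (induction I rule: infinite_finite_induct) (auto simp: smooth_mult, auto simp: smooth_def Ck_const)

section \<open>Smooth cutoff functions on boxes\<close>

definition flat_exp :: "real poly \<Rightarrow> real \<Rightarrow> real" where
  "flat_exp p t = (if t > 0 then poly p (1 / t) * exp (- (1 / t)) else 0)"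

text \<open>The class of these functions is closed under differentiation because
  \<open>(p(1/t) exp(-1/t))' = ((p(s) - p'(s)) s\<^sup>2) exp(-s)\<close> with \<open>s = 1/t\<close>.\<close>

lemma flat_exp_tendsto_0: "(flat_exp p \<longlongrightarrow> 0) (at 0)"
proof -
  have *: "((\<lambda>s. poly p s * exp (- s)) \<longlongrightarrow> 0) at_top"
  proof (induction p)
    case (pCons a p)
    have "((\<lambda>s::real. s ^ k * exp (- s)) \<longlongrightarrow> 0) at_top" for k
      using tendsto_power_div_exp_0[of k] by (simp add: exp_minus field_simps)
    then have "((\<lambda>s::real. \<Sum>i\<le>degree (pCons a p). coeff (pCons a p) i * (s ^ i * exp (- s))) \<longlongrightarrow> (\<Sum>i\<le>degree (pCons a p). coeff (pCons a p) i * 0)) at_top"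
      by (intro tendsto_intros)
    then show ?case
      by (simp add: poly_altdef sum_distrib_right mult.assoc)
  qed auto
  have "((\<lambda>t. poly p (inverse t) * exp (- inverse t)) \<longlongrightarrow> 0) (at_right 0)"
    by (rule filterlim_compose[OF * filterlim_inverse_at_top_right])
  then have "(flat_exp p \<longlongrightarrow> 0) (at_right 0)"
    by (rule Lim_transform_eventually) (auto simp: flat_exp_def eventually_at_filter inverse_eq_divide)
  moreover have "(flat_exp p \<longlongrightarrow> 0) (at_left 0)"
    by (rule Lim_transform_eventually[OF tendsto_const]) (auto simp: flat_exp_def eventually_at_filter)
  ultimately show ?thesis
    by (rule filterlim_split_at_real[rotated])
qed

lemma has_derivative_flat_exp:
  "(flat_exp p has_real_derivative flat_exp ((p - pderiv p) * [:0, 0, 1:]) t) (at t)"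
proof -
  consider "t > 0" | "t < 0" | "t = 0" by linarith
  then show ?thesis
  proof cases
    case 1
    have "((\<lambda>t. poly p (1 / t) * exp (- (1 / t))) has_real_derivative
        flat_exp ((p - pderiv p) * [:0, 0, 1:]) t) (at t)"
      using 1 by (auto intro!: derivative_eq_intros DERIV_chain2[OF poly_DERIV] simp: flat_exp_def power2_eq_square field_simps)
    then show ?thesis
      by (rule has_field_derivative_transform_within_open[of _ _ _ "{0<..}"]) (use 1 in \<open>auto simp: flat_exp_def\<close>)
  next
    case 2
    have "((\<lambda>t. 0) has_real_derivative flat_exp ((p - pderiv p) * [:0, 0, 1:]) t) (at t)"
      using 2 by (simp add: flat_exp_def)
    then show ?thesis
      by (rule has_field_derivative_transform_within_open[of _ _ _ "{..<0}"]) (use 2 in \<open>auto simp: flat_exp_def\<close>)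
  next
    case 3
    \<comment> \<open>The difference quotient at 0 lies in the class again, with \<open>p\<close>
      multiplied by the variable, so the limit at 0 is already known.\<close>
    have "(\<lambda>h. (flat_exp p (0 + h) - flat_exp p 0) / h) = flat_exp (p * [:0, 1:])"
      by (auto simp: flat_exp_def fun_eq_iff)
    then show ?thesis
      using flat_exp_tendsto_0[of "p * [:0, 1:]"] by (simp add: 3 DERIV_def flat_exp_def)
  qed
qed

text \<open>A partial derivative has the same shape up to a constant factor but with another
  polynomial, hence the induction for all \<open>p\<close> at once.\<close>

lemma Ck_flat_exp: "Ck k (\<lambda>x. flat_exp p (c * x $ i + e))"
proof (induction k arbitrary: p)
  case 0
  have "continuous_on UNIV (flat_exp p)"
    using has_derivative_flat_exp by (meson DERIV_continuous_on has_field_derivative_at_within)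
  then have "continuous_on UNIV (flat_exp p \<circ> (\<lambda>x. c * x $ i + e))"
    by (intro continuous_on_compose continuous_intros) (auto intro: continuous_on_subset)
  then show ?case by (simp add: o_def)
next
  case (Suc k)
  let ?q = "(p - pderiv p) * [:0, 0, 1:]"
  have D: "((\<lambda>x. flat_exp p (c * x $ i + e)) has_derivative (\<lambda>h. flat_exp ?q (c * x $ i + e) * (c * h $ i))) (at x)" for x
  proof -
    have "(flat_exp p has_derivative (*) (flat_exp ?q (c * x $ i + e))) (at (c * x $ i + e))"
      using has_derivative_flat_exp unfolding has_field_derivative_def .
    moreover have "((\<lambda>x. c * x $ i + e) has_derivative (\<lambda>h. c * h $ i)) (at x)"
      by (auto intro!: derivative_eq_intros bounded_linear.has_derivative[OF bounded_linear_vec_nth])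
    ultimately show ?thesis
      by (rule has_derivative_compose[rotated])
  qed
  have "partial j (\<lambda>x. flat_exp p (c * x $ i + e)) = (\<lambda>x. flat_exp ?q (c * x $ i + e) * (c * axis j 1 $ i))" for j
    by (rule ext) (simp add: partial_eqI[OF D])
  then show ?case
    using Suc D by (auto simp: differentiable_def intro!: Ck_mult Ck_const)
qed

lemma flat_exp_1_bounds: "0 \<le> flat_exp 1 t" "flat_exp 1 t \<le> 1"
  by (auto simp: flat_exp_def)

text \<open>A product of one-dimensional cutoffs. The shift by 1 keeps the support inside the box
  shrunk by 1/(n+1) on every side, hence compact in the open box; the dilation makes the bumps
  approach the indicator of that box.\<close>

definition bump :: "real ^ 'd \<Rightarrow> real ^ 'd \<Rightarrow> nat \<Rightarrow> real ^ 'd \<Rightarrow> real" where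
  "bump a b n x = (\<Prod>i\<in>UNIV. flat_exp 1 (real (Suc n) * (x $ i - a $ i) - 1) * flat_exp 1 (real (Suc n) * (b $ i - x $ i) - 1))"

lemma smooth_bump: "smooth (bump a b n)"
proof -
  have "smooth (\<lambda>x. flat_exp 1 (real (Suc n) * (x $ i - a $ i) - 1) * flat_exp 1 (real (Suc n) * (b $ i - x $ i) - 1))" for i
    using Ck_flat_exp[of _ 1 "real (Suc n)" i "- real (Suc n) * a $ i - 1"]
      Ck_flat_exp[of _ 1 "- real (Suc n)" i "real (Suc n) * b $ i - 1"]
    by (intro smooth_mult) (auto simp: smooth_def algebra_simps)
  then show ?thesis
    unfolding bump_def by (rule smooth_prod)
qed

lemma bump_bounds: "0 \<le> bump a b n x" "bump a b n x \<le> 1"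
  unfolding bump_def by (auto intro!: prod_nonneg prod_le_1 mult_nonneg_nonneg mult_le_one flat_exp_1_bounds)

lemma bump_nonzero:
  assumes "bump a b n x \<noteq> 0"
  shows "a $ i + 1 / real (Suc n) < x $ i" "x $ i < b $ i - 1 / real (Suc n)"
proof -
  have "flat_exp 1 (real (Suc n) * (x $ i - a $ i) - 1) \<noteq> 0" "flat_exp 1 (real (Suc n) * (b $ i - x $ i) - 1) \<noteq> 0"
    using assms by (auto simp: bump_def)
  then have "0 < real (Suc n) * (x $ i - a $ i) - 1" "0 < real (Suc n) * (b $ i - x $ i) - 1"
    by (auto simp: flat_exp_def split: if_splits)
  then show "a $ i + 1 / real (Suc n) < x $ i" "x $ i < b $ i - 1 / real (Suc n)"
    by (simp_all add: field_simps)
qed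

lemma test_function_bump:
  assumes "box a b \<subseteq> D"
  shows "test_function D (bump a b n)"
proof -
  define h :: "real ^ 'a" where "h = (\<chi> i. 1 / real (Suc n))"
  have sub: "closure {x. bump a b n x \<noteq> 0} \<subseteq> cbox (a + h) (b - h)"
  proof (rule closure_minimal)
    show "{x. bump a b n x \<noteq> 0} \<subseteq> cbox (a + h) (b - h)"
    proof
      fix x assume "x \<in> {x. bump a b n x \<noteq> 0}"
      then have "a $ i + 1 / real (Suc n) < x $ i \<and> x $ i < b $ i - 1 / real (Suc n)" for i
        using bump_nonzero by blast
      then show "x \<in> cbox (a + h) (b - h)"
        unfolding mem_box_cart h_def by (simp add: less_imp_le del: of_nat_Suc)
    qed
  qed (rule closed_cbox)
  also have "\<dots> \<subseteq> box a b"
  proof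
    fix x assume "x \<in> cbox (a + h) (b - h)"
    then have "a $ i + 1 / real (Suc n) \<le> x $ i \<and> x $ i \<le> b $ i - 1 / real (Suc n)" for i
      by (auto simp: mem_box_cart h_def)
    moreover have "0 < 1 / real (Suc n)" by simp
    ultimately have "a $ i < x $ i \<and> x $ i < b $ i" for i
      by (smt (verit))
    then show "x \<in> box a b"
      by (auto simp: mem_box_cart)
  qed
  finally have "closure {x. bump a b n x \<noteq> 0} \<subseteq> D"
    using assms by auto
  moreover have "compact (closure {x. bump a b n x \<noteq> 0})"
    using sub by (meson bounded_cbox bounded_closure bounded_subset closed_closure compact_eq_bounded_closed)
  ultimately show ?thesis
    by (simp add: test_function_def smooth_bump)
qed

lemma bump_tendsto:
  fixes a b x :: "real ^ 'd"
  shows "(\<lambda>n. bump a b n x) \<longlonglongrightarrow> indicator (box a b) x"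
proof (cases "x \<in> box a b")
  case True
  \<comment> \<open>For \<open>t > 0\<close> the argument tends to infinity, and exp(-1/s) tends to
    1 there.\<close>
  have *: "(\<lambda>n. flat_exp 1 (real (Suc n) * t - 1)) \<longlonglongrightarrow> 1" if "t > 0" for t
  proof -
    have lim: "filterlim (\<lambda>n. real (Suc n) * t - 1) at_top sequentially"
      using that by real_asymp
    have "((\<lambda>s::real. exp (- (1 / s))) \<longlongrightarrow> 1) at_top"
      by real_asymp
    then have "(flat_exp 1 \<longlongrightarrow> 1) at_top"
      by (rule Lim_transform_eventually) (auto simp: flat_exp_def intro: eventually_mono[OF eventually_gt_at_top[of 0]])
    from filterlim_compose[OF this lim] show ?thesis .
  qed
  have "(\<lambda>n. bump a b n x) \<longlonglongrightarrow> (\<Prod>i\<in>(UNIV :: 'd set). 1 * 1)"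
    unfolding bump_def using True by (intro tendsto_prod tendsto_mult *) (auto simp: mem_box_cart)
  with True show ?thesis by simp
next
  case False
  have "bump a b n x = 0" for n
  proof (rule ccontr)
    assume "bump a b n x \<noteq> 0"
    moreover have "0 < 1 / real (Suc n)" by simp
    ultimately have "a $ i < x $ i \<and> x $ i < b $ i" for i
      using bump_nonzero[of a b n x i] by (smt (verit))
    with False show False by (auto simp: mem_box_cart)
  qed
  with False show ?thesis by simp
qed

text \<open>Dominated convergence along the bumps, with majorant \<open>norm (g x)\<close>.\<close>

lemma integral_box_eq_0:
  fixes g :: "real ^ 'd \<Rightarrow> real"
  assumes g: "integrable (vol D) g"
    and 0: "\<And>\<phi>. test_function D \<phi> \<Longrightarrow> (\<integral>x. g x * \<phi> x \<partial>vol D) = 0"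
    and D: "box a b \<subseteq> D"
  shows "(\<integral>x. g x * indicator (box a b) x \<partial>vol D) = 0"
proof -
  have meas: "bump a b n \<in> borel_measurable (vol D)" for n
  proof -
    have "continuous_on UNIV (bump a b n)"
      using smooth_bump[of a b n] Ck_continuous unfolding smooth_def by blast
    then have "bump a b n \<in> borel_measurable borel"
      by (rule borel_measurable_continuous_onI)
    then show ?thesis
      by (intro measurable_restrict_space1) simp
  qed
  have "(\<lambda>n. \<integral>x. g x * bump a b n x \<partial>vol D) \<longlonglongrightarrow> (\<integral>x. g x * indicator (box a b) x \<partial>vol D)"
  proof (rule integral_dominated_convergence)
    show "(\<lambda>x. g x * indicator (box a b) x) \<in> borel_measurable (vol D)"
      using g by (intro borel_measurable_times measurable_restrict_space1[of "indicator (box a b)"]) auto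
    show "(\<lambda>x. g x * bump a b n x) \<in> borel_measurable (vol D)" for n
      using g meas by (intro borel_measurable_times) auto
    show "integrable (vol D) (\<lambda>x. norm (g x))" using g by simp
    show "AE x in vol D. (\<lambda>n. g x * bump a b n x) \<longlonglongrightarrow> g x * indicator (box a b) x"
      by (intro AE_I2 tendsto_mult tendsto_const bump_tendsto)
    show "AE x in vol D. norm (g x * bump a b n x) \<le> norm (g x)" for n
      by (intro AE_I2) (simp add: abs_mult bump_bounds mult_left_le)
  qed
  then show ?thesis
    using 0[OF test_function_bump[OF D]] by (simp add: LIMSEQ_const_iff)
qed

text \<open>The boxes form an intersection-stable generator of the Borel sets, so vanishing
  integrals over boxes propagate to all Borel sets. The argument runs inside one box
  \<open>X\<close> of a countable cover of \<open>D\<close>: intersected with \<open>X\<close>, any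
  box becomes a box contained in \<open>D\<close>.\<close>

lemma fundamental_lemma:
  fixes g :: "real ^ 'd \<Rightarrow> real"
  assumes g: "integrable (vol D) g" and D: "open D"
    and 0: "\<And>\<phi>. test_function D \<phi> \<Longrightarrow> (\<integral>x. g x * \<phi> x \<partial>vol D) = 0"
  shows "AE x in vol D. g x = 0"
proof -
  obtain \<B> where B: "countable \<B>" "\<B> \<subseteq> Pow D" "\<And>X. X \<in> \<B> \<Longrightarrow> \<exists>a b. X = box a b" "\<Union>\<B> = D"
    using open_countable_Union_open_box[OF D] by metis
  interpret sigma_finite_measure "vol D"
    using D by (intro sigma_finite_measure_restrict_space sigma_finite_lborel) auto
  have "AE x in vol D. indicator X x *\<^sub>R g x = 0" if X: "X \<in> \<B>" for X
  proof (rule density_zero)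
    obtain c d where X': "X = box c d" "box c d \<subseteq> D" using B X by blast
    have Xs [measurable]: "X \<in> sets (vol D)"
      using X' D by (auto simp: sets_restrict_space_iff)
    show int: "integrable (vol D) (\<lambda>x. indicator X x *\<^sub>R g x)"
      by (rule integrable_mult_indicator[OF Xs g])
    have main: "(\<integral>x. indicator A x * (indicator X x *\<^sub>R g x) \<partial>vol D) = 0" if "A \<in> sets borel" for A
    proof -
      let ?G = "range (\<lambda>(a, b). box a b :: (real ^ 'd) set)"
      have int_A: "integrable (vol D) (\<lambda>x. indicator A x * (indicator X x *\<^sub>R g x))" if "A \<in> sets borel" for A
      proof -
        have "A \<inter> D \<in> sets (vol D)"
          using that D by (auto simp: sets_restrict_space)
        from integrable_mult_indicator[OF this int] show ?thesis
          by (rule Bochner_Integration.integrable_cong[THEN iffD1, rotated -1])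
            (auto simp: indicator_def space_restrict_space)
      qed
      have gen: "A \<in> sigma_sets UNIV ?G"
        using that unfolding borel_eq_box by simp
      have stable: "Int_stable ?G"
      proof (rule Int_stableI)
        fix A B assume "A \<in> ?G" "B \<in> ?G"
        then have "\<exists>a b. A \<inter> B = box a b"
          using box_Int_box by (auto simp del: box_Int_box) blast
        then show "A \<inter> B \<in> ?G" by auto
      qed
      show ?thesis
        using stable subset_UNIV[THEN order_trans[OF _ Pow_UNIV[THEN equalityD2]]] gen
      proof (induction rule: sigma_sets_induct_disjoint)
        case (basic A)
        then obtain a b where "A = box a b" by auto
        then obtain a' b' where A: "A \<inter> X = box a' b'"
          using X' box_Int_box by blast
        have "(\<integral>x. indicator A x * (indicator X x *\<^sub>R g x) \<partial>vol D) = (\<integral>x. g x * indicator (box a' b') x \<partial>vol D)"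
          unfolding A[symmetric] by (intro Bochner_Integration.integral_cong) (auto simp: indicator_def)
        also have "\<dots> = 0"
          using integral_box_eq_0[OF g 0] A X' by blast
        finally show ?case .
      next
        case empty
        then show ?case by simp
      next
        \<comment> \<open>The complement is in effect taken within \<open>X\<close>, over which the
          integral vanishes as well.\<close>
        case (compl A)
        have A: "A \<in> sets borel" using compl(1) unfolding borel_eq_box by simp
        have "(\<integral>x. indicator (UNIV - A) x * (indicator X x *\<^sub>R g x) \<partial>vol D)
            = (\<integral>x. g x * indicator (box c d) x - indicator A x * (indicator X x *\<^sub>R g x) \<partial>vol D)"
          by (intro Bochner_Integration.integral_cong) (auto simp: indicator_def X')
        also have "\<dots> = (\<integral>x. g x * indicator (box c d) x \<partial>vol D) - (\<integral>x. indicator A x * (indicator X x *\<^sub>R g x) \<partial>vol D)"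
          using int int_A[OF A] by (intro Bochner_Integration.integral_diff) (auto simp: X' mult.commute)
        finally show ?case
          using compl integral_box_eq_0[OF g 0 X'(2)] by simp
      next
        case (union A)
        have A: "A i \<in> sets borel" for i using union(2) unfolding borel_eq_box by auto
        let ?h = "\<lambda>x. indicator X x *\<^sub>R g x"
        \<comment> \<open>Finite unions reduce to sums by disjointness; dominated convergence
          carries the result to the countable union.\<close>
        have "(\<lambda>n. \<integral>x. indicator (\<Union>i<n. A i) x * ?h x \<partial>vol D) \<longlonglongrightarrow> (\<integral>x. indicator (\<Union>i. A i) x * ?h x \<partial>vol D)"
        proof (rule integral_dominated_convergence)
          show "(\<lambda>x. indicator (\<Union>i. A i) x * ?h x) \<in> borel_measurable (vol D)"
            using A by (intro borel_measurable_integrable int_A) auto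
          show "(\<lambda>x. indicator (\<Union>i<n. A i) x * ?h x) \<in> borel_measurable (vol D)" for n
            using A by (intro borel_measurable_integrable int_A) auto
          show "integrable (vol D) (\<lambda>x. norm (?h x))" using int by (rule integrable_norm)
          show "AE x in vol D. (\<lambda>n. indicator (\<Union>i<n. A i) x * ?h x) \<longlonglongrightarrow> indicator (\<Union>i. A i) x * ?h x"
            by (intro AE_I2 tendsto_mult tendsto_const LIMSEQ_indicator_UN)
          show "AE x in vol D. norm (indicator (\<Union>i<n. A i) x * ?h x) \<le> norm (?h x)" for n
            by (intro AE_I2) (auto simp: indicator_def)
        qed
        moreover have "(\<integral>x. indicator (\<Union>i<n. A i) x * ?h x \<partial>vol D) = 0" for n
        proof -
          have "indicator (\<Union>i<n. A i) x = (\<Sum>i<n. indicator (A i) x :: real)" for x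
            using union(1) by (intro indicator_UN_disjoint) (auto intro: disjoint_family_on_mono)
          then have "(\<integral>x. indicator (\<Union>i<n. A i) x * ?h x \<partial>vol D) = (\<integral>x. (\<Sum>i<n. indicator (A i) x * ?h x) \<partial>vol D)"
            by (simp only: sum_distrib_right)
          also have "\<dots> = (\<Sum>i<n. \<integral>x. indicator (A i) x * ?h x \<partial>vol D)"
            using A by (intro Bochner_Integration.integral_sum int_A)
          finally show ?thesis using union(3) by simp
        qed
        ultimately show ?case by (simp add: LIMSEQ_const_iff)
      qed
    qed
    show "set_lebesgue_integral (vol D) A (\<lambda>x. indicator X x *\<^sub>R g x) = 0" if "A \<in> sets (vol D)" for A
      using main[of A] that D by (simp add: set_lebesgue_integral_def sets_restrict_space_iff)
  qed
  then have "AE x in vol D. \<forall>X\<in>\<B>. indicator X x *\<^sub>R g x = 0"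
    unfolding AE_ball_countable[OF B(1)] by blast
  then show ?thesis
  proof (rule AE_mp, intro AE_I2 impI)
    fix x assume "x \<in> space (vol D)" "\<forall>X\<in>\<B>. indicator X x *\<^sub>R g x = 0"
    then show "g x = 0"
      using B(4) by (auto simp: space_restrict_space)
  qed
qed

subsection \<open>Square integrable functions and weak gradients\<close>

lemma L2_measurable: "f \<in> L2 M \<Longrightarrow> f \<in> borel_measurable M"
  and L2_integrable_norm: "f \<in> L2 M \<Longrightarrow> integrable M (\<lambda>x. (norm (f x))\<^sup>2)"
  by (auto simp: L2_def)

lemma L2_integrable_inner:
  assumes "f \<in> L2 M" "g \<in> L2 M"
  shows "integrable M (\<lambda>x. f x \<bullet> g x)"
proof (rule Bochner_Integration.integrable_bound)
  show "integrable M (\<lambda>x. (norm (f x))\<^sup>2 + (norm (g x))\<^sup>2)"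
    using assms by (intro Bochner_Integration.integrable_add L2_integrable_norm)
  show "(\<lambda>x. f x \<bullet> g x) \<in> borel_measurable M"
    using assms by (intro borel_measurable_inner L2_measurable)
  have "norm (f x \<bullet> g x) \<le> norm ((norm (f x))\<^sup>2 + (norm (g x))\<^sup>2)" for x
  proof -
    have "\<bar>f x \<bullet> g x\<bar> \<le> norm (f x) * norm (g x)" by (rule Cauchy_Schwarz_ineq2)
    also have "\<dots> \<le> (norm (f x))\<^sup>2 + (norm (g x))\<^sup>2"
      using sum_squares_bound[of "norm (f x)" "norm (g x)"]
        mult_nonneg_nonneg[OF norm_ge_zero[of "f x"] norm_ge_zero[of "g x"]] by linarith
    finally show ?thesis by simp
  qed
  then show "AE x in M. norm (f x \<bullet> g x) \<le> norm ((norm (f x))\<^sup>2 + (norm (g x))\<^sup>2)" by simp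
qed

lemma L2_integrable_mult:
  fixes f g :: "'a \<Rightarrow> real"
  shows "f \<in> L2 M \<Longrightarrow> g \<in> L2 M \<Longrightarrow> integrable M (\<lambda>x. f x * g x)"
  using L2_integrable_inner[of f M g] by simp

lemma L2_dominated:
  assumes "g \<in> L2 M" "f \<in> borel_measurable M" "AE x in M. norm (f x) \<le> K * norm (g x)"
  shows "f \<in> L2 M"
proof -
  have "integrable M (\<lambda>x. (norm (f x))\<^sup>2)"
  proof (rule Bochner_Integration.integrable_bound)
    show "integrable M (\<lambda>x. K\<^sup>2 * (norm (g x))\<^sup>2)"
      using assms(1) by (intro integrable_mult_right L2_integrable_norm)
    show "AE x in M. norm ((norm (f x))\<^sup>2) \<le> norm (K\<^sup>2 * (norm (g x))\<^sup>2)"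
      using assms(3)
    proof eventually_elim
      case (elim x)
      then show ?case
        using power_mono[OF elim, of 2] by (simp add: power_mult_distrib)
    qed
  qed (use assms(2) in simp)
  with assms(2) show ?thesis by (simp add: L2_def)
qed

lemma L2_mult_bounded:
  assumes "g \<in> L2 M" "h \<in> borel_measurable M" "AE x in M. \<bar>h x\<bar> \<le> K"
  shows "(\<lambda>x. h x *\<^sub>R g x) \<in> L2 M"
proof (rule L2_dominated[OF assms(1), of _ K])
  show "AE x in M. norm (h x *\<^sub>R g x) \<le> K * norm (g x)"
    using assms(3) by eventually_elim (simp add: mult_right_mono)
qed (intro borel_measurable_scaleR assms L2_measurable)

lemma L2_bounded_linear:
  fixes T :: "'b::euclidean_space \<Rightarrow> 'c::euclidean_space"
  assumes "f \<in> L2 M" "bounded_linear T"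
  shows "(\<lambda>x. T (f x)) \<in> L2 M"
proof -
  obtain K where K: "\<And>x. norm (T x) \<le> norm x * K"
    using bounded_linear.bounded[OF assms(2)] by blast
  have T: "T \<in> borel_measurable borel"
    using assms(2) by (intro borel_measurable_continuous_onI linear_continuous_on)
  show ?thesis
    using measurable_compose[OF L2_measurable[OF assms(1)] T] K
    by (intro L2_dominated[OF assms(1), of _ K]) (auto simp: mult.commute)
qed

lemma L2_add: "f \<in> L2 M \<Longrightarrow> g \<in> L2 M \<Longrightarrow> (\<lambda>x. f x + g x) \<in> L2 M"
  unfolding L2_def
  by (auto simp: power2_norm_eq_inner inner_add
      intro!: Bochner_Integration.integrable_add L2_integrable_inner[unfolded L2_def])

lemma L2_scaleR: "f \<in> L2 M \<Longrightarrow> (\<lambda>x. c *\<^sub>R f x) \<in> L2 M"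
  by (rule L2_bounded_linear[OF _ bounded_linear_scaleR_right])

lemma L2_zero: "(\<lambda>x. 0) \<in> L2 M"
  by (simp add: L2_def)

lemma subspace_L2: "subspace (L2 M)"
  using L2_zero L2_add L2_scaleR
  by (auto simp: subspace_def zero_fun_def plus_fun_def scaleR_fun_def)

lemma (in finite_measure) L2_const: "(\<lambda>x. c) \<in> L2 M"
  by (simp add: L2_def)

lemma (in finite_measure) L2_integrable: 
  fixes f :: "'a \<Rightarrow> real"
  shows "f \<in> L2 M \<Longrightarrow> integrable M f"
  using L2_integrable_mult[OF _ L2_const, of f 1] by simp

lemma L2_norm_power2: "(L2_norm M f)\<^sup>2 = (\<integral>x. (norm (f x))\<^sup>2 \<partial>M)"
  by (simp add: L2_norm_def)

lemma L2_norm_nonneg: "0 \<le> L2_norm M f"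
  by (simp add: L2_norm_def)

section \<open>Calculus of weak gradients on a bounded open set\<close>

locale bounded_domain =
  fixes D :: "(real ^ 'd) set"
  assumes open_D: "open D" and bounded_D: "bounded D"
begin

lemma finite_measure_vol: "finite_measure (vol D)"
proof
  have "emeasure lborel D < \<infinity>"
    using bounded_D by (rule emeasure_bounded_finite)
  then show "emeasure (vol D) (space (vol D)) \<noteq> \<infinity>"
    using open_D by (simp add: emeasure_restrict_space space_restrict_space)
qed

sublocale vol: finite_measure "vol D"
  by (rule finite_measure_vol)

lemma test_function_L2:
  assumes "test_function D \<phi>"
  shows "\<phi> \<in> L2 (vol D)" and "partial i \<phi> \<in> L2 (vol D)"
proof -
  have cont: "f \<in> L2 (vol D)" if "continuous_on UNIV f" for f :: "real ^ 'd \<Rightarrow> real"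
  proof -
    have "compact (f ` closure D)"
      using bounded_D that by (intro compact_continuous_image) (auto intro: continuous_on_subset)
    then obtain K where "\<And>x. x \<in> D \<Longrightarrow> \<bar>f x\<bar> \<le> K"
      using closure_subset by (force dest!: compact_imp_bounded simp: bounded_iff)
    moreover have "f \<in> borel_measurable (vol D)"
      using that by (intro measurable_restrict_space1) (simp add: borel_measurable_continuous_onI)
    ultimately show ?thesis
      by (intro L2_dominated[OF vol.L2_const[of "1::real"], of f K] AE_I2) (auto simp: space_restrict_space)
  qed
  have "Ck 0 \<phi>" "Ck (Suc 0) \<phi>"
    using assms unfolding test_function_def smooth_def by blast+
  then show "\<phi> \<in> L2 (vol D)" "partial i \<phi> \<in> L2 (vol D)"
    by (auto intro: cont)
qed

lemma weak_gradient_works: "f \<in> H1 D \<Longrightarrow> is_weak_gradient D f (weak_gradient D f)"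
  unfolding H1_def weak_gradient_def by (auto simp: some_eq_ex)

lemma L2_component: "g \<in> L2 M \<Longrightarrow> (\<lambda>x. g x $ i) \<in> L2 M"
  for g :: "'a \<Rightarrow> real ^ 'n"
  by (rule L2_bounded_linear[OF _ bounded_linear_vec_nth])

text \<open>The components of the difference annihilate all test functions. Consequently the choice
  made in \<open>weak_gradient\<close> respects sums and multiples up to null sets.\<close>

lemma is_weak_gradient_unique:
  assumes "is_weak_gradient D f g" "is_weak_gradient D f h"
  shows "AE x in vol D. g x = h x"
proof -
  have L2: "g \<in> L2 (vol D)" "h \<in> L2 (vol D)"
    using assms by (auto simp: is_weak_gradient_def)
  have "AE x in vol D. g x $ i - h x $ i = 0" for i
  proof (rule fundamental_lemma[OF _ open_D])
    show "integrable (vol D) (\<lambda>x. g x $ i - h x $ i)"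
      using L2 by (intro Bochner_Integration.integrable_diff vol.L2_integrable L2_component)
    fix \<phi> assume \<phi>: "test_function D \<phi>"
    have "(\<integral>x. (g x $ i - h x $ i) * \<phi> x \<partial>vol D) = (\<integral>x. g x $ i * \<phi> x \<partial>vol D) - (\<integral>x. h x $ i * \<phi> x \<partial>vol D)"
      unfolding left_diff_distrib
      using L2 test_function_L2[OF \<phi>]
      by (intro Bochner_Integration.integral_diff L2_integrable_mult L2_component)
    also have "\<dots> = 0"
    proof -
      have "(\<integral>x. f x * partial i \<phi> x \<partial>vol D) = - (\<integral>x. g x $ i * \<phi> x \<partial>vol D)"
        "(\<integral>x. f x * partial i \<phi> x \<partial>vol D) = - (\<integral>x. h x $ i * \<phi> x \<partial>vol D)"
        using assms \<phi> unfolding is_weak_gradient_def by blast+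
      then show ?thesis by simp
    qed
    finally show "(\<integral>x. (g x $ i - h x $ i) * \<phi> x \<partial>vol D) = 0" .
  qed
  then have "AE x in vol D. \<forall>i. g x $ i - h x $ i = 0"
    by (simp add: AE_all_countable)
  then show ?thesis
    by eventually_elim (simp add: vec_eq_iff)
qed

lemma is_weak_gradient_add:
  assumes "is_weak_gradient D f g" "is_weak_gradient D f' g'" "f \<in> L2 (vol D)" "f' \<in> L2 (vol D)"
  shows "is_weak_gradient D (\<lambda>x. f x + f' x) (\<lambda>x. g x + g' x)"
  unfolding is_weak_gradient_def
proof (intro conjI allI impI)
  have L2: "g \<in> L2 (vol D)" "g' \<in> L2 (vol D)"
    using assms by (auto simp: is_weak_gradient_def)
  then show "(\<lambda>x. g x + g' x) \<in> L2 (vol D)"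
    by (rule L2_add)
  fix \<phi> i assume \<phi>: "test_function D \<phi>"
  have "(\<integral>x. (f x + f' x) * partial i \<phi> x \<partial>vol D) = (\<integral>x. f x * partial i \<phi> x \<partial>vol D) + (\<integral>x. f' x * partial i \<phi> x \<partial>vol D)"
    unfolding distrib_right
    using assms test_function_L2[OF \<phi>] by (intro Bochner_Integration.integral_add L2_integrable_mult)
  moreover have "(\<integral>x. (g x + g' x) $ i * \<phi> x \<partial>vol D) = (\<integral>x. g x $ i * \<phi> x \<partial>vol D) + (\<integral>x. g' x $ i * \<phi> x \<partial>vol D)"
    unfolding vector_add_component distrib_right
    using L2 test_function_L2[OF \<phi>] by (intro Bochner_Integration.integral_add L2_integrable_mult L2_component)
  ultimately show "(\<integral>x. (f x + f' x) * partial i \<phi> x \<partial>vol D) = - (\<integral>x. (g x + g' x) $ i * \<phi> x \<partial>vol D)"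
    using assms \<phi> by (simp add: is_weak_gradient_def)
qed

lemma is_weak_gradient_scaleR:
  assumes "is_weak_gradient D f g"
  shows "is_weak_gradient D (\<lambda>x. c *\<^sub>R f x) (\<lambda>x. c *\<^sub>R g x)"
  using assms unfolding is_weak_gradient_def by (auto intro: L2_scaleR simp: mult.assoc)

lemma subspace_H1: "subspace (H1 D)"
proof -
  have "is_weak_gradient D (\<lambda>x. 0) (\<lambda>x. 0)"
    by (simp add: is_weak_gradient_def L2_zero)
  then have "(\<lambda>x. 0) \<in> H1 D"
    unfolding H1_def using L2_zero by blast
  moreover have "(\<lambda>x. f x + f' x) \<in> H1 D" if "f \<in> H1 D" "f' \<in> H1 D" for f f'
    using that is_weak_gradient_add[of f _ f'] L2_add[of f _ f'] unfolding H1_def by blast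
  moreover have "(\<lambda>x. c *\<^sub>R f x) \<in> H1 D" if "f \<in> H1 D" for c f
    using that is_weak_gradient_scaleR[of f _ c] L2_scaleR[of f _ c] unfolding H1_def by blast
  ultimately show ?thesis
    unfolding subspace_def zero_fun_def plus_fun_def scaleR_fun_def by blast
qed

text \<open>Gradients are studied without boundary conditions; these return with Korn's
  inequality.\<close>

definition H1_vec :: "(real ^ 'd \<Rightarrow> real ^ 'd) set" where
  "H1_vec = {v. \<forall>i. (\<lambda>x. v x $ i) \<in> H1 D}"

lemma H1_E0_subset: "H1_E0 D \<Gamma> \<subseteq> H1_vec"
  by (auto simp: H1_E0_def H1_vec_def)

lemma subspace_H1_vec: "subspace H1_vec"
  using subspace_add[OF subspace_H1] subspace_scale[OF subspace_H1] subspace_0[OF subspace_H1]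
  unfolding subspace_def H1_vec_def zero_fun_def plus_fun_def scaleR_fun_def by simp

lemma L2_vecI:
  fixes f :: "'a \<Rightarrow> 'b::euclidean_space ^ 'n"
  assumes "\<And>i. (\<lambda>x. f x $ i) \<in> L2 M"
  shows "f \<in> L2 M"
proof -
  have "f \<in> borel_measurable M"
    using L2_measurable[OF assms]
    by (subst borel_measurable_euclidean_space) (auto simp: Basis_vec_def inner_axis intro!: borel_measurable_inner)
  moreover have "(\<lambda>x. (norm (f x))\<^sup>2) = (\<lambda>x. \<Sum>i\<in>UNIV. (norm (f x $ i))\<^sup>2)"
    by (simp add: norm_vec_def L2_set_def sum_nonneg)
  ultimately show ?thesis
    using assms by (simp add: L2_def)
qed

lemma H1_vec_L2: "v \<in> H1_vec \<Longrightarrow> v \<in> L2 (vol D)"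
  by (rule L2_vecI) (simp add: H1_vec_def H1_def)

lemma grad_L2: "v \<in> H1_vec \<Longrightarrow> grad D v \<in> L2 (vol D)"
  by (rule L2_vecI) (use weak_gradient_works in \<open>auto simp: grad_def H1_vec_def is_weak_gradient_def\<close>)

lemma grad_add:
  assumes "v \<in> H1_vec" "w \<in> H1_vec"
  shows "AE x in vol D. grad D (v + w) x = grad D v x + grad D w x"
proof -
  have "AE x in vol D. weak_gradient D (\<lambda>x. (v + w) x $ i) x = weak_gradient D (\<lambda>x. v x $ i) x + weak_gradient D (\<lambda>x. w x $ i) x" for i
  proof (rule is_weak_gradient_unique)
    show "is_weak_gradient D (\<lambda>x. (v + w) x $ i) (weak_gradient D (\<lambda>x. (v + w) x $ i))"
      using subspace_add[OF subspace_H1_vec assms] by (intro weak_gradient_works) (simp add: H1_vec_def)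
    show "is_weak_gradient D (\<lambda>x. (v + w) x $ i) (\<lambda>x. weak_gradient D (\<lambda>x. v x $ i) x + weak_gradient D (\<lambda>x. w x $ i) x)"
      using assms unfolding plus_fun_def vector_add_component
      by (intro is_weak_gradient_add weak_gradient_works) (auto simp: H1_vec_def H1_def)
  qed
  then have "AE x in vol D. \<forall>i. weak_gradient D (\<lambda>x. (v + w) x $ i) x = weak_gradient D (\<lambda>x. v x $ i) x + weak_gradient D (\<lambda>x. w x $ i) x"
    by (simp add: AE_all_countable)
  then show ?thesis
    by eventually_elim (simp add: grad_def vec_eq_iff)
qed

lemma grad_scaleR:
  assumes "v \<in> H1_vec"
  shows "AE x in vol D. grad D (c *\<^sub>R v) x = c *\<^sub>R grad D v x"
proof -
  have "AE x in vol D. weak_gradient D (\<lambda>x. (c *\<^sub>R v) x $ i) x = c *\<^sub>R weak_gradient D (\<lambda>x. v x $ i) x" for i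
  proof (rule is_weak_gradient_unique)
    show "is_weak_gradient D (\<lambda>x. (c *\<^sub>R v) x $ i) (weak_gradient D (\<lambda>x. (c *\<^sub>R v) x $ i))"
      using subspace_scale[OF subspace_H1_vec assms] by (intro weak_gradient_works) (simp add: H1_vec_def)
    show "is_weak_gradient D (\<lambda>x. (c *\<^sub>R v) x $ i) (\<lambda>x. c *\<^sub>R weak_gradient D (\<lambda>x. v x $ i) x)"
      using is_weak_gradient_scaleR[OF weak_gradient_works, of "\<lambda>x. v x $ i" c] assms
      by (simp add: H1_vec_def scaleR_fun_def)
  qed
  then have "AE x in vol D. \<forall>i. weak_gradient D (\<lambda>x. (c *\<^sub>R v) x $ i) x = c *\<^sub>R weak_gradient D (\<lambda>x. v x $ i) x"
    by (simp add: AE_all_countable)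
  then show ?thesis
    by eventually_elim (simp add: grad_def vec_eq_iff)
qed

lemma grad_zero: "AE x in vol D. grad D 0 x = 0"
  using grad_scaleR[OF subspace_0[OF subspace_H1_vec], of 0] by simp

end

subsection \<open>Legendre polynomials\<close>

lemma prob_space_uniform_11: "prob_space (uniform_measure (restrict_space lborel {-1..1::real}) {-1..1})"
  by (rule prob_space_uniform_measure) (auto simp: emeasure_restrict_space)

abbreviation unif :: "real measure" where
  "unif \<equiv> uniform_measure (restrict_space lborel {-1..1}) {-1..1}"

interpretation param: product_prob_space "\<lambda>_. unif" UNIV
  by (simp add: product_prob_space_def product_prob_space_axioms_def product_sigma_finite_def
      prob_space_uniform_11 prob_space_imp_sigma_finite)

lemma prob_space_param: "prob_space param_measure"
  unfolding param_measure_def by unfold_locales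

lemma space_unif: "space unif = {-1..1}"
  by (simp add: space_restrict_space)

text \<open>The measure has density 1/2 on the interval. The gauge integral on the right is the
  setting for the integration by parts below.\<close>

lemma unif_integral:
  fixes h :: "real \<Rightarrow> real"
  assumes "continuous_on {-1..1} h"
  shows "integrable unif h" and "(\<integral>x. h x \<partial>unif) = integral {-1..1} h / 2"
proof -
  have int: "set_integrable lborel {-1..1} h"
    using assms by (intro borel_integrable_atLeastAtMost' )
  have unif_eq: "unif = density (restrict_space lborel {-1..1}) (\<lambda>x. ennreal (1 / 2))"
    unfolding uniform_measure_def
  proof (rule density_cong)
    show "AE x in restrict_space lborel {-1..1::real}.
       indicator {-1..1} x / emeasure (restrict_space lborel {-1..1}) {-1..1::real} = ennreal (1 / 2)"
    proof (rule AE_I2)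
      fix x :: real assume "x \<in> space (restrict_space lborel {-1..1})"
      then have x: "indicator {-1..1} x = (1 :: ennreal)"
        by (simp add: space_restrict_space)
      have e: "emeasure (restrict_space lborel {-1..1}) {-1..1::real} = ennreal 2"
        by (subst emeasure_restrict_space) auto
      show "indicator {-1..1} x / emeasure (restrict_space lborel {-1..1}) {-1..1::real} = ennreal (1 / 2)"
        unfolding e x using divide_ennreal[of 1 2] by simp
    qed
  qed (auto intro!: measurable_restrict_space1)
  have r: "integrable (restrict_space lborel {-1..1}) h"
    using int by (simp add: integrable_restrict_space set_integrable_def)
  then show "integrable unif h"
    unfolding unif_eq by (subst integrable_density) (auto intro: borel_measurable_integrable)
  have "(\<integral>x. h x \<partial>unif) = (\<integral>x. h x \<partial>restrict_space lborel {-1..1}) / 2"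
    unfolding unif_eq using r by (subst integral_density) (auto intro: borel_measurable_integrable)
  also have "(\<integral>x. h x \<partial>restrict_space lborel {-1..1}) = integral {-1..1} h"
    using set_borel_integral_eq_integral(2)[OF int]
    by (simp add: integral_restrict_space set_lebesgue_integral_def)
  finally show "(\<integral>x. h x \<partial>unif) = integral {-1..1} h / 2" .
qed

text \<open>Each derivative removes at most one factor \<open>r\<close>. With x^2 - 1 for
  \<open>r\<close>, this makes the boundary terms vanish when the derivatives in Rodrigues' formula
  are integrated by parts.\<close>

lemma pderiv_iterate_dvd:
  fixes r :: "real poly"
  assumes "k \<le> n"
  shows "r ^ (n - k) dvd (pderiv ^^ k) (r ^ n)"
  using assms
proof (induction k)
  case (Suc k)
  then obtain s where s: "(pderiv ^^ k) (r ^ n) = r ^ (n - k) * s"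
    by (auto elim: dvdE)
  obtain l where l: "n - k = Suc l" "n - Suc k = l"
    using Suc.prems by (metis Suc_diff_Suc Suc_le_eq)
  show ?case
    unfolding l funpow.simps o_apply s
    by (simp add: pderiv_mult pderiv_power_Suc dvd_add dvd_mult2 dvd_mult dvd_smult le_imp_power_dvd del: power_Suc)
qed simp

lemma poly_integral_by_parts:
  fixes P Q :: "real poly"
  assumes "poly Q 1 = 0" "poly Q (-1) = 0"
  shows "integral {-1..1} (\<lambda>x. poly P x * poly (pderiv Q) x) = - integral {-1..1} (\<lambda>x. poly (pderiv P) x * poly Q x)"
proof -
  have "((\<lambda>x. poly (pderiv P) x * poly Q x + poly P x * poly (pderiv Q) x) has_integral
      (poly P 1 * poly Q 1 - poly P (-1) * poly Q (-1))) {-1..1}"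
    by (rule fundamental_theorem_of_calculus)
      (auto intro!: derivative_eq_intros simp flip: has_real_derivative_iff_has_vector_derivative)
  then have "integral {-1..1} (\<lambda>x. poly (pderiv P) x * poly Q x + poly P x * poly (pderiv Q) x) = 0"
    using assms by (simp add: integral_unique)
  moreover have "integral {-1..1} (\<lambda>x. poly (pderiv P) x * poly Q x + poly P x * poly (pderiv Q) x)
      = integral {-1..1} (\<lambda>x. poly (pderiv P) x * poly Q x) + integral {-1..1} (\<lambda>x. poly P x * poly (pderiv Q) x)"
    by (intro Henstock_Kurzweil_Integration.integral_add integrable_continuous_real continuous_intros)
  ultimately show ?thesis by simp
qed

text \<open>\<open>n\<close> integrations by parts move all derivatives of Rodrigues' formula onto
  \<open>P\<close>, and the \<open>n\<close>-th derivative of \<open>P\<close> is 0.\<close>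

lemma legendre_orthogonal_lower_degree:
  assumes "degree P < n"
  shows "integral {-1..1} (\<lambda>x. poly P x * poly (legendre n) x) = 0"
proof -
  let ?r = "[:-1, 0, 1:] :: real poly"
  have step: "integral {-1..1} (\<lambda>x. poly P x * poly ((pderiv ^^ n) (?r ^ n)) x)
      = (-1) ^ k * integral {-1..1} (\<lambda>x. poly ((pderiv ^^ k) P) x * poly ((pderiv ^^ (n - k)) (?r ^ n)) x)"
    if "k \<le> n" for k
    using that
  proof (induction k)
    case (Suc k)
    obtain l where l: "n - k = Suc l" "n - Suc k = l" "l < n"
      using Suc.prems by (metis Suc_diff_Suc Suc_le_eq diff_less less_imp_diff_less zero_less_Suc diff_Suc_less
          gr_zeroI not_less_zero)
    define Q where "Q = (pderiv ^^ l) (?r ^ n)"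
    have "?r ^ (n - l) dvd Q"
      unfolding Q_def using l by (intro pderiv_iterate_dvd) simp
    moreover have "?r dvd ?r ^ (n - l)"
      using l by (intro dvd_power) simp
    \<comment> \<open>At least one factor x^2 - 1 survives because \<open>l < n\<close>, so
      \<open>Q\<close> vanishes at both end points.\<close>
    ultimately have "?r dvd Q" by (rule dvd_trans[rotated])
    then have Q: "poly Q 1 = 0" "poly Q (-1) = 0"
      by (auto elim!: dvdE)
    have "integral {-1..1} (\<lambda>x. poly P x * poly ((pderiv ^^ n) (?r ^ n)) x)
        = (-1) ^ k * integral {-1..1} (\<lambda>x. poly ((pderiv ^^ k) P) x * poly (pderiv Q) x)"
      using Suc l by (simp add: Q_def)
    also have "\<dots> = (-1) ^ Suc k * integral {-1..1} (\<lambda>x. poly (pderiv ((pderiv ^^ k) P)) x * poly Q x)"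
      by (simp add: poly_integral_by_parts[OF Q])
    finally show ?case
      unfolding l Q_def by simp
  qed simp
  have "(pderiv ^^ n) P = 0"
  proof -
    have "degree ((pderiv ^^ k) P) = degree P - k" for k
      by (induction k) (auto simp: degree_pderiv)
    \<comment> \<open>\<open>n - 1\<close> derivatives exhaust the degree of \<open>P\<close>, with
      truncated subtraction if it is smaller, and leave a constant.\<close>
    from this[of "n - 1"] have "degree ((pderiv ^^ (n - 1)) P) = 0"
      using assms by simp
    then have "pderiv ((pderiv ^^ (n - 1)) P) = 0"
      by (simp add: pderiv_eq_0_iff)
    then show ?thesis
      using assms by (cases n) auto
  qed
  then have "integral {-1..1} (\<lambda>x. poly P x * poly ((pderiv ^^ n) (?r ^ n)) x) = 0"
    using step[of n] by simp
  then have "1 / (2 ^ n * fact n) * integral {-1..1} (\<lambda>x. poly P x * poly ((pderiv ^^ n) (?r ^ n)) x) = 0"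
    by simp
  then show ?thesis
    unfolding legendre_def integral_mult_right[symmetric] by (simp add: mult_ac)
qed

lemma degree_legendre: "degree (legendre n) \<le> n"
proof -
  have "degree ((pderiv ^^ k) P) = degree P - k" for k and P :: "real poly"
    by (induction k) (auto simp: degree_pderiv)
  then show ?thesis
    by (simp add: legendre_def degree_power_eq)
qed

lemma psi_continuous: "continuous_on A (psi n)"
  unfolding psi_def by (intro continuous_intros)

lemma psi_0: "psi 0 t = 1"
  by (simp add: psi_def legendre_def)

lemma psi_orthogonal:
  assumes "m \<noteq> n"
  shows "(\<integral>t. psi m t * psi n t \<partial>unif) = 0"
proof -
  have *: "integral {-1..1} (\<lambda>t. psi m t * psi n t) = 0" if "m < n" for m n
  proof -
    have "integral {-1..1} (\<lambda>t. poly (legendre m) t * poly (legendre n) t) = 0"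
      using degree_legendre[of m] that by (intro legendre_orthogonal_lower_degree) simp
    then have "sqrt (2 * real m + 1) * sqrt (2 * real n + 1) *
        integral {-1..1} (\<lambda>t. poly (legendre m) t * poly (legendre n) t) = 0"
      by simp
    then show ?thesis
      unfolding integral_mult_right[symmetric] psi_def by (simp add: mult_ac)
  qed
  have "integral {-1..1} (\<lambda>t. psi m t * psi n t) = 0"
    using *[of m n] *[of n m] assms by (cases "m < n") (auto simp: mult.commute)
  then show ?thesis
    by (subst unif_integral(2)) (auto intro!: continuous_intros psi_continuous)
qed

section \<open>Bounded random variables and orthogonality of the multivariate polynomials\<close>

lemma psi_bounded: "\<exists>K. \<forall>t\<in>{-1..1}. \<bar>psi n t\<bar> \<le> K"
proof -
  have "compact (psi n ` {-1..1})"
    by (intro compact_continuous_image psi_continuous) simp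
  then show ?thesis
    by (force dest!: compact_imp_bounded simp: bounded_iff)
qed

text \<open>Bounded rather than square integrable: the class is closed under products, and
  multiplication by its members preserves square integrability. The bound is restricted to the space
  of the measure because polynomials are unbounded outside it.\<close>

definition bounded_rv :: "((nat \<Rightarrow> real) \<Rightarrow> real) set" where
  "bounded_rv = {s \<in> borel_measurable param_measure. \<exists>K. \<forall>y\<in>space param_measure. \<bar>s y\<bar> \<le> K}"

lemma bounded_rv_mult: "s \<in> bounded_rv \<Longrightarrow> t \<in> bounded_rv \<Longrightarrow> (\<lambda>y. s y * t y) \<in> bounded_rv"
proof -
  assume *: "s \<in> bounded_rv" "t \<in> bounded_rv"
  then obtain K L where "\<forall>y\<in>space param_measure. \<bar>s y\<bar> \<le> K" "\<forall>y\<in>space param_measure. \<bar>t y\<bar> \<le> L"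
    by (auto simp: bounded_rv_def)
  then have "\<forall>y\<in>space param_measure. \<bar>s y * t y\<bar> \<le> K * L"
    unfolding abs_mult by (meson abs_ge_zero mult_mono order_trans)
  with * show ?thesis by (auto simp: bounded_rv_def)
qed

lemma bounded_rv_add: "s \<in> bounded_rv \<Longrightarrow> t \<in> bounded_rv \<Longrightarrow> (\<lambda>y. s y + t y) \<in> bounded_rv"
proof -
  assume *: "s \<in> bounded_rv" "t \<in> bounded_rv"
  then obtain K L where "\<forall>y\<in>space param_measure. \<bar>s y\<bar> \<le> K" "\<forall>y\<in>space param_measure. \<bar>t y\<bar> \<le> L"
    by (auto simp: bounded_rv_def)
  then have "\<forall>y\<in>space param_measure. \<bar>s y + t y\<bar> \<le> K + L"
    by (meson abs_triangle_ineq add_mono order_trans)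
  with * show ?thesis by (auto simp: bounded_rv_def)
qed

lemma bounded_rv_const: "(\<lambda>y. c) \<in> bounded_rv"
  by (auto simp: bounded_rv_def)

lemma bounded_rv_prod: "(\<And>i. i \<in> I \<Longrightarrow> s i \<in> bounded_rv) \<Longrightarrow> (\<lambda>y. \<Prod>i\<in>I. s i y) \<in> bounded_rv"
  by (induction I rule: infinite_finite_induct) (auto intro: bounded_rv_const bounded_rv_mult)

lemma bounded_rv_sum: "(\<And>i. i \<in> I \<Longrightarrow> s i \<in> bounded_rv) \<Longrightarrow> (\<lambda>y. \<Sum>i\<in>I. s i y) \<in> bounded_rv"
  by (induction I rule: infinite_finite_induct) (auto intro: bounded_rv_const bounded_rv_add)

lemma psi_unif_measurable: "psi n \<in> borel_measurable unif"
  using unif_integral(1)[OF psi_continuous] by (rule borel_measurable_integrable)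

lemma psi_coordinate_bounded_rv: "(\<lambda>y. psi n (y i)) \<in> bounded_rv"
proof -
  have "(\<lambda>y. y i) \<in> measurable param_measure unif"
    unfolding param_measure_def by (rule measurable_component_singleton) simp
  then have "(\<lambda>y. psi n (y i)) \<in> borel_measurable param_measure"
    using psi_unif_measurable by (rule measurable_compose)
  moreover obtain K where "\<forall>t\<in>{-1..1}. \<bar>psi n t\<bar> \<le> K"
    using psi_bounded by blast
  moreover have "y i \<in> {-1..1}" if "y \<in> space param_measure" for y
    using that unfolding param_measure_def space_PiM space_unif by blast
  ultimately show ?thesis
    unfolding bounded_rv_def by blast
qed

lemma Psi_bounded_rv: "Psi \<mu> \<in> bounded_rv"
  using bounded_rv_prod[OF psi_coordinate_bounded_rv] unfolding Psi_def[abs_def] .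

lemma poly_space_bounded_rv: "poly_space J \<subseteq> bounded_rv"
  by (auto simp: poly_space_def intro!: bounded_rv_sum bounded_rv_mult bounded_rv_const Psi_bounded_rv)

lemma bounded_rv_integrable:
  assumes "s \<in> bounded_rv"
  shows "integrable param_measure s"
proof -
  interpret prob_space param_measure by (rule prob_space_param)
  show ?thesis
    using assms unfolding bounded_rv_def by (auto intro!: integrable_const_bound AE_I2)
qed

text \<open>The integrand depends only on the coordinates in \<open>I\<close>. Restriction to them
  pushes the infinite product measure forward to a finite one, over which the integral
  factors.\<close>

lemma integral_param_prod:
  fixes h :: "nat \<Rightarrow> real \<Rightarrow> real"
  assumes "finite I" "\<And>i. i \<in> I \<Longrightarrow> integrable unif (h i)"
  shows "(\<integral>y. (\<Prod>i\<in>I. h i (y i)) \<partial>param_measure) = (\<Prod>i\<in>I. \<integral>t. h i t \<partial>unif)"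
proof -
  have "(\<Prod>i\<in>I. \<integral>t. h i t \<partial>unif) = (\<integral>z. (\<Prod>i\<in>I. h i (z i)) \<partial>PiM I (\<lambda>_. unif))"
    using assms by (intro param.product_integral_prod[symmetric])
  also have "PiM I (\<lambda>_. unif) = distr param_measure (PiM I (\<lambda>_. unif)) (\<lambda>y. restrict y I)"
    unfolding param_measure_def using assms(1) by (intro param.distr_PiM_restrict_finite[symmetric]) auto
  also have "(\<integral>z. (\<Prod>i\<in>I. h i (z i)) \<partial>\<dots>) = (\<integral>y. (\<Prod>i\<in>I. h i (restrict y I i)) \<partial>param_measure)"
  proof (rule integral_distr)
    show "(\<lambda>y. restrict y I) \<in> measurable param_measure (PiM I (\<lambda>_. unif))"
      unfolding param_measure_def by (rule measurable_restrict_subset) simp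
    show "(\<lambda>z. \<Prod>i\<in>I. h i (z i)) \<in> borel_measurable (PiM I (\<lambda>_. unif))"
    proof (intro borel_measurable_prod)
      fix i assume i: "i \<in> I"
      have "h i \<in> borel_measurable unif"
        using assms(2)[OF i] by (rule borel_measurable_integrable)
      with measurable_component_singleton[OF i] show "(\<lambda>z. h i (z i)) \<in> borel_measurable (PiM I (\<lambda>_. unif))"
        by (rule measurable_compose)
    qed
  qed
  finally show ?thesis by simp
qed

text \<open>On the union of the supports both products run over the same coordinates, as
  \<open>psi 0\<close> is 1. The indices differ at some coordinate, which lies in this union, and
  its factor vanishes.\<close>

lemma Psi_orthogonal:
  assumes "\<mu> \<in> multi_indices" "\<nu> \<in> multi_indices" "\<mu> \<noteq> \<nu>"
  shows "(\<integral>y. Psi \<mu> y * Psi \<nu> y \<partial>param_measure) = 0"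
proof -
  let ?I = "{i. \<mu> i \<noteq> 0} \<union> {i. \<nu> i \<noteq> 0}"
  have fin: "finite ?I" using assms by (simp add: multi_indices_def)
  have "Psi \<xi> y = (\<Prod>i\<in>?I. psi (\<xi> i) (y i))" if "{i. \<xi> i \<noteq> 0} \<subseteq> ?I" for \<xi> y
    unfolding Psi_def using fin that by (intro prod.mono_neutral_left) (auto simp: psi_0)
  then have "(\<integral>y. Psi \<mu> y * Psi \<nu> y \<partial>param_measure) = (\<integral>y. (\<Prod>i\<in>?I. psi (\<mu> i) (y i) * psi (\<nu> i) (y i)) \<partial>param_measure)"
    by (simp add: prod.distrib)
  also have "\<dots> = (\<Prod>i\<in>?I. \<integral>t. psi (\<mu> i) t * psi (\<nu> i) t \<partial>unif)"
    by (intro integral_param_prod[OF fin] unif_integral(1) continuous_intros psi_continuous)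
  also have "\<dots> = 0"
  proof -
    obtain i where "\<mu> i \<noteq> \<nu> i" using assms(3) by auto
    with fin show ?thesis
      by (intro prod_zero[OF fin] bexI[of _ i]) (auto simp: psi_orthogonal)
  qed
  finally show ?thesis .
qed

lemma poly_space_orthogonal:
  assumes "J \<subseteq> multi_indices" "K \<subseteq> multi_indices" "J \<inter> K = {}" "s \<in> poly_space J" "t \<in> poly_space K"
  shows "(\<integral>y. s y * t y \<partial>param_measure) = 0"
proof -
  obtain c d where s: "s = (\<lambda>y. \<Sum>\<mu>\<in>J. c \<mu> * Psi \<mu> y)" and t: "t = (\<lambda>y. \<Sum>\<nu>\<in>K. d \<nu> * Psi \<nu> y)"
    using assms by (auto simp: poly_space_def)
  have "(\<integral>y. s y * t y \<partial>param_measure) = (\<integral>y. (\<Sum>\<mu>\<in>J. \<Sum>\<nu>\<in>K. (c \<mu> * d \<nu>) * (Psi \<mu> y * Psi \<nu> y)) \<partial>param_measure)"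
    by (simp add: s t sum_product mult_ac)
  also have "\<dots> = (\<Sum>\<mu>\<in>J. \<Sum>\<nu>\<in>K. (c \<mu> * d \<nu>) * (\<integral>y. Psi \<mu> y * Psi \<nu> y \<partial>param_measure))"
  proof -
    have int: "integrable param_measure (\<lambda>y. (c \<mu> * d \<nu>) * (Psi \<mu> y * Psi \<nu> y))" for \<mu> \<nu>
      by (intro integrable_mult_right bounded_rv_integrable bounded_rv_mult Psi_bounded_rv)
    then show ?thesis
      by (simp add: Bochner_Integration.integral_sum Bochner_Integration.integrable_sum)
  qed
  also have "\<dots> = 0"
  proof (intro sum.neutral ballI)
    fix \<mu> \<nu> assume "\<mu> \<in> J" "\<nu> \<in> K"
    with assms(1-3) have "\<mu> \<in> multi_indices" "\<nu> \<in> multi_indices" "\<mu> \<noteq> \<nu>" by auto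
    then show "(c \<mu> * d \<nu>) * (\<integral>y. Psi \<mu> y * Psi \<nu> y \<partial>param_measure) = 0"
      by (simp add: Psi_orthogonal)
  qed
  finally show ?thesis .
qed

subsection \<open>Finite-dimensional Riesz representation and weighted forms\<close>

context psd_form
begin

lemma mono_subspace: "subspace X \<Longrightarrow> X \<subseteq> U \<Longrightarrow> psd_form X B"
  by unfold_locales (auto intro: bilinear_on_subset[OF bil] sym nonneg)

lemma null_imp_orthogonal: "x \<in> U \<Longrightarrow> y \<in> U \<Longrightarrow> B x x = 0 \<Longrightarrow> B x y = 0"
  using Cauchy_Schwarz[of x y] by simp

text \<open>The form may be degenerate, as the gradient form is on functions taken up to null sets, so the
  functional must vanish on its kernel.\<close>

lemma finite_dim_Riesz:
  assumes "finite S" "S \<subseteq> U"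
    and "\<And>x y. x \<in> U \<Longrightarrow> y \<in> U \<Longrightarrow> l (x + y) = l x + l y"
    and "\<And>c x. x \<in> U \<Longrightarrow> l (c *\<^sub>R x) = c * (l x :: real)"
    and "\<And>x. x \<in> U \<Longrightarrow> B x x = 0 \<Longrightarrow> l x = 0"
  shows "\<exists>t\<in>span S. \<forall>x\<in>span S. B t x = l x"
  using assms
proof (induction S arbitrary: l)
  case empty
  have "l 0 = 0"
    using empty.prems(3)[of 0 0] subspace_0[OF sub] by simp
  then show ?case
    using bilinear_on_zero_left[OF bil sub subspace_0[OF sub]] by simp
next
  case (insert b S)
  have b: "b \<in> U" and S: "span S \<subseteq> U"
    using insert.prems span_minimal[OF _ sub, of S] by auto
  obtain t where t: "t \<in> span S" "\<And>x. x \<in> span S \<Longrightarrow> B t x = l x"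
  proof -
    have "\<exists>t\<in>span S. \<forall>x\<in>span S. B t x = l x"
      by (rule insert.IH) (use insert.prems in auto)
    then show ?thesis using that by blast
  qed
  \<comment> \<open>The projection of \<open>b\<close> onto the span; subtracting it from
    \<open>b\<close> below is a Gram-Schmidt step.\<close>
  obtain p where p: "p \<in> span S" "\<And>x. x \<in> span S \<Longrightarrow> B p x = B b x"
  proof -
    have "\<exists>p\<in>span S. \<forall>x\<in>span S. B p x = B b x"
    proof (rule insert.IH)
      show "B b x = 0" if "x \<in> U" "B x x = 0" for x
        using null_imp_orthogonal[OF that(1) b that(2)] sym[OF that(1) b] by simp
    qed (use insert.prems b in \<open>auto simp: bilinear_on_add_right[OF bil] bilinear_on_scale_right[OF bil]\<close>)
    then show ?thesis using that by blast
  qed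
  define y where "y = b + (-1) *\<^sub>R p"
  have pU: "p \<in> U" "t \<in> U" using p t S by auto
  from pU(1) have pU': "(-1) *\<^sub>R p \<in> U" by (rule subspace_scale[OF sub])
  with b have yU: "y \<in> U" unfolding y_def by (rule subspace_add[OF sub])
  note pU = pU pU' yU
  have y_orth: "B y x = 0" if "x \<in> span S" for x
  proof -
    have x: "x \<in> U" using that S by auto
    have "B y x = B b x + - 1 * B p x"
      unfolding y_def bilinear_on_add_left[OF bil b pU(3) x] bilinear_on_scale_left[OF bil pU(1) x] ..
    with p that show ?thesis by simp
  qed
  \<comment> \<open>As \<open>p\<close> lies in the span of \<open>S\<close>, the generator
    \<open>b\<close> can be exchanged for \<open>y\<close>.\<close>
  have span_insert': "\<exists>k x'. x' \<in> span S \<and> x = x' + k *\<^sub>R y" if x: "x \<in> span (insert b S)" for x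
  proof -
    obtain k where "x - k *\<^sub>R b \<in> span S"
      using x span_breakdown_eq by blast
    then have "x - k *\<^sub>R b + k *\<^sub>R p \<in> span S"
      using p by (intro span_add span_scale)
    moreover have "x = (x - k *\<^sub>R b + k *\<^sub>R p) + k *\<^sub>R y"
      by (simp add: y_def algebra_simps)
    ultimately show ?thesis by blast
  qed
  \<comment> \<open>If \<open>y\<close> has norm 0, then \<open>l y = 0\<close> by the assumption on
    the kernel, so every coefficient satisfies the equation below; 0 is taken.\<close>
  define c where "c = (if B y y = 0 then 0 else l y / B y y)"
  have c: "c * B y y = l y"
    using insert.prems(4)[OF pU(4)] by (auto simp: c_def)
  have "B (t + c *\<^sub>R y) x = l x" if x: "x \<in> span (insert b S)" for x
  proof -
    obtain k x' where x': "x' \<in> span S" "x = x' + k *\<^sub>R y"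
      using span_insert'[OF x] by blast
    have mem: "x' \<in> U" "k *\<^sub>R y \<in> U" "c *\<^sub>R y \<in> U" "x \<in> U"
    proof -
      show x'U: "x' \<in> U" using x'(1) S by auto
      show k: "k *\<^sub>R y \<in> U" "c *\<^sub>R y \<in> U" using yU by (rule subspace_scale[OF sub])+
      show "x \<in> U" unfolding x'(2) using x'U k(1) by (rule subspace_add[OF sub])
    qed
    have "B (t + c *\<^sub>R y) x = B t x' + k * B t y + c * B y x' + c * k * B y y"
      using mem pU unfolding x'(2)
      by (simp add: bilinear_on_add_left[OF bil] bilinear_on_add_right[OF bil] bilinear_on_scale_left[OF bil]
          bilinear_on_scale_right[OF bil] algebra_simps)
    also have "\<dots> = l x' + k * l y"
      using t(2)[OF x'(1)] y_orth[OF x'(1)] y_orth[OF t(1)] sym[OF pU(2,4)] c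
      by (simp add: algebra_simps)
    also have "\<dots> = l x"
      using mem pU insert.prems(2)[OF mem(1,2)] insert.prems(3)[OF pU(4), of k] by (simp only: x'(2))
    finally show ?thesis .
  qed
  moreover have "t + c *\<^sub>R y \<in> span (insert b S)"
  proof -
    have "t \<in> span (insert b S)" "p \<in> span (insert b S)" "b \<in> span (insert b S)"
      using t p span_mono[of S "insert b S"] by (auto intro: span_base)
    then show ?thesis
      unfolding y_def by (intro span_add span_scale)
  qed
  ultimately show ?case by blast
qed

end

text \<open>Linear maps into L2 modulo null sets, without forming the quotient. Gradients are of
  this kind, since a representative is chosen separately for each argument.\<close>

definition AE_linear_on :: "'c measure \<Rightarrow> 'a::real_vector set \<Rightarrow> ('a \<Rightarrow> 'c \<Rightarrow> 'b::euclidean_space) \<Rightarrow> bool" where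
  "AE_linear_on M U A \<longleftrightarrow> (\<forall>u\<in>U. A u \<in> L2 M) \<and>
     (\<forall>u\<in>U. \<forall>v\<in>U. AE z in M. A (u + v) z = A u z + A v z) \<and>
     (\<forall>c. \<forall>u\<in>U. AE z in M. A (c *\<^sub>R u) z = c *\<^sub>R A u z)"

lemma AE_linear_on_compose:
  fixes T :: "'b::euclidean_space \<Rightarrow> 'c::euclidean_space"
  assumes "AE_linear_on M U A" "bounded_linear T"
  shows "AE_linear_on M U (\<lambda>u z. T (A u z))"
proof -
  interpret T: bounded_linear T by fact
  have "AE z in M. T (A (u + v) z) = T (A u z) + T (A v z)" if "u \<in> U" "v \<in> U" for u v
  proof -
    have "AE z in M. A (u + v) z = A u z + A v z"
      using assms(1) that by (simp add: AE_linear_on_def)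
    then show ?thesis by eventually_elim (simp add: T.add)
  qed
  moreover have "AE z in M. T (A (c *\<^sub>R u) z) = c *\<^sub>R T (A u z)" if "u \<in> U" for c u
  proof -
    have "AE z in M. A (c *\<^sub>R u) z = c *\<^sub>R A u z"
      using assms(1) that by (simp add: AE_linear_on_def)
    then show ?thesis by eventually_elim (simp add: T.scaleR)
  qed
  ultimately show ?thesis
    using assms by (auto simp: AE_linear_on_def intro: L2_bounded_linear)
qed

definition bounded_weight :: "'c measure \<Rightarrow> ('c \<Rightarrow> real) \<Rightarrow> bool" where
  "bounded_weight M h \<longleftrightarrow> h \<in> borel_measurable M \<and> (\<exists>K. AE z in M. \<bar>h z\<bar> \<le> K)"

lemma bounded_weight_1: "bounded_weight M (\<lambda>z. 1)"
  by (auto simp: bounded_weight_def)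

lemma weighted_inner_integrable:
  assumes "bounded_weight M h" "F \<in> L2 M" "G \<in> L2 M"
  shows "integrable M (\<lambda>z. h z * (F z \<bullet> G z))"
  using L2_integrable_inner[OF L2_mult_bounded[OF assms(2)] assms(3)] assms(1)
  by (auto simp: bounded_weight_def)

lemma weighted_integral_linear_left:
  assumes h: "bounded_weight M h" and A: "AE_linear_on M U A" and U: "subspace U" and G: "G \<in> L2 M"
  shows "u \<in> U \<Longrightarrow> v \<in> U \<Longrightarrow>
      (\<integral>z. h z * (A (u + v) z \<bullet> G z) \<partial>M) = (\<integral>z. h z * (A u z \<bullet> G z) \<partial>M) + (\<integral>z. h z * (A v z \<bullet> G z) \<partial>M)"
    and "u \<in> U \<Longrightarrow> (\<integral>z. h z * (A (c *\<^sub>R u) z \<bullet> G z) \<partial>M) = c * (\<integral>z. h z * (A u z \<bullet> G z) \<partial>M)"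
proof -
  have int: "integrable M (\<lambda>z. h z * (A u z \<bullet> G z))" if "u \<in> U" for u
    using weighted_inner_integrable[OF h _ G] A that by (simp add: AE_linear_on_def)
  have meas: "(\<lambda>z. h z * (A u z \<bullet> G z)) \<in> borel_measurable M" if "u \<in> U" for u
    using int[OF that] by simp
  show "(\<integral>z. h z * (A (u + v) z \<bullet> G z) \<partial>M) = (\<integral>z. h z * (A u z \<bullet> G z) \<partial>M) + (\<integral>z. h z * (A v z \<bullet> G z) \<partial>M)"
    if "u \<in> U" "v \<in> U"
  proof -
    have "AE z in M. A (u + v) z = A u z + A v z"
      using A that by (simp add: AE_linear_on_def)
    then have "(\<integral>z. h z * (A (u + v) z \<bullet> G z) \<partial>M) = (\<integral>z. h z * (A u z \<bullet> G z) + h z * (A v z \<bullet> G z) \<partial>M)"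
      using that U by (intro integral_cong_AE borel_measurable_add meas subspace_add)
        (auto elim!: eventually_mono simp: inner_add_left distrib_left)
    then show ?thesis using that by (simp add: int)
  qed
  show "(\<integral>z. h z * (A (c *\<^sub>R u) z \<bullet> G z) \<partial>M) = c * (\<integral>z. h z * (A u z \<bullet> G z) \<partial>M)" if "u \<in> U"
  proof -
    have "AE z in M. A (c *\<^sub>R u) z = c *\<^sub>R A u z"
      using A that by (simp add: AE_linear_on_def)
    then have "(\<integral>z. h z * (A (c *\<^sub>R u) z \<bullet> G z) \<partial>M) = (\<integral>z. c * (h z * (A u z \<bullet> G z)) \<partial>M)"
      using that U by (intro integral_cong_AE borel_measurable_times borel_measurable_const meas subspace_scale)
        (auto elim!: eventually_mono)
    then show ?thesis by simp
  qed
qed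

lemma bilinear_on_weighted_integral:
  assumes h: "bounded_weight M h" and A: "AE_linear_on M U A" and C: "AE_linear_on M W C"
    and U: "subspace U" and W: "subspace W"
  shows "bilinear_on U W (\<lambda>u w. \<integral>z. h z * (A u z \<bullet> C w z) \<partial>M)"
proof -
  have AL: "A u \<in> L2 M" if "u \<in> U" for u using A that by (simp add: AE_linear_on_def)
  have CL: "C u \<in> L2 M" if "u \<in> W" for u using C that by (simp add: AE_linear_on_def)
  show ?thesis
    using weighted_integral_linear_left[OF h A U CL] weighted_integral_linear_left[OF h C W AL]
    unfolding bilinear_on_def by (simp add: inner_commute)
qed

lemma psd_form_weighted_integral:
  assumes h: "bounded_weight M h" "AE z in M. 0 \<le> h z" and A: "AE_linear_on M U A" and U: "subspace U"
  shows "psd_form U (\<lambda>u v. \<integral>z. h z * (A u z \<bullet> A v z) \<partial>M)"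
proof
  show "bilinear_on U U (\<lambda>u v. \<integral>z. h z * (A u z \<bullet> A v z) \<partial>M)"
    by (rule bilinear_on_weighted_integral[OF h(1) A A U U])
  show "(\<integral>z. h z * (A u z \<bullet> A v z) \<partial>M) = (\<integral>z. h z * (A v z \<bullet> A u z) \<partial>M)" for u v
    by (simp add: inner_commute)
  show "0 \<le> (\<integral>z. h z * (A u z \<bullet> A u z) \<partial>M)" for u
    using h(2) by (intro integral_nonneg_AE) (auto elim!: eventually_mono)
qed fact

text \<open>For forms defined by iterated integrals, which are identified with integrals over the
  product measure only on a carrier.\<close>

lemma psd_form_cong:
  assumes "psd_form U B" "\<And>x y. x \<in> U \<Longrightarrow> y \<in> U \<Longrightarrow> B' x y = B x y"
  shows "psd_form U B'"
proof -
  interpret psd_form U B by fact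
  have "B' (x + y) z = B (x + y) z" "B' z (x + y) = B z (x + y)" "B' (c *\<^sub>R x) z = B (c *\<^sub>R x) z" "B' z (c *\<^sub>R x) = B z (c *\<^sub>R x)"
    if "x \<in> U" "y \<in> U" "z \<in> U" for x y z c
    using that sub assms(2) by (auto intro: subspace_add subspace_scale)
  then show ?thesis
    using sub bil sym nonneg assms(2) by unfold_locales (auto simp: bilinear_on_def)
qed

lemma bilinear_on_cong:
  assumes "bilinear_on U W B" "subspace U" "subspace W" "\<And>x y. x \<in> U \<Longrightarrow> y \<in> W \<Longrightarrow> B' x y = B x y"
  shows "bilinear_on U W B'"
proof -
  have "B' (x + y) z = B (x + y) z" "B' (c *\<^sub>R x) z = B (c *\<^sub>R x) z"
    if "x \<in> U" "y \<in> U" "z \<in> W" for x y z c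
    using that assms by (auto intro: subspace_add subspace_scale)
  moreover have "B' z (x + y) = B z (x + y)" "B' z (c *\<^sub>R x) = B z (c *\<^sub>R x)"
    if "x \<in> W" "y \<in> W" "z \<in> U" for x y z c
    using that assms by (auto intro: subspace_add subspace_scale)
  ultimately show ?thesis
    using assms(1,4) by (auto simp: bilinear_on_def)
qed

subsection \<open>Tensor product spaces\<close>

lemma sum_fun_apply: "(\<Sum>i\<in>I. f i) x = (\<Sum>i\<in>I. f i x)"
  by (induction I rule: infinite_finite_induct) auto

lemma finite_dim_space_iff_span:
  fixes X :: "(real ^ 'd \<Rightarrow> 'b::real_vector) set"
  shows "finite_dim_space X \<longleftrightarrow> (\<exists>B. finite B \<and> X = span B)"
proof -
  have "(\<lambda>x. \<Sum>b\<in>B. c b *\<^sub>R b x) = (\<Sum>b\<in>B. c b *\<^sub>R b)" for c :: "_ \<Rightarrow> real" and B :: "(real ^ 'd \<Rightarrow> 'b) set"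
    by (rule ext) (simp add: sum_fun_apply)
  then have *: "{\<lambda>x. \<Sum>b\<in>B. c b *\<^sub>R b x | c. True} = span B" if "finite B" for B :: "(real ^ 'd \<Rightarrow> 'b) set"
    unfolding span_finite[OF that] by auto
  show ?thesis
    unfolding finite_dim_space_def by (intro iff_exI conj_cong refl arg_cong2[where f = "(=)"] *)
qed

lemma finite_dim_space_subspace: "finite_dim_space X \<Longrightarrow> subspace X"
  by (auto simp: finite_dim_space_iff_span)

lemma subspace_sum_space: "subspace X \<Longrightarrow> subspace Z \<Longrightarrow> subspace (sum_space X Z)"
  using subspace_sums[of X Z] by (simp add: sum_space_def plus_fun_def)

lemma sum_space_subset: "subspace X \<Longrightarrow> X \<subseteq> Y \<Longrightarrow> Z \<subseteq> Y \<Longrightarrow> subspace Y \<Longrightarrow> sum_space X Z \<subseteq> Y"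
  using subspace_add[of Y] by (auto simp: sum_space_def plus_fun_def)

lemma sum_space_upper: "subspace X \<Longrightarrow> subspace Z \<Longrightarrow> X \<subseteq> sum_space X Z \<and> Z \<subseteq> sum_space X Z"
proof -
  assume "subspace X" "subspace Z"
  then have 0: "0 \<in> X" "0 \<in> Z"
    by (auto intro: subspace_0)
  have "v \<in> sum_space X Z" if "v \<in> X" for v
    unfolding sum_space_def mem_Collect_eq using that 0
    by (intro exI[of _ v] exI[of _ 0]) auto
  moreover have "z \<in> sum_space X Z" if "z \<in> Z" for z
    unfolding sum_space_def mem_Collect_eq using that 0
    by (intro exI[of _ 0] exI[of _ z]) auto
  ultimately show ?thesis by blast
qed

lemma finite_dim_sum_space:
  assumes "finite_dim_space X" "finite_dim_space Z"
  shows "finite_dim_space (sum_space X Z)"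
proof -
  obtain B C where "finite B" "X = span B" "finite C" "Z = span C"
    using assms by (auto simp: finite_dim_space_iff_span)
  moreover have "sum_space X Z = span (B \<union> C)" if "X = span B" "Z = span C"
    unfolding span_Un that by (auto simp: sum_space_def plus_fun_def)
  ultimately show ?thesis
    unfolding finite_dim_space_iff_span by blast
qed

lemma tensor_eq:
  "tensor X S = {\<Sum>i<n. (\<lambda>y. s i y *\<^sub>R v i) | (n::nat) s v. \<forall>i<n. s i \<in> S \<and> v i \<in> X}"
proof -
  have *: "(\<lambda>y x. \<Sum>i<n. s i y *\<^sub>R v i x) = (\<Sum>i<n. (\<lambda>y. s i y *\<^sub>R v i))"
    for n :: nat and s :: "nat \<Rightarrow> (nat \<Rightarrow> real) \<Rightarrow> real" and v :: "nat \<Rightarrow> real ^ 'a \<Rightarrow> 'b"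
    by (intro ext) (simp add: sum_fun_apply)
  show ?thesis unfolding tensor_def * ..
qed

lemma tensorE:
  assumes "u \<in> tensor X S"
  obtains n :: nat and s v where "u = (\<Sum>i<n. (\<lambda>y. s i y *\<^sub>R v i))" "\<And>i. i < n \<Longrightarrow> s i \<in> S" "\<And>i. i < n \<Longrightarrow> v i \<in> X"
  using assms unfolding tensor_eq by blast

lemma tensor_mono: "X \<subseteq> X' \<Longrightarrow> S \<subseteq> S' \<Longrightarrow> tensor X S \<subseteq> tensor X' S'"
  unfolding tensor_def by blast

lemma tensorI:
  fixes n :: nat
  assumes "\<And>i. i < n \<Longrightarrow> s i \<in> S" "\<And>i. i < n \<Longrightarrow> v i \<in> X"
  shows "(\<Sum>i<n. (\<lambda>y. s i y *\<^sub>R v i)) \<in> tensor X S"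
  using assms unfolding tensor_eq by blast

lemma tensor_add_elementary:
  assumes "u \<in> tensor X S" "t \<in> S" "b \<in> X"
  shows "u + (\<lambda>y. t y *\<^sub>R b) \<in> tensor X S"
proof -
  obtain n :: nat and s a where u: "u = (\<Sum>i<n. (\<lambda>y. s i y *\<^sub>R a i))" "\<And>i. i < n \<Longrightarrow> s i \<in> S" "\<And>i. i < n \<Longrightarrow> a i \<in> X"
    using assms(1) by (rule tensorE) (rule that)
  have "(\<Sum>i<Suc n. (\<lambda>y. (s(n := t)) i y *\<^sub>R (a(n := b)) i)) = u + (\<lambda>y. t y *\<^sub>R b)"
    unfolding u sum.lessThan_Suc by (intro arg_cong2[where f = "(+)"] sum.cong) auto
  moreover have "(\<Sum>i<Suc n. (\<lambda>y. (s(n := t)) i y *\<^sub>R (a(n := b)) i)) \<in> tensor X S"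
    by (rule tensorI) (use u assms in \<open>auto simp: less_Suc_eq\<close>)
  ultimately show ?thesis by (simp only:)
qed

text \<open>The summands of \<open>v\<close> are appended one by one, which avoids splicing two
  indexed families.\<close>

lemma tensor_add:
  assumes "u \<in> tensor X S" "v \<in> tensor X S"
  shows "u + v \<in> tensor X S"
proof -
  obtain n :: nat and s a where v: "v = (\<Sum>i<n. (\<lambda>y. s i y *\<^sub>R a i))" "\<And>i. i < n \<Longrightarrow> s i \<in> S" "\<And>i. i < n \<Longrightarrow> a i \<in> X"
    using assms(2) by (rule tensorE) (rule that)
  have "u + (\<Sum>i<m. (\<lambda>y. s i y *\<^sub>R a i)) \<in> tensor X S" if "m \<le> n" for m
    using that
  proof (induction m)
    case (Suc m)
    have "u + (\<Sum>i<m. (\<lambda>y. s i y *\<^sub>R a i)) + (\<lambda>y. s m y *\<^sub>R a m) \<in> tensor X S"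
    proof (rule tensor_add_elementary)
      show "u + (\<Sum>i<m. (\<lambda>y. s i y *\<^sub>R a i)) \<in> tensor X S"
        by (rule Suc.IH) (use Suc.prems in simp)
    qed (use v(2,3) Suc.prems in auto)
    then show ?case by (simp only: sum.lessThan_Suc add.assoc)
  qed (use assms(1) in simp)
  from this[of n] show ?thesis unfolding v(1) by simp
qed

lemma tensor_elementary: "s \<in> S \<Longrightarrow> v \<in> X \<Longrightarrow> (\<lambda>y. s y *\<^sub>R v) \<in> tensor X S"
  unfolding tensor_eq
  by (auto intro!: exI[of _ "1 :: nat"] exI[of _ "\<lambda>_. s"] exI[of _ "\<lambda>_. v"])

lemma subspace_tensor:
  assumes "subspace X"
  shows "subspace (tensor X S)"
  unfolding subspace_def
proof (intro conjI ballI allI)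
  show "0 \<in> tensor X S"
    unfolding tensor_eq by (auto intro!: exI[of _ "0 :: nat"])
  show "u + v \<in> tensor X S" if "u \<in> tensor X S" "v \<in> tensor X S" for u v
    using that by (rule tensor_add)
  fix c and u assume "u \<in> tensor X S"
  then obtain n :: nat and s a where u: "u = (\<Sum>i<n. (\<lambda>y. s i y *\<^sub>R a i))" "\<And>i. i < n \<Longrightarrow> s i \<in> S" "\<And>i. i < n \<Longrightarrow> a i \<in> X"
    by (rule tensorE) (rule that)
  \<comment> \<open>The scalar goes into the spatial factor, because \<open>X\<close> is a subspace
    while \<open>S\<close> is an arbitrary set.\<close>
  have "c *\<^sub>R u = (\<Sum>i<n. (\<lambda>y. s i y *\<^sub>R (c *\<^sub>R a i)))"
    by (simp add: u scaleR_sum_right fun_eq_iff sum_fun_apply mult.commute)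
  also have "\<dots> \<in> tensor X S"
    using u assms by (intro tensorI) (auto intro: subspace_scale)
  finally show "c *\<^sub>R u \<in> tensor X S" .
qed

lemma tensor_subsetI:
  assumes "subspace V" "\<And>s v. s \<in> S \<Longrightarrow> v \<in> X \<Longrightarrow> (\<lambda>y. s y *\<^sub>R v) \<in> V"
  shows "tensor X S \<subseteq> V"
  unfolding tensor_eq using assms by (auto intro!: subspace_sum)

text \<open>Gives access to the deterministic hypotheses at each parameter value.\<close>

lemma tensor_apply:
  assumes "subspace X" "u \<in> tensor X S"
  shows "u y \<in> X"
proof -
  have "subspace {u. u y \<in> X}"
    using assms(1) by (auto simp: subspace_def)
  then have "tensor X S \<subseteq> {u. u y \<in> X}"
    using assms(1) by (intro tensor_subsetI) (auto intro: subspace_scale)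
  with assms(2) show ?thesis by auto
qed

lemma tensor_sum_space:
  assumes "subspace X" "subspace Z" "u \<in> tensor (sum_space X Z) S"
  obtains v z where "v \<in> tensor X S" "z \<in> tensor Z S" "u = v + z"
proof -
  let ?W = "{v + z | v z. v \<in> tensor X S \<and> z \<in> tensor Z S}"
  have "subspace ?W"
    using subspace_tensor assms(1,2) by (intro subspace_sums)
  moreover have "(\<lambda>y. s y *\<^sub>R w) \<in> ?W" if s: "s \<in> S" and w: "w \<in> sum_space X Z" for s w
  proof -
    obtain v z where "w = v + z" "v \<in> X" "z \<in> Z"
      using w by (auto simp: sum_space_def plus_fun_def)
    then have "(\<lambda>y. s y *\<^sub>R w) = (\<lambda>y. s y *\<^sub>R v) + (\<lambda>y. s y *\<^sub>R z)"
      by (simp add: fun_eq_iff scaleR_add_right)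
    then show ?thesis
      using tensor_elementary s \<open>v \<in> X\<close> \<open>z \<in> Z\<close> by blast
  qed
  ultimately have "tensor (sum_space X Z) S \<subseteq> ?W"
    by (rule tensor_subsetI)
  with assms(3) that show ?thesis by blast
qed

lemma poly_space_mono:
  assumes "J \<subseteq> K" "finite K"
  shows "poly_space J \<subseteq> poly_space K"
proof
  fix s assume "s \<in> poly_space J"
  then obtain c where s: "s = (\<lambda>y. \<Sum>\<mu>\<in>J. c \<mu> * Psi \<mu> y)"
    by (auto simp: poly_space_def)
  \<comment> \<open>The coefficients outside \<open>J\<close> are set to 0.\<close>
  have "s = (\<lambda>y. \<Sum>\<mu>\<in>K. (if \<mu> \<in> J then c \<mu> else 0) * Psi \<mu> y)"
    unfolding s
  proof
    fix y
    have "(\<Sum>\<mu>\<in>K. (if \<mu> \<in> J then c \<mu> else 0) * Psi \<mu> y) = (\<Sum>\<mu>\<in>J. (if \<mu> \<in> J then c \<mu> else 0) * Psi \<mu> y)"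
      using assms by (intro sum.mono_neutral_right) auto
    then show "(\<Sum>\<mu>\<in>J. c \<mu> * Psi \<mu> y) = (\<Sum>\<mu>\<in>K. (if \<mu> \<in> J then c \<mu> else 0) * Psi \<mu> y)"
      by simp
  qed
  then show "s \<in> poly_space K"
    unfolding poly_space_def mem_Collect_eq
    by (intro exI[of _ "\<lambda>\<mu>. if \<mu> \<in> J then c \<mu> else 0"] conjI TrueI)
qed

lemma tensor_poly_space_Un:
  assumes "subspace X" "finite J" "finite K" "J \<inter> K = {}" "u \<in> tensor X (poly_space (J \<union> K))"
  obtains v z where "v \<in> tensor X (poly_space J)" "z \<in> tensor X (poly_space K)" "u = v + z"
proof -
  let ?W = "{v + z | v z. v \<in> tensor X (poly_space J) \<and> z \<in> tensor X (poly_space K)}"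
  have "subspace ?W"
    using subspace_tensor assms(1) by (intro subspace_sums)
  moreover have "(\<lambda>y. s y *\<^sub>R w) \<in> ?W" if s_in: "s \<in> poly_space (J \<union> K)" and w: "w \<in> X" for s w
  proof -
    obtain c where s: "s = (\<lambda>y. \<Sum>\<mu>\<in>J \<union> K. c \<mu> * Psi \<mu> y)"
      using s_in unfolding poly_space_def by blast
    define s1 where "s1 y = (\<Sum>\<mu>\<in>J. c \<mu> * Psi \<mu> y)" for y
    define s2 where "s2 y = (\<Sum>\<mu>\<in>K. c \<mu> * Psi \<mu> y)" for y
    have "(\<lambda>y. s y *\<^sub>R w) = (\<lambda>y. s1 y *\<^sub>R w) + (\<lambda>y. s2 y *\<^sub>R w)"
      using assms by (simp add: fun_eq_iff s s1_def s2_def sum.union_disjoint scaleR_add_left)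
    moreover have "s1 \<in> poly_space J" "s2 \<in> poly_space K"
      unfolding poly_space_def s1_def[abs_def] s2_def[abs_def] by blast+
    ultimately show ?thesis
      using tensor_elementary w by blast
  qed
  ultimately have "tensor X (poly_space (J \<union> K)) \<subseteq> ?W"
    by (rule tensor_subsetI)
  with assms(5) that show ?thesis by blast
qed

subsection \<open>Random fields\<close>

definition sym_part :: "real ^ 'd ^ 'd \<Rightarrow> real ^ 'd ^ 'd" where
  "sym_part A = (1 / 2) *\<^sub>R (A + transpose A)"

lemma strain_eq: "strain D v x = sym_part (grad D v x)"
  by (simp add: strain_def sym_part_def)

lemma norm_transpose: "norm (transpose A) = norm A" for A :: "real ^ 'n ^ 'm"
proof -
  have "(norm A)\<^sup>2 = (\<Sum>i\<in>UNIV. \<Sum>j\<in>UNIV. (A $ i $ j)\<^sup>2)" for A :: "real ^ 'n ^ 'm"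
    by (simp add: norm_vec_def L2_set_def sum_nonneg)
  moreover have "(norm (transpose A))\<^sup>2 = (\<Sum>j\<in>UNIV. \<Sum>i\<in>UNIV. (A $ i $ j)\<^sup>2)"
    by (simp add: norm_vec_def L2_set_def sum_nonneg transpose_def)
  moreover have "(\<Sum>j\<in>UNIV. \<Sum>i\<in>UNIV. (A $ i $ j)\<^sup>2) = (\<Sum>i\<in>UNIV. \<Sum>j\<in>UNIV. (A $ i $ j)\<^sup>2)"
    by (rule sum.swap)
  ultimately have "(norm (transpose A))\<^sup>2 = (norm A)\<^sup>2"
    by (simp only:)
  then show ?thesis by simp
qed

lemma bounded_linear_transpose: "bounded_linear (transpose :: real ^ 'n ^ 'm \<Rightarrow> real ^ 'm ^ 'n)"
  by (rule bounded_linear_intro[where K = 1]) (auto simp: transpose_def vec_eq_iff norm_transpose[unfolded transpose_def])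

lemma bounded_linear_sym_part: "bounded_linear sym_part"
  unfolding sym_part_def[abs_def]
  by (intro bounded_linear_const_scaleR bounded_linear_add bounded_linear_ident bounded_linear_transpose)

lemma norm_sym_part_le: "norm (sym_part A) \<le> norm A"
proof -
  have "norm (sym_part A) = norm (A + transpose A) / 2"
    by (simp add: sym_part_def)
  also have "\<dots> \<le> (norm A + norm (transpose A)) / 2"
    by (intro divide_right_mono norm_triangle_ineq) simp
  finally show ?thesis by (simp add: norm_transpose)
qed

lemma trace_eq_inner: "trace A = A \<bullet> mat 1" for A :: "real ^ 'n ^ 'n"
  by (simp add: trace_def inner_vec_def mat_def if_distrib cong: if_cong)

lemma bounded_linear_trace: "bounded_linear (trace :: real ^ 'n ^ 'n \<Rightarrow> real)"
  unfolding trace_eq_inner[abs_def] by (rule bounded_linear_inner_left)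

text \<open>Cauchy-Schwarz against the identity matrix, whose squared Frobenius norm is the
  dimension. This is the source of sqrt d in \<open>const_C6\<close>.\<close>

lemma trace_power2_le: "(trace A)\<^sup>2 \<le> real CARD('n) * (norm A)\<^sup>2" for A :: "real ^ 'n ^ 'n"
proof -
  have "(trace A)\<^sup>2 \<le> (A \<bullet> A) * (mat 1 \<bullet> (mat 1 :: real ^ 'n ^ 'n))"
    unfolding trace_eq_inner by (rule Cauchy_Schwarz_ineq)
  also have "mat 1 \<bullet> (mat 1 :: real ^ 'n ^ 'n) = real CARD('n)"
    by (simp add: inner_vec_def mat_def if_distrib cong: if_cong)
  finally show ?thesis
    by (simp add: power2_norm_eq_inner mult.commute)
qed

section \<open>Measurability on the product of the domain and the parameter space\<close>

context bounded_domain
begin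

abbreviation DG :: "((real ^ 'd) \<times> (nat \<Rightarrow> real)) measure" where
  "DG \<equiv> vol D \<Otimes>\<^sub>M param_measure"

sublocale param_prob: prob_space param_measure
  by (rule prob_space_param)

sublocale DG: pair_sigma_finite "vol D" param_measure
  by unfold_locales

text \<open>\<open>weak_gradient\<close> is chosen slice by slice, so \<open>\<lambda>(x, y). grad D (u y) x\<close> need not be jointly
  measurable. Integrands built from it are therefore compared with a jointly measurable function
  on each slice.\<close>

definition slicewise :: "((nat \<Rightarrow> real) \<Rightarrow> real ^ 'd \<Rightarrow> real) \<Rightarrow> ((real ^ 'd) \<times> (nat \<Rightarrow> real) \<Rightarrow> real) \<Rightarrow> bool" where
  "slicewise H F \<longleftrightarrow> integrable DG F \<and>
     (\<forall>y\<in>space param_measure. H y \<in> borel_measurable (vol D) \<and> (AE x in vol D. H y x = F (x, y)))"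

lemma slice_integral_eq:
  assumes "slicewise H F" "y \<in> space param_measure"
  shows "(\<integral>x. H y x \<partial>vol D) = (\<integral>x. F (x, y) \<partial>vol D)"
proof (rule integral_cong_AE)
  have "F \<in> borel_measurable DG"
    using assms by (auto simp: slicewise_def)
  then show "(\<lambda>x. F (x, y)) \<in> borel_measurable (vol D)"
    using assms(2) by simp
qed (use assms in \<open>auto simp: slicewise_def\<close>)

lemma double_integral_slicewise:
  assumes "slicewise H F"
  shows "double_integral D H = (\<integral>z. F z \<partial>DG)"
proof -
  have F: "integrable DG (case_prod (\<lambda>x y. F (x, y)))"
    using assms by (simp add: slicewise_def)
  have "double_integral D H = (\<integral>y. (\<integral>x. F (x, y) \<partial>vol D) \<partial>param_measure)"
    by (rule Bochner_Integration.integral_cong) (auto simp: slice_integral_eq[OF assms])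
  also have "\<dots> = (\<integral>z. F z \<partial>DG)"
    using DG.integral_snd[OF F] by simp
  finally show ?thesis .
qed

lemma integrable_slice:
  assumes "slicewise H F"
  shows "integrable param_measure (\<lambda>y. \<integral>x. H y x \<partial>vol D)"
proof -
  have F: "integrable DG (case_prod (\<lambda>x y. F (x, y)))"
    using assms by (simp add: slicewise_def)
  show ?thesis
    using DG.integrable_snd[OF F]
    by (rule Bochner_Integration.integrable_cong[THEN iffD1, rotated -1]) (auto simp: slice_integral_eq[OF assms])
qed

text \<open>The route by which Korn's inequality, the CBS inequalities and the inf-sup condition,
  each available at a fixed parameter value, reach random fields.\<close>

lemma double_integral_mono:
  assumes "slicewise H F" "slicewise K G"
    and "\<And>y. y \<in> space param_measure \<Longrightarrow> c * (\<integral>x. H y x \<partial>vol D) \<le> (\<integral>x. K y x \<partial>vol D)"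
  shows "c * double_integral D H \<le> double_integral D K"
  unfolding integral_mult_right_zero[symmetric]
  by (rule integral_mono) (use assms integrable_slice in \<open>auto intro!: integrable_mult_right\<close>)

text \<open>Joint measurability turns null slices into a null set of the product. The slices are
  taken at fixed parameter while the product measure has the spatial factor first, hence the
  exchange of the two quantifiers.\<close>

lemma AE_DG_I:
  fixes F G :: "_ \<Rightarrow> 'b::euclidean_space"
  assumes [measurable]: "F \<in> borel_measurable DG" "G \<in> borel_measurable DG"
    and eq: "\<And>y. y \<in> space param_measure \<Longrightarrow> AE x in vol D. F (x, y) = G (x, y)"
  shows "AE z in DG. F z = G z"
proof -
  have m: "{z \<in> space DG. F z = G z} \<in> sets DG" by measurable
  then have m': "{z \<in> space DG. F (fst z, snd z) = G (fst z, snd z)} \<in> sets DG" by simp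
  have "AE y in param_measure. AE x in vol D. F (x, y) = G (x, y)"
    by (rule AE_I2) (rule eq)
  then have "AE x in vol D. AE y in param_measure. F (x, y) = G (x, y)"
    using DG.AE_commute[of "\<lambda>x y. F (x, y) = G (x, y)"] m' by simp
  then show ?thesis
    by (rule DG.AE_pair_measure[OF m])
qed

definition random_L2 :: "((nat \<Rightarrow> real) \<Rightarrow> real ^ 'd \<Rightarrow> 'b::euclidean_space) set" where
  "random_L2 = {u. (\<lambda>z. u (snd z) (fst z)) \<in> L2 DG}"

text \<open>A jointly measurable stand-in for the slicewise gradients. For a tensor field, the sum
  of the parameter factors times the gradients of the spatial factors is one.\<close>

definition joint_gradient :: "'d vfield \<Rightarrow> ((real ^ 'd) \<times> (nat \<Rightarrow> real) \<Rightarrow> real ^ 'd ^ 'd) \<Rightarrow> bool" where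
  "joint_gradient u G \<longleftrightarrow> G \<in> L2 DG \<and> (\<forall>y. AE x in vol D. G (x, y) = grad D (u y) x)"

text \<open>Existence of a joint gradient is made part of membership, as weak differentiability of
  the slices does not supply a square integrable one.\<close>

definition random_H1 :: "'d vfield set" where
  "random_H1 = {u. u \<in> random_L2 \<and> (\<forall>y. u y \<in> H1_vec) \<and> (\<exists>G. joint_gradient u G)}"

definition rgrad :: "'d vfield \<Rightarrow> (real ^ 'd) \<times> (nat \<Rightarrow> real) \<Rightarrow> real ^ 'd ^ 'd" where
  "rgrad u = (SOME G. joint_gradient u G)"

lemma joint_gradient_rgrad: "u \<in> random_H1 \<Longrightarrow> joint_gradient u (rgrad u)"
  unfolding random_H1_def rgrad_def by (auto simp: some_eq_ex)

lemma rgrad_L2: "u \<in> random_H1 \<Longrightarrow> rgrad u \<in> L2 DG"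
  and rgrad_slice: "u \<in> random_H1 \<Longrightarrow> AE x in vol D. rgrad u (x, y) = grad D (u y) x"
  using joint_gradient_rgrad by (auto simp: joint_gradient_def)

lemma random_H1I: "u \<in> random_L2 \<Longrightarrow> (\<And>y. u y \<in> H1_vec) \<Longrightarrow> joint_gradient u G \<Longrightarrow> u \<in> random_H1"
  unfolding random_H1_def by blast

lemma random_H1_slice: "u \<in> random_H1 \<Longrightarrow> u y \<in> H1_vec"
  by (auto simp: random_H1_def)

lemma subspace_random_L2: "subspace (random_L2 :: ((nat \<Rightarrow> real) \<Rightarrow> real ^ 'd \<Rightarrow> 'b::euclidean_space) set)"
  unfolding subspace_def random_L2_def
  using L2_zero L2_add L2_scaleR by auto

lemma joint_gradient_add:
  assumes "joint_gradient u G" "joint_gradient v H" "\<And>y. u y \<in> H1_vec" "\<And>y. v y \<in> H1_vec"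
  shows "joint_gradient (u + v) (\<lambda>z. G z + H z)"
  unfolding joint_gradient_def
proof (intro conjI allI)
  show "(\<lambda>z. G z + H z) \<in> L2 DG"
    using assms by (auto simp: joint_gradient_def intro: L2_add)
  fix y
  have "AE x in vol D. G (x, y) = grad D (u y) x" "AE x in vol D. H (x, y) = grad D (v y) x"
    using assms by (auto simp: joint_gradient_def)
  with grad_add[OF assms(3)[of y] assms(4)[of y]] show "AE x in vol D. G (x, y) + H (x, y) = grad D ((u + v) y) x"
    unfolding plus_fun_apply[of u v y] by eventually_elim (simp only:)
qed

lemma joint_gradient_scaleR:
  assumes "joint_gradient u G" "\<And>y. u y \<in> H1_vec"
  shows "joint_gradient (c *\<^sub>R u) (\<lambda>z. c *\<^sub>R G z)"
  unfolding joint_gradient_def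
proof (intro conjI allI)
  show "(\<lambda>z. c *\<^sub>R G z) \<in> L2 DG"
    using assms by (auto simp: joint_gradient_def intro: L2_scaleR)
  fix y
  have "AE x in vol D. G (x, y) = grad D (u y) x"
    using assms by (auto simp: joint_gradient_def)
  with grad_scaleR[OF assms(2)[of y], of c] show "AE x in vol D. c *\<^sub>R G (x, y) = grad D ((c *\<^sub>R u) y) x"
    unfolding scaleR_fun_apply[of c u y] by eventually_elim (simp only:)
qed

lemma joint_gradient_unique:
  assumes "joint_gradient u G" "joint_gradient u H"
  shows "AE z in DG. G z = H z"
proof (rule AE_DG_I)
  fix y
  have "AE x in vol D. G (x, y) = grad D (u y) x" "AE x in vol D. H (x, y) = grad D (u y) x"
    using assms by (auto simp: joint_gradient_def)
  then show "AE x in vol D. G (x, y) = H (x, y)"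
    by eventually_elim simp
qed (use assms in \<open>auto simp: joint_gradient_def L2_def\<close>)

lemma subspace_random_H1: "subspace random_H1"
  unfolding subspace_def
proof (intro conjI ballI allI)
  show "0 \<in> random_H1"
  proof -
    have "joint_gradient 0 (\<lambda>z. 0)"
      unfolding joint_gradient_def
    proof (intro conjI allI)
      fix y
      have "(0 :: 'd vfield) y = 0" by simp
      then show "AE x in vol D. 0 = grad D ((0 :: 'd vfield) y) x"
        using grad_zero by (simp only: eq_commute)
    qed (rule L2_zero)
    then show ?thesis
    proof (rule random_H1I[rotated 2])
      show "(0 :: 'd vfield) y \<in> H1_vec" for y
        using subspace_0[OF subspace_H1_vec] by simp
    qed (rule subspace_0[OF subspace_random_L2])
  qed
  show "u + v \<in> random_H1" if uv: "u \<in> random_H1" "v \<in> random_H1" for u v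
  proof (rule random_H1I)
    show "u + v \<in> random_L2"
      using uv by (intro subspace_add subspace_random_L2) (auto simp: random_H1_def)
    show "(u + v) y \<in> H1_vec" for y
      unfolding plus_fun_apply[of u v] using uv by (intro subspace_add subspace_H1_vec random_H1_slice)
    show "joint_gradient (u + v) (\<lambda>z. rgrad u z + rgrad v z)"
      using uv by (intro joint_gradient_add joint_gradient_rgrad random_H1_slice)
  qed
  show "c *\<^sub>R u \<in> random_H1" if u: "u \<in> random_H1" for c u
  proof (rule random_H1I)
    show "c *\<^sub>R u \<in> random_L2"
      using u by (intro subspace_scale subspace_random_L2) (auto simp: random_H1_def)
    show "(c *\<^sub>R u) y \<in> H1_vec" for y
      unfolding scaleR_fun_apply[of c u] using u by (intro subspace_scale subspace_H1_vec random_H1_slice)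
    show "joint_gradient (c *\<^sub>R u) (\<lambda>z. c *\<^sub>R rgrad u z)"
      using u by (intro joint_gradient_scaleR joint_gradient_rgrad random_H1_slice)
  qed
qed

text \<open>Sums and multiples of chosen joint gradients are joint gradients again, and
  \<open>joint_gradient_unique\<close> compares them with the one chosen for the sum or
  multiple.\<close>

lemma AE_linear_on_rgrad: "AE_linear_on DG random_H1 rgrad"
  unfolding AE_linear_on_def
proof (intro conjI ballI allI)
  show "rgrad u \<in> L2 DG" if "u \<in> random_H1" for u using that by (rule rgrad_L2)
  show "AE z in DG. rgrad (u + v) z = rgrad u z + rgrad v z" if "u \<in> random_H1" "v \<in> random_H1" for u v
    using that
    by (intro joint_gradient_unique[of "u + v"] joint_gradient_add joint_gradient_rgrad random_H1_slice
        subspace_add subspace_random_H1)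
  show "AE z in DG. rgrad (c *\<^sub>R u) z = c *\<^sub>R rgrad u z" if "u \<in> random_H1" for c u
    using that
    by (intro joint_gradient_unique[of "c *\<^sub>R u"] joint_gradient_scaleR joint_gradient_rgrad random_H1_slice
        subspace_scale subspace_random_H1)
qed

lemma AE_linear_on_joint: "AE_linear_on DG random_L2 (\<lambda>u z. u (snd z) (fst z))"
  by (simp add: AE_linear_on_def random_L2_def)

lemma AE_linear_on_joint_H1: "AE_linear_on DG random_H1 (\<lambda>u z. u (snd z) (fst z))"
  using AE_linear_on_joint unfolding AE_linear_on_def random_H1_def by blast

lemma random_L2_elementary:
  fixes v :: "real ^ 'd \<Rightarrow> 'b::euclidean_space"
  assumes "s \<in> bounded_rv" "v \<in> L2 (vol D)"
  shows "(\<lambda>z. s (snd z) *\<^sub>R v (fst z)) \<in> L2 DG"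
proof -
  have [measurable]: "s \<in> borel_measurable param_measure" "v \<in> borel_measurable (vol D)"
    using assms by (auto simp: bounded_rv_def L2_def)
  obtain K where K: "\<And>y. y \<in> space param_measure \<Longrightarrow> \<bar>s y\<bar> \<le> K"
    using assms by (auto simp: bounded_rv_def)
  \<comment> \<open>The first marginal of the product is \<open>vol D\<close> because the parameter
    measure has mass 1.\<close>
  have "integrable DG (\<lambda>z. (norm (v (fst z)))\<^sup>2)"
  proof -
    have "integrable (distr DG (vol D) fst) (\<lambda>x. (norm (v x))\<^sup>2)"
      unfolding param_prob.distr_pair_fst by (rule L2_integrable_norm[OF assms(2)])
    then show ?thesis
      by (subst (asm) integrable_distr_eq) (auto simp: case_prod_beta)
  qed
  then have "(\<lambda>z. v (fst z)) \<in> L2 DG"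
    by (simp add: L2_def case_prod_beta)
  then show ?thesis
    by (rule L2_mult_bounded[of _ _ _ K]) (auto simp: space_pair_measure K intro!: AE_I2)
qed

lemma tensor_random_L2:
  assumes "X \<subseteq> L2 (vol D)" "S \<subseteq> bounded_rv"
  shows "tensor X S \<subseteq> random_L2"
  using assms random_L2_elementary
  by (intro tensor_subsetI subspace_random_L2) (auto simp: random_L2_def)

lemma tensor_random_H1:
  assumes "X \<subseteq> H1_vec" "S \<subseteq> bounded_rv"
  shows "tensor X S \<subseteq> random_H1"
proof (rule tensor_subsetI[OF subspace_random_H1])
  fix s v assume sv: "s \<in> S" "v \<in> X"
  then have s: "s \<in> bounded_rv" and v: "v \<in> H1_vec" using assms by auto
  have "joint_gradient (\<lambda>y. s y *\<^sub>R v) (\<lambda>z. s (snd z) *\<^sub>R grad D v (fst z))"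
    unfolding joint_gradient_def
  proof (intro conjI allI)
    show "(\<lambda>z. s (snd z) *\<^sub>R grad D v (fst z)) \<in> L2 DG"
      by (rule random_L2_elementary[OF s grad_L2[OF v]])
    show "AE x in vol D. s (snd (x, y)) *\<^sub>R grad D v (fst (x, y)) = grad D (s y *\<^sub>R v) x" for y
      using grad_scaleR[OF v, of "s y"] by eventually_elim simp
  qed
  then show "(\<lambda>y. s y *\<^sub>R v) \<in> random_H1"
    using random_L2_elementary[OF s H1_vec_L2[OF v]] subspace_scale[OF subspace_H1_vec v]
    by (auto simp: random_H1_def random_L2_def)
qed

end

subsection \<open>The forms on random fields\<close>

lemma AE_linear_on_id: "AE_linear_on M (L2 M) (\<lambda>F. F)"
  by (simp add: AE_linear_on_def)

lemma L2_Cauchy_Schwarz: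
  fixes F G :: "'a \<Rightarrow> real"
  assumes "F \<in> L2 M" "G \<in> L2 M"
  shows "\<bar>\<integral>z. F z * G z \<partial>M\<bar> \<le> sqrt (\<integral>z. (F z)\<^sup>2 \<partial>M) * sqrt (\<integral>z. (G z)\<^sup>2 \<partial>M)"
proof -
  interpret psd_form "L2 M" "\<lambda>F G :: 'a \<Rightarrow> real. \<integral>z. 1 * (F z \<bullet> G z) \<partial>M"
    by (rule psd_form_weighted_integral[OF bounded_weight_1 _ AE_linear_on_id subspace_L2]) simp
  show ?thesis
    using Cauchy_Schwarz_sqrt[OF assms] by (simp add: power2_eq_square)
qed

text \<open>Allows the bound for the parametric enrichment to use the smaller of the two inf-sup
  constants.\<close>

lemma inf_sup_stable_mono: "inf_sup_stable D V W g \<Longrightarrow> 0 < g' \<Longrightarrow> g' \<le> g \<Longrightarrow> inf_sup_stable D V W g'"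
  unfolding inf_sup_stable_def
proof (elim conjE, intro conjI ballI)
  fix q
  assume "0 < g'" "g' \<le> g" "q \<in> W" and *: "\<forall>q\<in>W. ereal (g * L2_norm (vol D) q) \<le>
        (SUP v \<in> {v \<in> V. \<not> (AE x in vol D. v x = 0)}.
           ereal ((\<integral>x. q x * dvg D v x \<partial>vol D) / L2_norm (vol D) (grad D v)))"
  have "ereal (g' * L2_norm (vol D) q) \<le> ereal (g * L2_norm (vol D) q)"
    using \<open>g' \<le> g\<close> by (simp add: mult_right_mono L2_norm_nonneg)
  also note bspec[OF * \<open>q \<in> W\<close>]
  finally show "ereal (g' * L2_norm (vol D) q) \<le>
        (SUP v \<in> {v \<in> V. \<not> (AE x in vol D. v x = 0)}.
           ereal ((\<integral>x. q x * dvg D v x \<partial>vol D) / L2_norm (vol D) (grad D v)))" .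
qed

text \<open>In each argument the zeros of a bilinear form are a subspace, so elementary tensors
  decide.\<close>

lemma tensor_form_eq_0:
  assumes B: "bilinear_on U W B" "subspace U" "subspace W"
    and sub: "tensor X S \<subseteq> U" "tensor Z T \<subseteq> W"
    and 0: "\<And>s t v w. s \<in> S \<Longrightarrow> t \<in> T \<Longrightarrow> v \<in> X \<Longrightarrow> w \<in> Z \<Longrightarrow> B (\<lambda>y. s y *\<^sub>R v) (\<lambda>y. t y *\<^sub>R w) = 0"
    and u: "u \<in> tensor X S" and w: "w \<in> tensor Z T"
  shows "B u w = 0"
proof -
  have sub1: "subspace {w \<in> W. B u w = 0}" if "u \<in> U" for u
    using that B(3) bilinear_on_zero_right[OF B(1,3) that]
    by (auto simp: subspace_def bilinear_on_add_right[OF B(1)] bilinear_on_scale_right[OF B(1)])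
  have sub2: "subspace {u \<in> U. B u w = 0}" if "w \<in> W" for w
    using that B(2) bilinear_on_zero_left[OF B(1,2) that]
    by (auto simp: subspace_def bilinear_on_add_left[OF B(1)] bilinear_on_scale_left[OF B(1)])
  have elem: "(\<lambda>y. s y *\<^sub>R v) \<in> U" if "s \<in> S" "v \<in> X" for s v
    using tensor_elementary[OF that] sub(1) by (rule rev_subsetD)
  have elem': "(\<lambda>y. t y *\<^sub>R v) \<in> W" if "t \<in> T" "v \<in> Z" for t v
    using tensor_elementary[OF that] sub(2) by (rule rev_subsetD)
  have wW: "w \<in> W" using w sub by auto
  have "B (\<lambda>y. s y *\<^sub>R v) w = 0" if sv: "s \<in> S" "v \<in> X" for s v
  proof -
    have "tensor Z T \<subseteq> {w \<in> W. B (\<lambda>y. s y *\<^sub>R v) w = 0}"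
      by (rule tensor_subsetI[OF sub1[OF elem[OF sv]]]) (simp add: elem' 0 sv)
    with w show ?thesis by auto
  qed
  then have "tensor X S \<subseteq> {u \<in> U. B u w = 0}"
    by (intro tensor_subsetI[OF sub2[OF wW]]) (simp add: elem)
  with u show ?thesis by auto
qed

context bounded_domain
begin

text \<open>For the square integrable factors of an integrand, whereas \<open>slicewise\<close>
  describes their integrable product.\<close>

definition slice_rep :: "((nat \<Rightarrow> real) \<Rightarrow> real ^ 'd \<Rightarrow> 'b::euclidean_space) \<Rightarrow> ((real ^ 'd) \<times> (nat \<Rightarrow> real) \<Rightarrow> 'b) \<Rightarrow> bool" where
  "slice_rep H F \<longleftrightarrow> F \<in> L2 DG \<and>
     (\<forall>y\<in>space param_measure. H y \<in> borel_measurable (vol D) \<and> (AE x in vol D. H y x = F (x, y)))"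

lemma slice_rep_grad: "u \<in> random_H1 \<Longrightarrow> slice_rep (\<lambda>y. grad D (u y)) (rgrad u)"
  unfolding slice_rep_def
proof (intro conjI ballI)
  assume u: "u \<in> random_H1"
  show "rgrad u \<in> L2 DG" by (rule rgrad_L2[OF u])
  fix y
  show "grad D (u y) \<in> borel_measurable (vol D)"
    by (rule L2_measurable[OF grad_L2[OF random_H1_slice[OF u]]])
  show "AE x in vol D. grad D (u y) x = rgrad u (x, y)"
    using rgrad_slice[OF u, of y] by eventually_elim simp
qed

lemma slice_rep_compose:
  fixes T :: "'b::euclidean_space \<Rightarrow> 'c::euclidean_space"
  assumes "slice_rep H F" "bounded_linear T"
  shows "slice_rep (\<lambda>y x. T (H y x)) (\<lambda>z. T (F z))"
proof -
  have T: "T \<in> borel_measurable borel"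
    using assms(2) by (intro borel_measurable_continuous_onI linear_continuous_on)
  show ?thesis
    using assms L2_bounded_linear[OF _ assms(2), of F] measurable_compose[OF _ T]
    unfolding slice_rep_def by (auto elim!: eventually_mono)
qed

lemma slice_rep_strain: "u \<in> random_H1 \<Longrightarrow> slice_rep (\<lambda>y. strain D (u y)) (\<lambda>z. sym_part (rgrad u z))"
  unfolding strain_eq[abs_def] by (rule slice_rep_compose[OF slice_rep_grad bounded_linear_sym_part])

lemma slice_rep_dvg: "u \<in> random_H1 \<Longrightarrow> slice_rep (\<lambda>y. dvg D (u y)) (\<lambda>z. trace (rgrad u z))"
  unfolding dvg_def[abs_def] by (rule slice_rep_compose[OF slice_rep_grad bounded_linear_trace])

lemma slice_rep_random_L2:
  assumes "q \<in> random_L2"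
  shows "slice_rep q (\<lambda>z. q (snd z) (fst z))"
proof -
  have q: "(\<lambda>z. q (snd z) (fst z)) \<in> L2 DG"
    using assms by (simp add: random_L2_def)
  have "q y \<in> borel_measurable (vol D)" if "y \<in> space param_measure" for y
  proof -
    have "(\<lambda>x. (x, y)) \<in> measurable (vol D) DG"
      using that by simp
    from measurable_compose[OF this L2_measurable[OF q]] show ?thesis by simp
  qed
  with q show ?thesis by (simp add: slice_rep_def)
qed

lemma slicewise_weighted_inner:
  assumes h: "bounded_weight DG h" and H: "slice_rep H F" and K: "slice_rep K G"
  shows "slicewise (\<lambda>y x. h (x, y) * (H y x \<bullet> K y x)) (\<lambda>z. h z * (F z \<bullet> G z))"
  unfolding slicewise_def
proof (intro conjI ballI)
  show "integrable DG (\<lambda>z. h z * (F z \<bullet> G z))"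
    using h H K by (intro weighted_inner_integrable) (auto simp: slice_rep_def)
  fix y assume y: "y \<in> space param_measure"
  have "(\<lambda>x. (x, y)) \<in> measurable (vol D) DG"
    using y by simp
  from measurable_compose[OF this] h have [measurable]: "(\<lambda>x. h (x, y)) \<in> borel_measurable (vol D)"
    by (auto simp: bounded_weight_def)
  have [measurable]: "H y \<in> borel_measurable (vol D)" "K y \<in> borel_measurable (vol D)"
    using H K y by (auto simp: slice_rep_def)
  show "(\<lambda>x. h (x, y) * (H y x \<bullet> K y x)) \<in> borel_measurable (vol D)"
    by measurable
  have "AE x in vol D. H y x = F (x, y)" "AE x in vol D. K y x = G (x, y)"
    using H K y by (auto simp: slice_rep_def)
  then show "AE x in vol D. h (x, y) * (H y x \<bullet> K y x) = h (x, y) * (F (x, y) \<bullet> G (x, y))"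
    by eventually_elim simp
qed

lemma slicewise_inner:
  assumes "slice_rep H F" "slice_rep K G"
  shows "slicewise (\<lambda>y x. H y x \<bullet> K y x) (\<lambda>z. F z \<bullet> G z)"
  using slicewise_weighted_inner[OF bounded_weight_1 assms] by simp

definition grad_prod :: "'d vfield \<Rightarrow> 'd vfield \<Rightarrow> real" where
  "grad_prod u v = double_integral D (\<lambda>y x. grad D (u y) x \<bullet> grad D (v y) x)"

definition L2_prod :: "'d sfield \<Rightarrow> 'd sfield \<Rightarrow> real" where
  "L2_prod p q = double_integral D (\<lambda>y x. p y x * q y x)"

lemma grad_prod_eq: "u \<in> random_H1 \<Longrightarrow> v \<in> random_H1 \<Longrightarrow> grad_prod u v = (\<integral>z. 1 * (rgrad u z \<bullet> rgrad v z) \<partial>DG)"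
  unfolding grad_prod_def
  using double_integral_slicewise[OF slicewise_inner[OF slice_rep_grad slice_rep_grad]] by simp

lemma slicewise_mult:
  "p \<in> random_L2 \<Longrightarrow> q \<in> random_L2 \<Longrightarrow> slicewise (\<lambda>y x. p y x * q y x) (\<lambda>z. p (snd z) (fst z) * q (snd z) (fst z))"
  for p q :: "'d sfield"
  using slicewise_inner[OF slice_rep_random_L2 slice_rep_random_L2, of p q] by simp

lemma L2_prod_eq: "p \<in> random_L2 \<Longrightarrow> q \<in> random_L2 \<Longrightarrow> L2_prod p q = (\<integral>z. 1 * (p (snd z) (fst z) \<bullet> q (snd z) (fst z)) \<partial>DG)"
  unfolding L2_prod_def using double_integral_slicewise[OF slicewise_mult] by simp

lemma psd_form_grad_prod: "psd_form random_H1 grad_prod"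
  by (rule psd_form_cong[OF psd_form_weighted_integral[OF bounded_weight_1 _ AE_linear_on_rgrad subspace_random_H1]])
    (auto simp: grad_prod_eq)

lemma psd_form_L2_prod: "psd_form random_L2 L2_prod"
  by (rule psd_form_cong[OF psd_form_weighted_integral[OF bounded_weight_1 _ AE_linear_on_joint subspace_random_L2]])
    (auto simp: L2_prod_eq)

lemma form_b_eq:
  assumes "v \<in> random_H1" "q \<in> random_L2"
  shows "form_b D v q = (\<integral>z. - 1 * (trace (rgrad v z) \<bullet> q (snd z) (fst z)) \<partial>DG)"
  unfolding form_b_def
  using double_integral_slicewise[OF slicewise_inner[OF slice_rep_random_L2[OF assms(2)] slice_rep_dvg[OF assms(1)]]]
  by (simp add: mult.commute)

lemma bilinear_on_form_b: "bilinear_on random_H1 random_L2 (form_b D)"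
proof (rule bilinear_on_cong)
  show "bilinear_on random_H1 random_L2 (\<lambda>v q. \<integral>z. - 1 * (trace (rgrad v z) \<bullet> q (snd z) (fst z)) \<partial>DG)"
    by (intro bilinear_on_weighted_integral AE_linear_on_joint subspace_random_H1 subspace_random_L2
        AE_linear_on_compose[OF AE_linear_on_rgrad bounded_linear_trace]) (auto simp: bounded_weight_def)
qed (rule form_b_eq subspace_random_H1 subspace_random_L2; assumption?)+

lemma form_b_bound:
  assumes "v \<in> random_H1" "q \<in> random_L2"
  shows "\<bar>form_b D v q\<bar> \<le> sqrt (real CARD('d)) * sqrt (grad_prod v v) * sqrt (L2_prod q q)"
proof -
  let ?q = "\<lambda>z. q (snd z) (fst z)"
  have q: "?q \<in> L2 DG" using assms(2) by (simp add: random_L2_def)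
  note g = rgrad_L2[OF assms(1)]
  have t: "(\<lambda>z. trace (rgrad v z)) \<in> L2 DG"
    by (rule L2_bounded_linear[OF g bounded_linear_trace])
  have "\<bar>form_b D v q\<bar> = \<bar>\<integral>z. trace (rgrad v z) * ?q z \<partial>DG\<bar>"
    using form_b_eq[OF assms] by simp
  also have "\<dots> \<le> sqrt (\<integral>z. (trace (rgrad v z))\<^sup>2 \<partial>DG) * sqrt (\<integral>z. (?q z)\<^sup>2 \<partial>DG)"
    by (rule L2_Cauchy_Schwarz[OF t q])
  also have "(\<integral>z. (?q z)\<^sup>2 \<partial>DG) = L2_prod q q"
    using L2_prod_eq[OF assms(2,2)] by (simp add: power2_eq_square)
  also have "sqrt (\<integral>z. (trace (rgrad v z))\<^sup>2 \<partial>DG) \<le> sqrt (real CARD('d) * grad_prod v v)"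
  proof (rule real_sqrt_le_mono)
    have "(\<integral>z. (trace (rgrad v z))\<^sup>2 \<partial>DG) \<le> (\<integral>z. real CARD('d) * (norm (rgrad v z))\<^sup>2 \<partial>DG)"
      using L2_integrable_norm[OF t] L2_integrable_norm[OF g]
      by (intro integral_mono integrable_mult_right trace_power2_le) auto
    also have "\<dots> = real CARD('d) * grad_prod v v"
      using grad_prod_eq[OF assms(1,1)] by (simp add: power2_norm_eq_inner)
    finally show "(\<integral>z. (trace (rgrad v z))\<^sup>2 \<partial>DG) \<le> real CARD('d) * grad_prod v v" .
  qed
  finally show ?thesis
    using psd_form.nonneg[OF psd_form_L2_prod assms(2)] by (simp add: real_sqrt_mult mult_right_mono)
qed

text \<open>The load is a pairing with the parameter-independent field \<open>\<lambda>y. f\<close>,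
  hence the second argument of a bilinear form.\<close>

lemma load_linear:
  assumes f: "f \<in> L2 (vol D)"
  shows "u \<in> random_H1 \<Longrightarrow> v \<in> random_H1 \<Longrightarrow> load D f (u + v) = load D f u + load D f v"
proof -
  have f': "(\<lambda>y. f) \<in> random_L2"
    using random_L2_elementary[OF bounded_rv_const[of 1] f] by (simp add: random_L2_def)
  have eq: "load D f u = (\<integral>z. 1 * (f (fst z) \<bullet> u (snd z) (fst z)) \<partial>DG)" if "u \<in> random_H1" for u
    unfolding load_def
    using double_integral_slicewise[OF slicewise_inner[OF slice_rep_random_L2[OF f'] slice_rep_random_L2]] that
    by (simp add: random_H1_def)
  have "bilinear_on random_L2 random_H1 (\<lambda>F u. \<integral>z. 1 * (F (snd z) (fst z) \<bullet> u (snd z) (fst z)) \<partial>DG)"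
    by (intro bilinear_on_weighted_integral bounded_weight_1 AE_linear_on_joint AE_linear_on_joint_H1
        subspace_random_H1 subspace_random_L2)
  from bilinear_on_add_right[OF this f', of u v]
  show "load D f (u + v) = load D f u + load D f v" if "u \<in> random_H1" "v \<in> random_H1"
    using that by (simp add: eq subspace_add[OF subspace_random_H1 that])
qed

lemma grad_prod_slice_mono:
  assumes "u \<in> random_H1" "v \<in> random_H1"
    and "\<And>y. c * (\<integral>x. grad D (u y) x \<bullet> grad D (u y) x \<partial>vol D) \<le> (\<integral>x. grad D (v y) x \<bullet> grad D (v y) x \<partial>vol D)"
  shows "c * grad_prod u u \<le> grad_prod v v"
  unfolding grad_prod_def
  by (rule double_integral_mono[OF slicewise_inner[OF slice_rep_grad slice_rep_grad]
        slicewise_inner[OF slice_rep_grad slice_rep_grad]]) (use assms in auto)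

lemma L2_prod_slice_mono:
  assumes "p \<in> random_L2" "q \<in> random_L2"
    and "\<And>y. c * (\<integral>x. p y x * p y x \<partial>vol D) \<le> (\<integral>x. q y x * q y x \<partial>vol D)"
  shows "c * L2_prod p p \<le> L2_prod q q"
  unfolding L2_prod_def
  by (rule double_integral_mono[OF slicewise_mult slicewise_mult]) (use assms in auto)

section \<open>Forms at a fixed parameter value and the splitting of enriched fields\<close>

lemma AE_linear_on_grad: "AE_linear_on (vol D) H1_vec (grad D)"
  unfolding AE_linear_on_def using grad_L2 grad_add grad_scaleR by blast

lemma psd_form_grad: "psd_form H1_vec (\<lambda>v w. \<integral>x. grad D v x \<bullet> grad D w x \<partial>vol D)"
  using psd_form_weighted_integral[OF bounded_weight_1 _ AE_linear_on_grad subspace_H1_vec] by simp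

lemma psd_form_L2: "psd_form (L2 (vol D)) (\<lambda>p q. \<integral>x. p x * q x \<partial>vol D)"
proof -
  have "psd_form (L2 (vol D)) (\<lambda>p q :: real ^ 'd \<Rightarrow> real. \<integral>x. 1 * (p x \<bullet> q x) \<partial>vol D)"
    by (rule psd_form_weighted_integral[OF bounded_weight_1 _ AE_linear_on_id subspace_L2]) simp
  then show ?thesis by simp
qed

lemma bilinear_on_dvg: "bilinear_on (L2 (vol D)) H1_vec (\<lambda>q v. \<integral>x. q x * dvg D v x \<partial>vol D)"
  using bilinear_on_weighted_integral[OF bounded_weight_1 AE_linear_on_id
      AE_linear_on_compose[OF AE_linear_on_grad bounded_linear_trace] subspace_L2 subspace_H1_vec]
  by (simp add: dvg_def)

lemma L2_norm_grad: "(L2_norm (vol D) (grad D v))\<^sup>2 = (\<integral>x. grad D v x \<bullet> grad D v x \<partial>vol D)"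
  by (simp add: L2_norm_power2 power2_norm_eq_inner)

lemma L2_norm_real: "(L2_norm (vol D) q)\<^sup>2 = (\<integral>x. q x * q x \<partial>vol D)" for q :: "real ^ 'd \<Rightarrow> real"
  unfolding L2_norm_power2 by (simp add: power2_eq_square)

text \<open>Completing the square: the right side exceeds the left by at least
  \<open>(a - c * b)\<^sup>2\<close>. This is where the factor \<open>1 - \<gamma>\<^sup>2\<close>
  originates.\<close>

lemma cbs_abstract:
  fixes a b c m :: real
  assumes "\<bar>m\<bar> \<le> c * a * b"
  shows "(1 - c\<^sup>2) * b\<^sup>2 \<le> a\<^sup>2 + 2 * m + b\<^sup>2"
proof -
  have "0 \<le> (a - c * b)\<^sup>2" by simp
  with assms show ?thesis by (simp add: power2_eq_square algebra_simps abs_le_iff)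
qed

text \<open>At each \<open>y\<close> the slices lie in the two spatial spaces, so the deterministic
  constant carries over unchanged.\<close>

lemma cbs_grad_prod:
  assumes cbs: "cbs_vector D V V' c" and V: "subspace V" "subspace V'" "V \<subseteq> H1_vec" "V' \<subseteq> H1_vec"
    and S: "S \<subseteq> bounded_rv" and v: "v \<in> tensor V S" and w: "w \<in> tensor V' S"
  shows "(1 - c\<^sup>2) * grad_prod w w \<le> grad_prod (v + w) (v + w)"
proof (rule grad_prod_slice_mono)
  show w': "w \<in> random_H1" and vw: "v + w \<in> random_H1"
    using tensor_random_H1[OF V(3) S] tensor_random_H1[OF V(4) S] v w
    by (auto intro: subspace_add[OF subspace_random_H1])
  fix y
  interpret psd_form H1_vec "\<lambda>v w. \<integral>x. grad D v x \<bullet> grad D w x \<partial>vol D"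
    by (rule psd_form_grad)
  have mem: "v y \<in> V" "w y \<in> V'"
    using tensor_apply V v w by auto
  then have "\<bar>\<integral>x. grad D (v y) x \<bullet> grad D (w y) x \<partial>vol D\<bar>
      \<le> c * L2_norm (vol D) (grad D (v y)) * L2_norm (vol D) (grad D (w y))"
    using cbs by (auto simp: cbs_vector_def)
  from cbs_abstract[OF this] expand[of "v y" "w y" 1] mem V
  show "(1 - c\<^sup>2) * (\<integral>x. grad D (w y) x \<bullet> grad D (w y) x \<partial>vol D)
      \<le> (\<integral>x. grad D ((v + w) y) x \<bullet> grad D ((v + w) y) x \<partial>vol D)"
    unfolding plus_fun_apply[of v w] scaleR_one by (auto simp only: L2_norm_grad subset_iff power_one mult_1_right mult_1)
qed

lemma cbs_L2_prod:
  assumes cbs: "cbs_scalar D V V' c" and V: "subspace V" "subspace V'" "V \<subseteq> L2 (vol D)" "V' \<subseteq> L2 (vol D)"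
    and S: "S \<subseteq> bounded_rv" and v: "v \<in> tensor V S" and w: "w \<in> tensor V' S"
  shows "(1 - c\<^sup>2) * L2_prod w w \<le> L2_prod (v + w) (v + w)"
proof (rule L2_prod_slice_mono)
  show w': "w \<in> random_L2" and vw: "v + w \<in> random_L2"
    using tensor_random_L2[OF V(3) S] tensor_random_L2[OF V(4) S] v w
    by (auto intro: subspace_add[OF subspace_random_L2])
  fix y
  interpret psd_form "L2 (vol D)" "\<lambda>p q :: real ^ 'd \<Rightarrow> real. \<integral>x. p x * q x \<partial>vol D"
    by (rule psd_form_L2)
  have mem: "v y \<in> V" "w y \<in> V'"
    using tensor_apply V v w by auto
  then have "\<bar>\<integral>x. v y x * w y x \<partial>vol D\<bar> \<le> c * L2_norm (vol D) (v y) * L2_norm (vol D) (w y)"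
    using cbs by (auto simp: cbs_scalar_def)
  from cbs_abstract[OF this] expand[of "v y" "w y" 1] mem V
  show "(1 - c\<^sup>2) * (\<integral>x. w y x * w y x \<partial>vol D) \<le> (\<integral>x. (v + w) y x * (v + w) y x \<partial>vol D)"
    unfolding plus_fun_apply[of v w] scaleR_one by (auto simp only: L2_norm_real subset_iff power_one mult_1_right mult_1)
qed

lemma double_integral_elementary:
  assumes st: "(\<integral>y. s y * t y \<partial>param_measure) = 0"
    and eq: "\<And>y. (\<integral>x. H y x \<partial>vol D) = s y * t y * c"
  shows "double_integral D H = 0"
  unfolding eq using st by simp

text \<open>For elementary tensors the double integral is the mean of \<open>s y * t y\<close> times
  a spatial integral.\<close>

lemma grad_prod_orthogonal:
  assumes X: "X \<subseteq> H1_vec" "Z \<subseteq> H1_vec" and S: "S \<subseteq> bounded_rv" "T \<subseteq> bounded_rv"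
    and orth: "\<And>s t. s \<in> S \<Longrightarrow> t \<in> T \<Longrightarrow> (\<integral>y. s y * t y \<partial>param_measure) = 0"
    and u: "u \<in> tensor X S" "w \<in> tensor Z T"
  shows "grad_prod u w = 0"
proof (rule tensor_form_eq_0[OF psd_form.bil[OF psd_form_grad_prod] subspace_random_H1 subspace_random_H1
      tensor_random_H1[OF X(1) S(1)] tensor_random_H1[OF X(2) S(2)] _ u])
  fix s t v w assume *: "s \<in> S" "t \<in> T" "v \<in> X" "w \<in> Z"
  interpret psd_form H1_vec "\<lambda>v w. \<integral>x. grad D v x \<bullet> grad D w x \<partial>vol D"
    by (rule psd_form_grad)
  have v: "v \<in> H1_vec" "w \<in> H1_vec" using * X by auto
  show "grad_prod (\<lambda>y. s y *\<^sub>R v) (\<lambda>y. t y *\<^sub>R w) = 0"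
    unfolding grad_prod_def
    using v bilinear_on_scale_left[OF bil] bilinear_on_scale_right[OF bil] subspace_scale[OF sub]
    by (intro double_integral_elementary[OF orth[OF *(1,2)], where c = "\<integral>x. grad D v x \<bullet> grad D w x \<partial>vol D"]) simp
qed

lemma L2_prod_orthogonal:
  assumes X: "X \<subseteq> L2 (vol D)" "Z \<subseteq> L2 (vol D)" and S: "S \<subseteq> bounded_rv" "T \<subseteq> bounded_rv"
    and orth: "\<And>s t. s \<in> S \<Longrightarrow> t \<in> T \<Longrightarrow> (\<integral>y. s y * t y \<partial>param_measure) = 0"
    and u: "u \<in> tensor X S" "w \<in> tensor Z T"
  shows "L2_prod u w = 0"
proof (rule tensor_form_eq_0[OF psd_form.bil[OF psd_form_L2_prod] subspace_random_L2 subspace_random_L2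
      tensor_random_L2[OF X(1) S(1)] tensor_random_L2[OF X(2) S(2)] _ u])
  fix s t v w assume *: "s \<in> S" "t \<in> T" "v \<in> X" "w \<in> Z"
  show "L2_prod (\<lambda>y. s y *\<^sub>R v) (\<lambda>y. t y *\<^sub>R w) = 0"
    unfolding L2_prod_def
    by (intro double_integral_elementary[OF orth[OF *(1,2)], where c = "\<integral>x. v x * w x \<partial>vol D"])
      (simp add: mult_ac flip: integral_mult_right_zero)
qed

lemma form_b_orthogonal:
  assumes X: "X \<subseteq> H1_vec" "Z \<subseteq> L2 (vol D)" and S: "S \<subseteq> bounded_rv" "T \<subseteq> bounded_rv"
    and orth: "\<And>s t. s \<in> S \<Longrightarrow> t \<in> T \<Longrightarrow> (\<integral>y. s y * t y \<partial>param_measure) = 0"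
    and u: "u \<in> tensor X S" "w \<in> tensor Z T"
  shows "form_b D u w = 0"
proof (rule tensor_form_eq_0[OF bilinear_on_form_b subspace_random_H1 subspace_random_L2
      tensor_random_H1[OF X(1) S(1)] tensor_random_L2[OF X(2) S(2)] _ u])
  fix s t v w assume *: "s \<in> S" "t \<in> T" "v \<in> X" "w \<in> Z"
  have v: "v \<in> H1_vec" "w \<in> L2 (vol D)" using * X by auto
  have "double_integral D (\<lambda>y x. (t y *\<^sub>R w) x * dvg D (s y *\<^sub>R v) x) = 0"
    using v bilinear_on_scale_left[OF bilinear_on_dvg] bilinear_on_scale_right[OF bilinear_on_dvg]
      subspace_scale[OF subspace_H1_vec]
    by (intro double_integral_elementary[OF orth[OF *(1,2)], where c = "\<integral>x. w x * dvg D v x \<partial>vol D"]) simp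
  then show "form_b D (\<lambda>y. s y *\<^sub>R v) (\<lambda>y. t y *\<^sub>R w) = 0"
    by (simp add: form_b_def)
qed

end

subsection \<open>Traces, inf-sup stability and bounds on the forms\<close>

lemma bilinear_on_sum_left:
  fixes n :: nat
  assumes B: "bilinear_on U W B" "subspace U" and "\<And>i. i < n \<Longrightarrow> x i \<in> U" "y \<in> W"
  shows "B (\<Sum>i<n. c i *\<^sub>R x i) y = (\<Sum>i<n. c i * B (x i) y)"
  using assms(3)
proof (induction n)
  case 0
  show ?case using bilinear_on_zero_left[OF B assms(4)] by simp
next
  case (Suc n)
  have "(\<Sum>i<n. c i *\<^sub>R x i) \<in> U" "c n *\<^sub>R x n \<in> U" "x n \<in> U"
    using Suc.prems by (auto intro!: subspace_sum subspace_scale B(2))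
  then show ?case
    unfolding sum.lessThan_Suc
    using Suc assms(4) by (simp only: bilinear_on_add_left[OF B(1)] bilinear_on_scale_left[OF B(1)] less_SucI)
qed

text \<open>From (a + b)^2 <= 2 a^2 + 2 b^2. The sum is required only almost everywhere because weak
  gradients add only up to null sets.\<close>

lemma nn_integral_square_tendsto_add:
  fixes a b c :: "nat \<Rightarrow> 'a \<Rightarrow> real"
  assumes [measurable]: "\<And>n. a n \<in> borel_measurable M" "\<And>n. b n \<in> borel_measurable M"
    and a: "(\<lambda>n. \<integral>\<^sup>+x. ennreal ((a n x)\<^sup>2) \<partial>M) \<longlonglongrightarrow> 0" and b: "(\<lambda>n. \<integral>\<^sup>+x. ennreal ((b n x)\<^sup>2) \<partial>M) \<longlonglongrightarrow> 0"
    and c: "\<And>n. AE x in M. c n x = a n x + b n x"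
  shows "(\<lambda>n. \<integral>\<^sup>+x. ennreal ((c n x)\<^sup>2) \<partial>M) \<longlonglongrightarrow> 0"
proof (rule tendsto_sandwich[OF _ _ tendsto_const])
  have "(\<lambda>n. 2 * (\<integral>\<^sup>+x. ennreal ((a n x)\<^sup>2) \<partial>M) + 2 * (\<integral>\<^sup>+x. ennreal ((b n x)\<^sup>2) \<partial>M)) \<longlonglongrightarrow> 2 * 0 + 2 * 0"
    using a b by (intro tendsto_add ennreal_tendsto_cmult) auto
  then show "(\<lambda>n. 2 * (\<integral>\<^sup>+x. ennreal ((a n x)\<^sup>2) \<partial>M) + 2 * (\<integral>\<^sup>+x. ennreal ((b n x)\<^sup>2) \<partial>M)) \<longlonglongrightarrow> 0"
    by simp
  have "(\<integral>\<^sup>+x. ennreal ((c n x)\<^sup>2) \<partial>M) \<le> 2 * (\<integral>\<^sup>+x. ennreal ((a n x)\<^sup>2) \<partial>M) + 2 * (\<integral>\<^sup>+x. ennreal ((b n x)\<^sup>2) \<partial>M)" for n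
  proof -
    have "(\<integral>\<^sup>+x. ennreal ((c n x)\<^sup>2) \<partial>M) \<le> (\<integral>\<^sup>+x. 2 * ennreal ((a n x)\<^sup>2) + 2 * ennreal ((b n x)\<^sup>2) \<partial>M)"
    proof (rule nn_integral_mono_AE)
      show "AE x in M. ennreal ((c n x)\<^sup>2) \<le> 2 * ennreal ((a n x)\<^sup>2) + 2 * ennreal ((b n x)\<^sup>2)"
        using c[of n]
      proof eventually_elim
        case (elim x)
        have "0 \<le> (a n x - b n x)\<^sup>2" by simp
        then have "(c n x)\<^sup>2 \<le> 2 * (a n x)\<^sup>2 + 2 * (b n x)\<^sup>2"
          unfolding elim by (simp add: power2_eq_square algebra_simps)
        then have "ennreal ((c n x)\<^sup>2) \<le> ennreal (2 * (a n x)\<^sup>2 + 2 * (b n x)\<^sup>2)"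
          by (rule ennreal_leI)
        then show ?case by (simp add: ennreal_plus ennreal_mult)
      qed
    qed
    also have "\<dots> = 2 * (\<integral>\<^sup>+x. ennreal ((a n x)\<^sup>2) \<partial>M) + 2 * (\<integral>\<^sup>+x. ennreal ((b n x)\<^sup>2) \<partial>M)"
      by (simp add: nn_integral_add nn_integral_cmult)
    finally show ?thesis .
  qed
  then show "\<forall>\<^sub>F n in sequentially. (\<integral>\<^sup>+x. ennreal ((c n x)\<^sup>2) \<partial>M) \<le> 2 * (\<integral>\<^sup>+x. ennreal ((a n x)\<^sup>2) \<partial>M) + 2 * (\<integral>\<^sup>+x. ennreal ((b n x)\<^sup>2) \<partial>M)"
    by simp
qed simp

context bounded_domain
begin

lemma continuous_surface_measurable:
  fixes f :: "real ^ 'd \<Rightarrow> real"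
  assumes "continuous_on UNIV f"
  shows "f \<in> borel_measurable (surface_measure D)"
proof -
  have "sets (hausdorff_measure (CARD('d) - 1) :: (real ^ 'd) measure) = sets borel"
    unfolding hausdorff_measure_def by (simp add: sets.sigma_sets_eq[of borel, simplified])
  then have "f \<in> borel_measurable (hausdorff_measure (CARD('d) - 1))"
    using borel_measurable_continuous_onI[OF assms] measurable_cong_sets by blast
  then show ?thesis
    unfolding surface_measure_def by (rule measurable_restrict_space1)
qed

text \<open>The approximating sequences add up. Traces of sums matter because Korn's inequality is
  applied on the enriched space, whose elements are sums of functions vanishing on the Dirichlet
  part.\<close>

lemma has_trace_add:
  assumes f: "f \<in> H1 D" "f' \<in> H1 D" and tr: "has_trace D f g" "has_trace D f' g'"
  shows "has_trace D (\<lambda>x. f x + f' x) (\<lambda>x. g x + g' x)"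
proof -
  have g: "g \<in> borel_measurable (surface_measure D)" "g' \<in> borel_measurable (surface_measure D)"
    using tr by (auto simp: has_trace_def)
  obtain \<phi> \<phi>' where \<phi>: "\<And>n::nat. smooth (\<phi> n)" "\<And>n::nat. smooth (\<phi>' n)"
    and 1: "(\<lambda>n. \<integral>\<^sup>+x. ennreal ((\<phi> n x - f x)\<^sup>2) \<partial>vol D) \<longlonglongrightarrow> 0"
      "(\<lambda>n. \<integral>\<^sup>+x. ennreal ((\<phi>' n x - f' x)\<^sup>2) \<partial>vol D) \<longlonglongrightarrow> 0"
    and 2: "\<And>i. (\<lambda>n. \<integral>\<^sup>+x. ennreal ((partial i (\<phi> n) x - weak_gradient D f x $ i)\<^sup>2) \<partial>vol D) \<longlonglongrightarrow> 0"
      "\<And>i. (\<lambda>n. \<integral>\<^sup>+x. ennreal ((partial i (\<phi>' n) x - weak_gradient D f' x $ i)\<^sup>2) \<partial>vol D) \<longlonglongrightarrow> 0"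
    and 3: "(\<lambda>n. \<integral>\<^sup>+x. ennreal ((\<phi> n x - g x)\<^sup>2) \<partial>surface_measure D) \<longlonglongrightarrow> 0"
      "(\<lambda>n. \<integral>\<^sup>+x. ennreal ((\<phi>' n x - g' x)\<^sup>2) \<partial>surface_measure D) \<longlonglongrightarrow> 0"
    using tr unfolding has_trace_def by blast
  have smooth_cont: "continuous_on UNIV h" "continuous_on UNIV (partial i h)" and smooth_diff: "\<And>x. h differentiable (at x)"
    if "smooth h" for h :: "real ^ 'd \<Rightarrow> real" and i
  proof -
    have "Ck 0 h" "Ck (Suc 0) h" using that unfolding smooth_def by blast+
    then show "continuous_on UNIV h" "continuous_on UNIV (partial i h)" "\<And>x. h differentiable (at x)" by auto
  qed
  have vol_meas: "h \<in> borel_measurable (vol D)" if "continuous_on UNIV h" for h :: "real ^ 'd \<Rightarrow> real"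
    using that by (intro measurable_restrict_space1) (simp add: borel_measurable_continuous_onI)
  have fm: "f \<in> borel_measurable (vol D)" "f' \<in> borel_measurable (vol D)"
    using f by (auto simp: H1_def L2_def)
  note wg = weak_gradient_works[OF f(1)] weak_gradient_works[OF f(2)]
  have wgm: "(\<lambda>x. weak_gradient D f x $ i) \<in> borel_measurable (vol D)"
    "(\<lambda>x. weak_gradient D f' x $ i) \<in> borel_measurable (vol D)" for i
    using wg by (auto intro!: L2_measurable L2_component simp: is_weak_gradient_def)
  have f_L2: "f \<in> L2 (vol D)" "f' \<in> L2 (vol D)" using f by (auto simp: H1_def)
  have sum_H1: "(\<lambda>x. f x + f' x) \<in> H1 D"
    using subspace_add[OF subspace_H1 f] by (simp add: plus_fun_def)
  have wg_add: "AE x in vol D. weak_gradient D (\<lambda>x. f x + f' x) x = weak_gradient D f x + weak_gradient D f' x"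
    by (rule is_weak_gradient_unique[OF weak_gradient_works[OF sum_H1] is_weak_gradient_add[OF wg f_L2]])
  have smooth_add: "smooth (\<lambda>x. \<phi> n x + \<phi>' n x)" for n
    using \<phi> by (simp add: smooth_def Ck_add)
  show ?thesis
    unfolding has_trace_def
  proof (intro conjI exI[of _ "\<lambda>n x. \<phi> n x + \<phi>' n x"] allI)
    show "(\<lambda>x. g x + g' x) \<in> borel_measurable (surface_measure D)"
      using g by simp
    show "smooth (\<lambda>x. \<phi> n x + \<phi>' n x)" for n by (rule smooth_add)
    show "(\<lambda>n. \<integral>\<^sup>+x. ennreal ((\<phi> n x + \<phi>' n x - (f x + f' x))\<^sup>2) \<partial>vol D) \<longlonglongrightarrow> 0"
    proof (rule nn_integral_square_tendsto_add[OF _ _ 1])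
      show "(\<lambda>x. \<phi> n x - f x) \<in> borel_measurable (vol D)" "(\<lambda>x. \<phi>' n x - f' x) \<in> borel_measurable (vol D)" for n
        using \<phi> fm by (blast intro: borel_measurable_diff vol_meas smooth_cont(1))+
    qed simp
    show "(\<lambda>n. \<integral>\<^sup>+x. ennreal ((partial i (\<lambda>x. \<phi> n x + \<phi>' n x) x - weak_gradient D (\<lambda>x. f x + f' x) x $ i)\<^sup>2) \<partial>vol D) \<longlonglongrightarrow> 0" for i
    proof (rule nn_integral_square_tendsto_add[OF _ _ 2[of i]])
      show "AE x in vol D. partial i (\<lambda>x. \<phi> n x + \<phi>' n x) x - weak_gradient D (\<lambda>x. f x + f' x) x $ i
          = partial i (\<phi> n) x - weak_gradient D f x $ i + (partial i (\<phi>' n) x - weak_gradient D f' x $ i)" for n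
        using wg_add by eventually_elim (simp add: partial_add[OF smooth_diff[OF \<phi>(1)] smooth_diff[OF \<phi>(2)]])
      show "(\<lambda>x. partial i (\<phi> n) x - weak_gradient D f x $ i) \<in> borel_measurable (vol D)" for n
        by (rule borel_measurable_diff[OF vol_meas[OF smooth_cont(2)[OF \<phi>(1)]] wgm(1)])
      show "(\<lambda>x. partial i (\<phi>' n) x - weak_gradient D f' x $ i) \<in> borel_measurable (vol D)" for n
        by (rule borel_measurable_diff[OF vol_meas[OF smooth_cont(2)[OF \<phi>(2)]] wgm(2)])
    qed
    show "(\<lambda>n. \<integral>\<^sup>+x. ennreal ((\<phi> n x + \<phi>' n x - (g x + g' x))\<^sup>2) \<partial>surface_measure D) \<longlonglongrightarrow> 0"
    proof (rule nn_integral_square_tendsto_add[OF _ _ 3])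
      show "(\<lambda>x. \<phi> n x - g x) \<in> borel_measurable (surface_measure D)"
        "(\<lambda>x. \<phi>' n x - g' x) \<in> borel_measurable (surface_measure D)" for n
        using \<phi> g by (blast intro: borel_measurable_diff continuous_surface_measurable smooth_cont(1))+
    qed simp
  qed
qed

lemma H1_E0_add:
  assumes "v \<in> H1_E0 D \<Gamma>" "w \<in> H1_E0 D \<Gamma>"
  shows "v + w \<in> H1_E0 D \<Gamma>"
  unfolding H1_E0_def mem_Collect_eq
proof (intro allI conjI)
  fix i
  have H1: "(\<lambda>x. v x $ i) \<in> H1 D" "(\<lambda>x. w x $ i) \<in> H1 D"
    using assms by (auto simp: H1_E0_def)
  have eq: "(\<lambda>x. (v + w) x $ i) = (\<lambda>x. v x $ i + w x $ i)" by simp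
  show "(\<lambda>x. (v + w) x $ i) \<in> H1 D"
    unfolding eq using subspace_add[OF subspace_H1 H1] by (simp add: plus_fun_def)
  obtain g where g: "has_trace D (\<lambda>x. v x $ i) g" "AE x in surface_measure D. x \<in> \<Gamma> \<longrightarrow> g x = 0"
    using assms(1) by (auto simp: H1_E0_def)
  obtain g' where g': "has_trace D (\<lambda>x. w x $ i) g'" "AE x in surface_measure D. x \<in> \<Gamma> \<longrightarrow> g' x = 0"
    using assms(2) by (auto simp: H1_E0_def)
  have "AE x in surface_measure D. x \<in> \<Gamma> \<longrightarrow> g x + g' x = 0"
    using g(2) g'(2) by eventually_elim simp
  with has_trace_add[OF H1 g(1) g'(1)]
  show "\<exists>g. has_trace D (\<lambda>x. (v + w) x $ i) g \<and> (AE x in surface_measure D. x \<in> \<Gamma> \<longrightarrow> g x = 0)"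
    unfolding eq by blast
qed

section \<open>The inf-sup condition on tensor product spaces\<close>

lemma dvg_bound:
  assumes "q \<in> L2 (vol D)" "v \<in> H1_vec"
  shows "\<bar>\<integral>x. q x * dvg D v x \<partial>vol D\<bar> \<le> L2_norm (vol D) q * (sqrt (real CARD('d)) * L2_norm (vol D) (grad D v))"
proof -
  note g = grad_L2[OF assms(2)]
  have t: "dvg D v \<in> L2 (vol D)"
    unfolding dvg_def[abs_def] by (rule L2_bounded_linear[OF g bounded_linear_trace])
  have "\<bar>\<integral>x. q x * dvg D v x \<partial>vol D\<bar> \<le> sqrt (\<integral>x. (q x)\<^sup>2 \<partial>vol D) * sqrt (\<integral>x. (dvg D v x)\<^sup>2 \<partial>vol D)"
    by (rule L2_Cauchy_Schwarz[OF assms(1) t])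
  also have "sqrt (\<integral>x. (dvg D v x)\<^sup>2 \<partial>vol D) \<le> sqrt (real CARD('d) * (\<integral>x. (norm (grad D v x))\<^sup>2 \<partial>vol D))"
  proof (rule real_sqrt_le_mono)
    have "(\<integral>x. (dvg D v x)\<^sup>2 \<partial>vol D) \<le> (\<integral>x. real CARD('d) * (norm (grad D v x))\<^sup>2 \<partial>vol D)"
      using L2_integrable_norm[OF t] L2_integrable_norm[OF g]
      by (intro integral_mono integrable_mult_right) (auto simp: dvg_def trace_power2_le)
    then show "(\<integral>x. (dvg D v x)\<^sup>2 \<partial>vol D) \<le> real CARD('d) * (\<integral>x. (norm (grad D v x))\<^sup>2 \<partial>vol D)"
      by simp
  qed
  finally show ?thesis
    by (simp add: L2_norm_def real_sqrt_mult mult_left_mono)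
qed

text \<open>By \<open>dvg_bound\<close> the functional vanishes wherever the gradient norm does,
  which is the kernel condition of \<open>finite_dim_Riesz\<close>.\<close>

lemma divergence_Riesz:
  assumes V: "finite_dim_space V" "V \<subseteq> H1_vec" and q: "q \<in> L2 (vol D)"
  shows "\<exists>t\<in>V. \<forall>v\<in>V. (\<integral>x. grad D t x \<bullet> grad D v x \<partial>vol D) = (\<integral>x. q x * dvg D v x \<partial>vol D)"
proof -
  interpret psd_form H1_vec "\<lambda>v w. \<integral>x. grad D v x \<bullet> grad D w x \<partial>vol D"
    by (rule psd_form_grad)
  obtain B where B: "finite B" "V = span B"
    using V by (auto simp: finite_dim_space_iff_span)
  show ?thesis
    unfolding B(2)
  proof (rule finite_dim_Riesz[OF B(1)])
    show "B \<subseteq> H1_vec" using V(2) B(2) span_superset by blast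
    show "(\<integral>x. q x * dvg D v x \<partial>vol D) = 0"
      if "v \<in> H1_vec" "(\<integral>x. grad D v x \<bullet> grad D v x \<partial>vol D) = 0" for v
    proof -
      have "L2_norm (vol D) (grad D v) = 0"
        using that(2) L2_norm_grad[of v] by simp
      then show ?thesis using dvg_bound[OF q that(1)] by simp
    qed
  qed (use q in \<open>auto intro: bilinear_on_add_right[OF bilinear_on_dvg] bilinear_on_scale_right[OF bilinear_on_dvg]\<close>)
qed

text \<open>By Cauchy-Schwarz the supremum in the inf-sup condition is at most the gradient norm of
  the representer \<open>t\<close>. This replaces the supremum by a quadratic inequality, which can
  be integrated over the parameters.\<close>

lemma inf_sup_slice:
  assumes "inf_sup_stable D V W \<gamma>" "V \<subseteq> H1_vec" "q \<in> W" "t \<in> V"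
    and t: "\<And>v. v \<in> V \<Longrightarrow> (\<integral>x. grad D t x \<bullet> grad D v x \<partial>vol D) = (\<integral>x. q x * dvg D v x \<partial>vol D)"
  shows "\<gamma>\<^sup>2 * (\<integral>x. q x * q x \<partial>vol D) \<le> (\<integral>x. grad D t x \<bullet> grad D t x \<partial>vol D)"
proof -
  interpret psd_form H1_vec "\<lambda>v w. \<integral>x. grad D v x \<bullet> grad D w x \<partial>vol D"
    by (rule psd_form_grad)
  let ?n = "\<lambda>v. L2_norm (vol D) (grad D v)"
  have n: "sqrt (\<integral>x. grad D v x \<bullet> grad D v x \<partial>vol D) = ?n v" for v
    unfolding L2_norm_grad[symmetric] by (simp add: L2_norm_nonneg)
  have "ereal (\<gamma> * L2_norm (vol D) q) \<le>
      (SUP v \<in> {v \<in> V. \<not> (AE x in vol D. v x = 0)}. ereal ((\<integral>x. q x * dvg D v x \<partial>vol D) / ?n v))"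
    using assms(1,3) by (auto simp: inf_sup_stable_def)
  also have "\<dots> \<le> ereal (?n t)"
  proof (rule SUP_least)
    fix v assume v: "v \<in> {v \<in> V. \<not> (AE x in vol D. v x = 0)}"
    then have "(\<integral>x. q x * dvg D v x \<partial>vol D) \<le> ?n t * ?n v"
      using Cauchy_Schwarz_sqrt[of t v] t[of v] assms(2,4) by (auto simp: n abs_le_iff)
    \<comment> \<open>A vanishing denominator makes the quotient 0, which respects the bound as
      well.\<close>
    then have "(\<integral>x. q x * dvg D v x \<partial>vol D) / ?n v \<le> ?n t"
      using L2_norm_nonneg[of "vol D" "grad D v"] L2_norm_nonneg[of "vol D" "grad D t"]
      by (cases "?n v = 0") (auto simp: divide_le_eq)
    then show "ereal ((\<integral>x. q x * dvg D v x \<partial>vol D) / ?n v) \<le> ereal (?n t)" by simp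
  qed
  finally have "\<gamma> * L2_norm (vol D) q \<le> ?n t" by simp
  then have "(\<gamma> * L2_norm (vol D) q)\<^sup>2 \<le> (?n t)\<^sup>2"
    using assms(1) by (intro power_mono) (auto simp: inf_sup_stable_def L2_norm_nonneg)
  then show ?thesis
    by (simp add: power_mult_distrib L2_norm_grad L2_norm_real)
qed

text \<open>The representer depends linearly on the pressure up to null sets, so it can be formed on
  the spatial factors of \<open>r\<close> while the parameter factors are kept. This places the test
  field in the tensor space, which separate choices at each \<open>y\<close> would not
  guarantee.\<close>

lemma tensor_inf_sup:
  assumes inf_sup: "inf_sup_stable D V W \<gamma>" and V: "finite_dim_space V" "V \<subseteq> H1_vec"
    and W: "subspace W" "W \<subseteq> L2 (vol D)" and S: "S \<subseteq> bounded_rv" and r: "r \<in> tensor W S"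
  shows "\<exists>v\<in>tensor V S. grad_prod v v \<le> L2_prod r r \<and> \<gamma> * L2_prod r r \<le> form_b D v r"
proof -
  interpret G: psd_form H1_vec "\<lambda>v w. \<integral>x. grad D v x \<bullet> grad D w x \<partial>vol D"
    by (rule psd_form_grad)
  interpret GP: psd_form random_H1 grad_prod by (rule psd_form_grad_prod)
  have \<gamma>: "0 < \<gamma>" using inf_sup by (simp add: inf_sup_stable_def)
  have subV: "subspace V" by (rule finite_dim_space_subspace[OF V(1)])
  obtain n :: nat and s q where r_eq: "r = (\<Sum>i<n. (\<lambda>y. s i y *\<^sub>R q i))"
    and s: "\<And>i. i < n \<Longrightarrow> s i \<in> S" and q: "\<And>i. i < n \<Longrightarrow> q i \<in> W"
    using r by (rule tensorE) (rule that)
  have "\<forall>i\<in>{..<n}. \<exists>t. t \<in> V \<and> (\<forall>v\<in>V. (\<integral>x. grad D t x \<bullet> grad D v x \<partial>vol D) = (\<integral>x. q i x * dvg D v x \<partial>vol D))"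
  proof
    fix i assume "i \<in> {..<n}"
    then have "q i \<in> L2 (vol D)" using q W(2) by auto
    from divergence_Riesz[OF V this]
    show "\<exists>t. t \<in> V \<and> (\<forall>v\<in>V. (\<integral>x. grad D t x \<bullet> grad D v x \<partial>vol D) = (\<integral>x. q i x * dvg D v x \<partial>vol D))"
      by blast
  qed
  from bchoice[OF this] obtain t where t': "\<forall>i\<in>{..<n}. t i \<in> V \<and>
      (\<forall>v\<in>V. (\<integral>x. grad D (t i) x \<bullet> grad D v x \<partial>vol D) = (\<integral>x. q i x * dvg D v x \<partial>vol D))" ..
  then have t: "\<And>i. i < n \<Longrightarrow> t i \<in> V"
    "\<And>i v. i < n \<Longrightarrow> v \<in> V \<Longrightarrow> (\<integral>x. grad D (t i) x \<bullet> grad D v x \<partial>vol D) = (\<integral>x. q i x * dvg D v x \<partial>vol D)"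
    by auto
  define v where "v = (\<Sum>i<n. (\<lambda>y. s i y *\<^sub>R t i))"
  have v: "v \<in> tensor V S"
    unfolding v_def using s t(1) by (rule tensorI)
  have vR: "v \<in> random_H1" and rR: "r \<in> random_L2"
    using v r tensor_random_H1[OF V(2) S] tensor_random_L2[OF W(2) S] by auto
  have rep: "(\<integral>x. grad D (v y) x \<bullet> grad D w x \<partial>vol D) = (\<integral>x. r y x * dvg D w x \<partial>vol D)" if w: "w \<in> V" for w y
  proof -
    have vy: "v y = (\<Sum>i<n. s i y *\<^sub>R t i)" and ry: "r y = (\<Sum>i<n. s i y *\<^sub>R q i)"
      unfolding v_def r_eq by (simp_all only: sum_fun_apply)
    have "(\<integral>x. grad D (v y) x \<bullet> grad D w x \<partial>vol D) = (\<Sum>i<n. s i y * (\<integral>x. grad D (t i) x \<bullet> grad D w x \<partial>vol D))"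
      unfolding vy using t(1) V(2) w by (intro bilinear_on_sum_left[OF G.bil G.sub]) auto
    also have "\<dots> = (\<Sum>i<n. s i y * (\<integral>x. q i x * dvg D w x \<partial>vol D))"
      using t(2) w by simp
    also have "\<dots> = (\<integral>x. r y x * dvg D w x \<partial>vol D)"
      unfolding ry using q W(2) V(2) w
      by (intro bilinear_on_sum_left[OF bilinear_on_dvg subspace_L2, symmetric]) auto
    finally show ?thesis .
  qed
  have vy: "v y \<in> V" and ry: "r y \<in> W" for y
    using tensor_apply subV W(1) v r by auto
  \<comment> \<open>The sign is the one in the definition of \<open>form_b\<close>; the witness is
    therefore a negative multiple of \<open>v\<close>.\<close>
  have b: "form_b D v r = - grad_prod v v"
    unfolding form_b_def grad_prod_def using rep[OF vy] by simp
  have low: "\<gamma>\<^sup>2 * L2_prod r r \<le> grad_prod v v"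
    unfolding L2_prod_def grad_prod_def
    by (rule double_integral_mono[OF slicewise_mult[OF rR rR]
          slicewise_inner[OF slice_rep_grad[OF vR] slice_rep_grad[OF vR]]])
      (rule inf_sup_slice[OF inf_sup V(2) ry vy rep])
  have P: "0 \<le> L2_prod r r"
    using psd_form.nonneg[OF psd_form_L2_prod rR] .
  show ?thesis
  proof (cases "grad_prod v v = 0")
    \<comment> \<open>Then \<open>r\<close> has norm 0 and the zero field serves as witness.\<close>
    case True
    then have "L2_prod r r = 0"
      using low P \<gamma> by (simp add: mult_le_0_iff)
    moreover have "0 \<in> tensor V S"
      by (rule subspace_0[OF subspace_tensor[OF subV]])
    moreover have "grad_prod 0 0 = 0" "form_b D 0 r = 0"
      using bilinear_on_zero_left[OF GP.bil GP.sub subspace_0[OF GP.sub]]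
        bilinear_on_zero_left[OF bilinear_on_form_b subspace_random_H1 rR] by auto
    ultimately show ?thesis by (intro bexI[of _ 0]) auto
  next
    case False
    then have G: "0 < grad_prod v v" using GP.nonneg[OF vR] by simp
    \<comment> \<open>Scales the gradient norm of \<open>v\<close> to the norm of
      \<open>r\<close>.\<close>
    define k where "k = sqrt (L2_prod r r / grad_prod v v)"
    have k: "k\<^sup>2 * grad_prod v v = L2_prod r r"
      using G P by (simp add: k_def)
    have k0: "0 \<le> k" using G P by (simp add: k_def)
    let ?w = "(- k) *\<^sub>R v"
    have w: "?w \<in> tensor V S"
      using v by (rule subspace_scale[OF subspace_tensor[OF subV]])
    have "grad_prod ?w ?w = L2_prod r r"
      using k subspace_scale[OF GP.sub vR, of "- k"] vR
      by (simp only: bilinear_on_scale_left[OF GP.bil] bilinear_on_scale_right[OF GP.bil])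
        (simp add: power2_eq_square mult.assoc)
    moreover have "form_b D ?w r = k * grad_prod v v"
      using bilinear_on_scale_left[OF bilinear_on_form_b vR rR, of "- k"] b by simp
    moreover have "\<gamma> * L2_prod r r \<le> k * grad_prod v v"
    proof -
      \<comment> \<open>This restates \<open>low\<close>. Multiplied by
        \<open>k * grad_prod v v\<close> it yields the claim, because
        \<open>k\<^sup>2 * grad_prod v v\<close> is \<open>L2_prod r r\<close>.\<close>
      have "\<gamma> * k \<le> 1"
      proof -
        have "(\<gamma> * k)\<^sup>2 = \<gamma>\<^sup>2 * L2_prod r r / grad_prod v v"
          using G P by (simp add: k_def power_mult_distrib)
        also have "\<dots> \<le> 1\<^sup>2" using low G by simp
        finally show ?thesis by (rule power2_le_imp_le) simp
      qed
      then have "(\<gamma> * k) * (k * grad_prod v v) \<le> 1 * (k * grad_prod v v)"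
        using k0 G by (intro mult_right_mono) auto
      then show ?thesis
        unfolding k[symmetric] by (simp add: power2_eq_square mult_ac)
    qed
    ultimately show ?thesis using w by (intro bexI[of _ ?w]) auto
  qed
qed

end

section \<open>Forms weighted with the modulus\<close>

locale elastic_domain = bounded_domain D for D :: "(real ^ 'd) set" +
  fixes E :: "real ^ 'd \<Rightarrow> (nat \<Rightarrow> real) \<Rightarrow> real" and Emin Emax :: real
  assumes E_measurable: "(\<lambda>(x, y). E x y) \<in> borel_measurable DG"
    and E_bounds: "AE (x, y) in DG. Emin \<le> E x y \<and> E x y \<le> Emax"
    and Emin_pos: "0 < Emin"
begin

abbreviation modulus_weight :: "(real ^ 'd) \<times> (nat \<Rightarrow> real) \<Rightarrow> real" where
  "modulus_weight \<equiv> \<lambda>z. E (fst z) (snd z)"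

lemma E_bounds': "AE z in DG. Emin \<le> modulus_weight z \<and> modulus_weight z \<le> Emax"
  using E_bounds by (simp add: case_prod_beta)

lemma bounded_weight_E: "bounded_weight DG modulus_weight"
  unfolding bounded_weight_def
proof (intro conjI exI[of _ Emax])
  show "modulus_weight \<in> borel_measurable DG"
    using E_measurable by (simp add: case_prod_beta')
  show "AE z in DG. \<bar>modulus_weight z\<bar> \<le> Emax"
    using E_bounds' by (rule AE_mp) (use Emin_pos in \<open>auto intro!: AE_I2\<close>)
qed

lemma modulus_weight_nonneg: "AE z in DG. 0 \<le> modulus_weight z"
  using E_bounds' by (rule AE_mp) (use Emin_pos in \<open>auto intro!: AE_I2\<close>)

definition strain_prod :: "'d vfield \<Rightarrow> 'd vfield \<Rightarrow> real" where
  "strain_prod u v = double_integral D (\<lambda>y x. E x y * (strain D (u y) x \<bullet> strain D (v y) x))"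

definition weighted_prod :: "'d sfield \<Rightarrow> 'd sfield \<Rightarrow> real" where
  "weighted_prod p q = double_integral D (\<lambda>y x. E x y * p y x * q y x)"

lemma strain_prod_eq:
  assumes "u \<in> random_H1" "v \<in> random_H1"
  shows "strain_prod u v = (\<integral>z. modulus_weight z * (sym_part (rgrad u z) \<bullet> sym_part (rgrad v z)) \<partial>DG)"
  unfolding strain_prod_def
  using double_integral_slicewise[OF slicewise_weighted_inner[OF bounded_weight_E
      slice_rep_strain[OF assms(1)] slice_rep_strain[OF assms(2)]]] by simp

lemma weighted_prod_eq:
  assumes "p \<in> random_L2" "q \<in> random_L2"
  shows "weighted_prod p q = (\<integral>z. modulus_weight z * (p (snd z) (fst z) \<bullet> q (snd z) (fst z)) \<partial>DG)"
  unfolding weighted_prod_def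
  using double_integral_slicewise[OF slicewise_weighted_inner[OF bounded_weight_E
      slice_rep_random_L2[OF assms(1)] slice_rep_random_L2[OF assms(2)]]] by (simp add: mult.assoc)

lemma psd_form_strain_prod: "psd_form random_H1 strain_prod"
  by (rule psd_form_cong[OF psd_form_weighted_integral[OF bounded_weight_E modulus_weight_nonneg
          AE_linear_on_compose[OF AE_linear_on_rgrad bounded_linear_sym_part] subspace_random_H1] strain_prod_eq])

lemma psd_form_weighted_prod: "psd_form random_L2 weighted_prod"
  by (rule psd_form_cong[OF psd_form_weighted_integral[OF bounded_weight_E modulus_weight_nonneg
          AE_linear_on_joint subspace_random_L2] weighted_prod_eq])

lemma weighted_integral_bounds:
  fixes F :: "_ \<Rightarrow> 'b::euclidean_space"
  assumes "F \<in> L2 DG"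
  shows "Emin * (\<integral>z. F z \<bullet> F z \<partial>DG) \<le> (\<integral>z. modulus_weight z * (F z \<bullet> F z) \<partial>DG)"
    and "(\<integral>z. modulus_weight z * (F z \<bullet> F z) \<partial>DG) \<le> Emax * (\<integral>z. F z \<bullet> F z \<partial>DG)"
proof -
  have int: "integrable DG (\<lambda>z. F z \<bullet> F z)" by (rule L2_integrable_inner[OF assms assms])
  have intE: "integrable DG (\<lambda>z. modulus_weight z * (F z \<bullet> F z))"
    by (rule weighted_inner_integrable[OF bounded_weight_E assms assms])
  have "(\<integral>z. Emin * (F z \<bullet> F z) \<partial>DG) \<le> (\<integral>z. modulus_weight z * (F z \<bullet> F z) \<partial>DG)"
  proof (intro integral_mono_AE integrable_mult_right int intE)
    show "AE z in DG. Emin * (F z \<bullet> F z) \<le> modulus_weight z * (F z \<bullet> F z)"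
      using E_bounds' by (rule AE_mp) (auto intro!: AE_I2 mult_right_mono)
  qed
  then show "Emin * (\<integral>z. F z \<bullet> F z \<partial>DG) \<le> (\<integral>z. modulus_weight z * (F z \<bullet> F z) \<partial>DG)" by simp
  have "(\<integral>z. modulus_weight z * (F z \<bullet> F z) \<partial>DG) \<le> (\<integral>z. Emax * (F z \<bullet> F z) \<partial>DG)"
  proof (intro integral_mono_AE integrable_mult_right int intE)
    show "AE z in DG. modulus_weight z * (F z \<bullet> F z) \<le> Emax * (F z \<bullet> F z)"
      using E_bounds' by (rule AE_mp) (auto intro!: AE_I2 mult_right_mono)
  qed
  then show "(\<integral>z. modulus_weight z * (F z \<bullet> F z) \<partial>DG) \<le> Emax * (\<integral>z. F z \<bullet> F z \<partial>DG)" by simp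
qed

lemma weighted_prod_bounds:
  assumes "q \<in> random_L2"
  shows "Emin * L2_prod q q \<le> weighted_prod q q" "weighted_prod q q \<le> Emax * L2_prod q q"
  using weighted_integral_bounds[of "\<lambda>z. q (snd z) (fst z)"] assms
  by (auto simp: random_L2_def weighted_prod_eq L2_prod_eq)

lemma strain_prod_upper:
  assumes "0 \<le> Emax" "u \<in> random_H1"
  shows "strain_prod u u \<le> Emax * grad_prod u u"
proof -
  note g = rgrad_L2[OF assms(2)]
  note s = L2_bounded_linear[OF g bounded_linear_sym_part]
  have "strain_prod u u \<le> Emax * (\<integral>z. sym_part (rgrad u z) \<bullet> sym_part (rgrad u z) \<partial>DG)"
    unfolding strain_prod_eq[OF assms(2,2)] by (rule weighted_integral_bounds(2)[OF s])
  also have "(\<integral>z. sym_part (rgrad u z) \<bullet> sym_part (rgrad u z) \<partial>DG) \<le> (\<integral>z. rgrad u z \<bullet> rgrad u z \<partial>DG)"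
    using norm_sym_part_le
    by (intro integral_mono L2_integrable_inner g s) (simp add: power_mono flip: power2_norm_eq_inner)
  also have "(\<integral>z. rgrad u z \<bullet> rgrad u z \<partial>DG) = grad_prod u u"
    using grad_prod_eq[OF assms(2,2)] by simp
  finally show ?thesis using assms(1) by (simp add: mult_left_mono)
qed

text \<open>Korn's inequality concerns the unweighted strain of a slice. It is integrated over the
  parameters, and the modulus enters afterwards through its lower bound.\<close>

lemma strain_prod_lower:
  assumes korn: "korn_constant D \<Gamma> CK" and u: "u \<in> random_H1" "\<And>y. u y \<in> H1_E0 D \<Gamma>"
  shows "Emin * CK * grad_prod u u \<le> strain_prod u u"
proof -
  note g = slice_rep_grad[OF u(1)] and s = slice_rep_strain[OF u(1)]
  have "CK * grad_prod u u \<le> double_integral D (\<lambda>y x. strain D (u y) x \<bullet> strain D (u y) x)"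
    unfolding grad_prod_def
  proof (rule double_integral_mono[OF slicewise_inner[OF g g] slicewise_inner[OF s s]])
    fix y
    show "CK * (\<integral>x. grad D (u y) x \<bullet> grad D (u y) x \<partial>vol D) \<le> (\<integral>x. strain D (u y) x \<bullet> strain D (u y) x \<partial>vol D)"
      using korn u(2)[of y] unfolding korn_constant_def L2_norm_grad[symmetric] by blast
  qed
  also have "\<dots> = (\<integral>z. sym_part (rgrad u z) \<bullet> sym_part (rgrad u z) \<partial>DG)"
    by (rule double_integral_slicewise[OF slicewise_inner[OF s s]])
  finally have "Emin * (CK * grad_prod u u) \<le> Emin * (\<integral>z. sym_part (rgrad u z) \<bullet> sym_part (rgrad u z) \<partial>DG)"
    using Emin_pos by simp
  also have "\<dots> \<le> strain_prod u u"
    unfolding strain_prod_eq[OF u(1) u(1)]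
    by (rule weighted_integral_bounds(1)[OF L2_bounded_linear[OF rgrad_L2[OF u(1)] bounded_linear_sym_part]])
  finally show ?thesis by (simp add: mult.assoc)
qed

text \<open>A nonempty open set has positive measure, so the bounds on the modulus hold at some
  point.\<close>

lemma Emin_le_Emax:
  assumes "D \<noteq> {}"
  shows "Emin \<le> Emax"
proof (rule ccontr)
  assume "\<not> Emin \<le> Emax"
  from E_bounds' have "AE z in DG. False"
    by (rule AE_mp) (use \<open>\<not> Emin \<le> Emax\<close> in \<open>auto intro!: AE_I2\<close>)
  then have "AE x in vol D. AE y in param_measure. False"
    using DG.AE_pair[of "\<lambda>_. False"] by simp
  then have "AE x in vol D. False" by simp
  then obtain N where N: "space (vol D) \<subseteq> N" "emeasure (vol D) N = 0" "N \<in> sets (vol D)"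
    by (auto elim!: AE_E)
  have "emeasure (vol D) (space (vol D)) = 0"
    using emeasure_mono[OF N(1,3)] N(2) by simp
  then have "D \<in> null_sets lborel"
    using open_D by (simp add: emeasure_restrict_space space_restrict_space null_sets_def)
  then have "negligible D"
    by (simp add: negligible_iff_null_sets null_sets_completionI)
  with open_not_negligible[OF open_D assms] show False ..
qed

end

subsection \<open>Error bounds for the enriched problems\<close>

context mixed_problem
begin

text \<open>The form is linear in the error, and the enriched equations replace its fine part by
  data; what remains is the residual of the original solution.\<close>

lemma total_form_galerkin:
  assumes u: "u \<in> V" "p \<in> W" "pt \<in> W" and us: "us \<in> V" "ps \<in> W" "pts \<in> W" and v: "v \<in> V" "q \<in> W" "t \<in> W"
    and eq: "\<alpha> * a us v + b v ps = l" "b us q - \<kappa> * m pts q = 0" "- \<kappa> * m ps t + \<kappa> * d pts t = 0"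
  shows "total_form (us - u) (ps - p) (pts - pt) v q t =
    (l - \<alpha> * a u v - b v p) + (- b u q + \<kappa> * m pt q) + (\<kappa> * m p t - \<kappa> * d pt t)"
proof -
  have neg: "(-1) *\<^sub>R p \<in> W" using u W.sub by (intro subspace_scale)
  have 1: "b v (ps - p) = b v ps - b v p"
    using bilinear_on_add_right[OF b_bil v(1) us(2) neg] bilinear_on_scale_right[OF b_bil v(1) u(2), of "-1"]
    by simp
  have 2: "a (us - u) v = a us v - a u v"
    by (rule bilinear_on_diff_left[OF V_E.bil V.sub us(1) u(1) v(1)])
  have 3: "b (us - u) q = b us q - b u q"
    by (rule bilinear_on_diff_left[OF b_bil V.sub us(1) u(1) v(2)])
  have 4: "m (pts - pt) q = m pts q - m pt q" "m (ps - p) t = m ps t - m p t"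
    using u us v by (simp_all add: bilinear_on_diff_left[OF W.bil W.sub])
  have 5: "d (pts - pt) t = d pts t - d pt t"
    by (rule bilinear_on_diff_left[OF W_E.bil W.sub us(3) u(3) v(3)])
  show ?thesis
    using eq unfolding total_form_def 1 2 3 4 5 right_diff_distrib by linarith
qed

text \<open>\<open>X\<close> and \<open>Y\<close> are the original spaces, \<open>Z\<close> and
  \<open>T\<close> the added ones. \<open>\<delta>\<close> measures the stability of the splitting;
  it is \<open>1 - \<gamma>\<^sup>2\<close> for the spatial enrichment and 1 for the parametric
  one.\<close>

lemma enriched_error_bounds:
  fixes l :: "'v \<Rightarrow> real"
  assumes l: "\<And>v v'. v \<in> V \<Longrightarrow> v' \<in> V \<Longrightarrow> l (v + v') = l v + l v'"
    and inf_sup: "\<And>r. r \<in> W \<Longrightarrow> \<exists>v\<in>V. g v v \<le> m r r \<and> \<gamma> * m r r \<le> b v r" and \<gamma>: "0 < \<gamma>"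
    and sub: "X \<subseteq> V" "Z \<subseteq> V" "Y \<subseteq> W" "T \<subseteq> W" and \<delta>: "0 < \<delta>"
    and split_V: "\<And>v. v \<in> V \<Longrightarrow> \<exists>v0\<in>X. \<exists>z\<in>Z. v = v0 + z \<and> \<delta> * g z z \<le> g v v"
    and split_W: "\<And>q. q \<in> W \<Longrightarrow> \<exists>q0\<in>Y. \<exists>z\<in>T. q = q0 + z \<and> \<delta> * m z z \<le> m q q"
    and coarse: "u \<in> X" "p \<in> Y" "pt \<in> Y"
      "\<And>v. v \<in> X \<Longrightarrow> \<alpha> * a u v + b v p = l v"
      "\<And>q. q \<in> Y \<Longrightarrow> b u q - \<kappa> * m pt q = 0"
      "\<And>t. t \<in> Y \<Longrightarrow> - \<kappa> * m p t + \<kappa> * d pt t = 0"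
    and fine: "us \<in> V" "ps \<in> W" "pts \<in> W"
      "\<And>v. v \<in> V \<Longrightarrow> \<alpha> * a us v + b v ps = l v"
      "\<And>q. q \<in> W \<Longrightarrow> b us q - \<kappa> * m pts q = 0"
      "\<And>t. t \<in> W \<Longrightarrow> - \<kappa> * m ps t + \<kappa> * d pts t = 0"
    and proxy: "zu \<in> Z" "zp \<in> T" "zt \<in> T"
      "\<And>v. v \<in> Z \<Longrightarrow> \<alpha> * g zu v = l v - \<alpha> * a u v - b v p"
      "\<And>q. q \<in> T \<Longrightarrow> (1 / \<alpha> + \<kappa>) * m zp q = - b u q + \<kappa> * m pt q"
      "\<And>t. t \<in> T \<Longrightarrow> \<kappa> * m zt t = \<kappa> * m p t - \<kappa> * d pt t"
  shows "inverse (sqrt 3 * max (Emax + n) (1 + n)) * sqrt (energy zu zp zt)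
      \<le> sqrt (energy (us - u) (ps - p) (pts - pt))"
    and "sqrt (energy (us - u) (ps - p) (pts - pt)) \<le> const_C7 CK \<gamma> Emin Emax / sqrt \<delta> * sqrt (energy zu zp zt)"
proof -
  have u: "u \<in> V" "p \<in> W" "pt \<in> W" and z: "zu \<in> V" "zp \<in> W" "zt \<in> W"
    using coarse(1-3) proxy(1-3) sub by auto
  have e: "us - u \<in> V" "ps - p \<in> W" "pts - pt \<in> W"
    using fine(1-3) u V.sub W.sub by (auto intro: subspace_diff)
  have total: "total_form (us - u) (ps - p) (pts - pt) v q t =
      (l v - \<alpha> * a u v - b v p) + (- b u q + \<kappa> * m pt q) + (\<kappa> * m p t - \<kappa> * d pt t)"
    if "v \<in> V" "q \<in> W" "t \<in> W" for v q t
    using that by (intro total_form_galerkin u fine)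
  note zero = bilinear_on_zero_left[OF b_bil V.sub] bilinear_on_zero_right[OF b_bil W.sub]
    bilinear_on_zero_right[OF V_E.bil V.sub] bilinear_on_zero_right[OF W.bil W.sub] bilinear_on_zero_right[OF W_E.bil W.sub]
  have V0: "0 \<in> V" and W0: "0 \<in> W" using subspace_0[OF V.sub] subspace_0[OF W.sub] by auto
  have l0: "l 0 = 0" using l[OF V0 V0] by simp
  show "inverse (sqrt 3 * max (Emax + n) (1 + n)) * sqrt (energy zu zp zt)
      \<le> sqrt (energy (us - u) (ps - p) (pts - pt))"
  proof (rule error_lower_bound[OF e z])
    \<comment> \<open>Test triples with two zero components isolate one proxy each.\<close>
    show "\<alpha> * g zu zu = \<alpha> * a (us - u) zu + b zu (ps - p)"
      using total[OF z(1) W0 W0] proxy(4)[OF proxy(1)] u e by (simp add: total_form_def zero)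
    show "(1 / \<alpha> + \<kappa>) * m zp zp = b (us - u) zp - \<kappa> * m (pts - pt) zp"
      using total[OF V0 z(2) W0] proxy(5)[OF proxy(2)] u e l0 by (simp add: total_form_def zero)
    show "\<kappa> * m zt zt = - \<kappa> * m (ps - p) zt + \<kappa> * d (pts - pt) zt"
      using total[OF V0 W0 z(3)] proxy(6)[OF proxy(3)] u e l0 by (simp add: total_form_def zero)
  qed
  have K: "0 \<le> sqrt (energy zu zp zt) / sqrt \<delta>"
    using energy_nonneg[OF z] \<delta> by simp
  have "sqrt (energy (us - u) (ps - p) (pts - pt)) \<le> const_C7 CK \<gamma> Emin Emax * (sqrt (energy zu zp zt) / sqrt \<delta>)"
  proof (rule error_upper_bound[OF V.sub order_refl W.sub order_refl inf_sup \<gamma> e K])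
    fix v q t assume v: "v \<in> V" and q: "q \<in> W" and t: "t \<in> W"
    obtain v0 z where vz: "v0 \<in> X" "z \<in> Z" "v = v0 + z" "\<delta> * g z z \<le> g v v"
      using split_V[OF v] by blast
    obtain q0 zq where qz: "q0 \<in> Y" "zq \<in> T" "q = q0 + zq" "\<delta> * m zq zq \<le> m q q"
      using split_W[OF q] by blast
    obtain t0 zs where tz: "t0 \<in> Y" "zs \<in> T" "t = t0 + zs" "\<delta> * m zs zs \<le> m t t"
      using split_W[OF t] by blast
    have mem: "v0 \<in> V" "z \<in> V" "q0 \<in> W" "zq \<in> W" "t0 \<in> W" "zs \<in> W"
      using vz qz tz sub by auto
    \<comment> \<open>By the equations of the original problem \<open>v0\<close> drops out of the
      residual, and the proxy represents the rest; likewise for \<open>q0\<close> and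
      \<open>t0\<close> below.\<close>
    have "l v - \<alpha> * a u v - b v p = \<alpha> * g zu z"
      using coarse(4)[OF vz(1)] proxy(4)[OF vz(2)] mem u unfolding vz(3)
      by (simp add: l bilinear_on_add_right[OF V_E.bil] bilinear_on_add_left[OF b_bil] algebra_simps)
    moreover have "- b u q + \<kappa> * m pt q = (1 / \<alpha> + \<kappa>) * m zp zq"
      using coarse(5)[OF qz(1)] proxy(5)[OF qz(2)] mem u unfolding qz(3)
      by (simp add: bilinear_on_add_right[OF b_bil] bilinear_on_add_right[OF W.bil] algebra_simps)
    moreover have "\<kappa> * m p t - \<kappa> * d pt t = \<kappa> * m zt zs"
      using coarse(6)[OF tz(1)] proxy(6)[OF tz(2)] mem u unfolding tz(3)
      by (simp only: bilinear_on_add_right[OF W.bil] bilinear_on_add_right[OF W_E.bil] distrib_left)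
    ultimately have "total_form (us - u) (ps - p) (pts - pt) v q t =
        \<alpha> * g zu z + (1 / \<alpha> + \<kappa>) * m zp zq + \<kappa> * m zt zs"
      using total[OF v q t] by simp
    also have "\<dots> \<le> sqrt (energy zu zp zt) * sqrt (energy z zq zs)"
      using z mem by (intro energy_Cauchy_Schwarz)
    also have "\<dots> \<le> sqrt (energy zu zp zt) * sqrt (energy v q t / \<delta>)"
    proof (intro mult_left_mono real_sqrt_le_mono)
      have "\<alpha> * (\<delta> * g z z) + (1 / \<alpha> + \<kappa>) * (\<delta> * m zq zq) + \<kappa> * (\<delta> * m zs zs) \<le> energy v q t"
        unfolding energy_def using pos vz(4) qz(4) tz(4) by (intro add_mono mult_left_mono) auto
      then have "\<delta> * energy z zq zs \<le> energy v q t"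
        by (simp add: energy_def algebra_simps)
      then show "energy z zq zs \<le> energy v q t / \<delta>"
        using \<delta> by (simp add: field_simps)
    qed (use energy_nonneg[OF z] in simp)
    finally show "total_form (us - u) (ps - p) (pts - pt) v q t
        \<le> sqrt (energy zu zp zt) / sqrt \<delta> * sqrt (energy v q t)"
      by (simp add: real_sqrt_divide)
  qed
  then show "sqrt (energy (us - u) (ps - p) (pts - pt)) \<le> const_C7 CK \<gamma> Emin Emax / sqrt \<delta> * sqrt (energy zu zp zt)"
    by simp
qed

end

section \<open>Specialisation to the Galerkin spaces\<close>

context elastic_domain
begin

lemma mixed_problem_tensor:
  assumes V: "subspace V" "V \<subseteq> H1_E0 D \<Gamma>" and W: "subspace W" "W \<subseteq> L2 (vol D)" and S: "S \<subseteq> bounded_rv"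
    and korn: "korn_constant D \<Gamma> CK" and pos: "0 < \<alpha>" "0 < \<kappa>" and Emax: "Emin \<le> Emax"
  shows "mixed_problem (tensor V S) grad_prod strain_prod (tensor W S) L2_prod weighted_prod (form_b D)
    \<alpha> \<kappa> Emin Emax CK (sqrt (real CARD('d)))"
proof -
  have V': "tensor V S \<subseteq> random_H1" and W': "tensor W S \<subseteq> random_L2"
    using tensor_random_H1[OF order_trans[OF V(2) H1_E0_subset] S] tensor_random_L2[OF W(2) S] by auto
  note sub = subspace_tensor[OF V(1), of S] subspace_tensor[OF W(1), of S]
  interpret V: psd_form "tensor V S" grad_prod
    by (rule psd_form.mono_subspace[OF psd_form_grad_prod sub(1) V'])
  interpret VE: psd_form "tensor V S" strain_prod
    by (rule psd_form.mono_subspace[OF psd_form_strain_prod sub(1) V'])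
  interpret W: psd_form "tensor W S" L2_prod
    by (rule psd_form.mono_subspace[OF psd_form_L2_prod sub(2) W'])
  interpret WE: psd_form "tensor W S" weighted_prod
    by (rule psd_form.mono_subspace[OF psd_form_weighted_prod sub(2) W'])
  have "1 \<le> real CARD('d)"
    using zero_less_card_finite[where 'a = 'd] by linarith
  then show ?thesis
  proof unfold_locales
    show "bilinear_on (tensor V S) (tensor W S) (form_b D)"
      by (rule bilinear_on_subset[OF bilinear_on_form_b V' W'])
    show "Emin * CK * grad_prod v v \<le> strain_prod v v" if "v \<in> tensor V S" for v
      using that V' V(2) tensor_apply[OF V(1) that] by (intro strain_prod_lower[OF korn]) auto
    show "strain_prod v v \<le> Emax * grad_prod v v" if "v \<in> tensor V S" for v
      using that V' Emin_pos Emax by (intro strain_prod_upper) auto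
    show "Emin * L2_prod q q \<le> weighted_prod q q" "weighted_prod q q \<le> Emax * L2_prod q q" if "q \<in> tensor W S" for q
      using that W' weighted_prod_bounds by auto
    show "\<bar>form_b D v q\<bar> \<le> sqrt (real CARD('d)) * sqrt (grad_prod v v) * sqrt (L2_prod q q)"
      if "v \<in> tensor V S" "q \<in> tensor W S" for v q
      using that V' W' by (intro form_b_bound) auto
  qed (use pos Emax Emin_pos korn in \<open>auto simp: korn_constant_def\<close>)
qed

lemma form_eqs:
  "form_a D \<alpha> E u v = \<alpha> * strain_prod u v"
  "form_c D \<alpha> \<beta> p q = 1 / (\<alpha> * \<beta>) * L2_prod p q"
  "form_d D \<alpha> \<beta> E p q = 1 / (\<alpha> * \<beta>) * weighted_prod p q"
  "form_a0 D \<alpha> u v = \<alpha> * grad_prod u v"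
  "form_cbar D \<alpha> \<beta> p q = (1 / \<alpha> + 1 / (\<alpha> * \<beta>)) * L2_prod p q"
  "form_d0 D \<alpha> \<beta> p q = 1 / (\<alpha> * \<beta>) * L2_prod p q"
  by (simp_all add: form_a_def form_c_def form_d_def form_a0_def form_cbar_def form_d0_def
      strain_prod_def L2_prod_def weighted_prod_def grad_prod_def)

lemma triple_norm_eq:
  assumes "v \<in> random_H1" "q \<in> random_L2" "r \<in> random_L2"
  shows "triple_norm D \<alpha> \<beta> v q r =
    sqrt (\<alpha> * grad_prod v v + (1 / \<alpha> + 1 / (\<alpha> * \<beta>)) * L2_prod q q + 1 / (\<alpha> * \<beta>) * L2_prod r r)"
proof -
  have "(grad_W_norm D v)\<^sup>2 = grad_prod v v"
    using psd_form.nonneg[OF psd_form_grad_prod assms(1)]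
    by (simp add: grad_W_norm_def grad_prod_def power2_norm_eq_inner)
  moreover have "(W_norm D q)\<^sup>2 = L2_prod q q" if "q \<in> random_L2" for q
    using psd_form.nonneg[OF psd_form_L2_prod that]
    by (simp add: W_norm_def L2_prod_def power2_eq_square)
  ultimately show ?thesis
    using assms by (simp add: triple_norm_def)
qed

lemma eta_spatial_eq:
  assumes "0 < \<alpha>" "0 < \<beta>" "zu \<in> random_H1" "zp \<in> random_L2" "zt \<in> random_L2"
  shows "eta_spatial D \<alpha> \<beta> zu zp zt =
      sqrt (\<alpha> * grad_prod zu zu + (1 / \<alpha> + 1 / (\<alpha> * \<beta>)) * L2_prod zp zp + 1 / (\<alpha> * \<beta>) * L2_prod zt zt)"
  using psd_form.nonneg[OF psd_form_grad_prod assms(3)] psd_form.nonneg[OF psd_form_L2_prod assms(4)]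
    psd_form.nonneg[OF psd_form_L2_prod assms(5)] assms(1,2)
  by (simp add: eta_spatial_def induced_norm_def form_eqs)

text \<open>Makes the parametric estimator an instance of the spatial one, with zero as second
  proxy.\<close>

lemma eta_spatial_0: "eta_spatial D \<alpha> \<beta> zu 0 zt = eta_parametric D \<alpha> \<beta> zu zt"
  by (simp add: eta_spatial_def eta_parametric_def induced_norm_def form_cbar_def)

text \<open>Shared by both enrichments: \<open>tensor V S\<close> and \<open>tensor W S\<close> are
  the enriched spaces, whichever factor has been enlarged.\<close>

lemma enrichment_bounds:
  assumes pos: "0 < \<alpha>" "0 < \<beta>" and ne: "D \<noteq> {}" and korn: "korn_constant D \<Gamma> CK" and f: "f \<in> L2 (vol D)"
    and V: "finite_dim_space V" "V \<subseteq> H1_E0 D \<Gamma>" and W: "subspace W" "W \<subseteq> L2 (vol D)"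
    and inf_sup: "inf_sup_stable D V W \<gamma>" and S: "S \<subseteq> bounded_rv"
    and sub: "X \<subseteq> tensor V S" "Z \<subseteq> tensor V S" "Y \<subseteq> tensor W S" "T \<subseteq> tensor W S" and \<delta>: "0 < \<delta>"
    and split_V: "\<And>v. v \<in> tensor V S \<Longrightarrow> \<exists>v0\<in>X. \<exists>z\<in>Z. v = v0 + z \<and> \<delta> * grad_prod z z \<le> grad_prod v v"
    and split_W: "\<And>q. q \<in> tensor W S \<Longrightarrow> \<exists>q0\<in>Y. \<exists>z\<in>T. q = q0 + z \<and> \<delta> * L2_prod z z \<le> L2_prod q q"
    and coarse: "galerkin_solution D \<alpha> \<beta> E f X Y u p pt"
    and fine: "galerkin_solution D \<alpha> \<beta> E f (tensor V S) (tensor W S) us ps pts"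
    and proxies: "represents_on (form_a0 D \<alpha>) (res_u D \<alpha> E f u p) Z zu"
      "represents_on (form_cbar D \<alpha> \<beta>) (res_p D \<alpha> \<beta> u pt) T zp"
      "represents_on (form_d0 D \<alpha> \<beta>) (res_pt D \<alpha> \<beta> E p pt) T zt"
  shows "const_C6 (CARD('d)) Emax * eta_spatial D \<alpha> \<beta> zu zp zt \<le> triple_norm D \<alpha> \<beta> (us - u) (ps - p) (pts - pt)"
    and "triple_norm D \<alpha> \<beta> (us - u) (ps - p) (pts - pt)
      \<le> const_C7 CK \<gamma> Emin Emax / sqrt \<delta> * eta_spatial D \<alpha> \<beta> zu zp zt"
proof -
  define \<kappa> where "\<kappa> = 1 / (\<alpha> * \<beta>)"
  have \<kappa>: "0 < \<kappa>" using pos by (simp add: \<kappa>_def)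
  have subV: "subspace V" by (rule finite_dim_space_subspace[OF V(1)])
  have V_H1: "V \<subseteq> H1_vec" by (rule order_trans[OF V(2) H1_E0_subset])
  interpret mixed_problem "tensor V S" grad_prod strain_prod "tensor W S" L2_prod weighted_prod "form_b D"
    \<alpha> \<kappa> Emin Emax CK "sqrt (real CARD('d))"
    by (rule mixed_problem_tensor[OF subV V(2) W S korn pos(1) \<kappa> Emin_le_Emax[OF ne]])
  have VR: "tensor V S \<subseteq> random_H1" and WR: "tensor W S \<subseteq> random_L2"
    using tensor_random_H1[OF V_H1 S] tensor_random_L2[OF W(2) S] by auto
  have mem: "u \<in> X" "p \<in> Y" "pt \<in> Y" "us \<in> tensor V S" "ps \<in> tensor W S" "pts \<in> tensor W S" "zu \<in> Z" "zp \<in> T" "zt \<in> T"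
    using coarse fine proxies by (auto simp: galerkin_solution_def represents_on_def)
  have load: "load D f (v + w) = load D f v + load D f w" if "v \<in> tensor V S" "w \<in> tensor V S" for v w
    using that VR by (intro load_linear[OF f]) auto
  have inf_sup': "\<exists>v\<in>tensor V S. grad_prod v v \<le> L2_prod r r \<and> \<gamma> * L2_prod r r \<le> form_b D v r"
    if "r \<in> tensor W S" for r
    by (rule tensor_inf_sup[OF inf_sup V(1) V_H1 W S that])
  have \<gamma>: "0 < \<gamma>" using inf_sup by (simp add: inf_sup_stable_def)
  have coarse_u: "\<alpha> * strain_prod u v + form_b D v p = load D f v" if "v \<in> X" for v
    using coarse that by (simp add: galerkin_solution_def form_eqs)
  have coarse_p: "form_b D u q - \<kappa> * L2_prod pt q = 0" "- \<kappa> * L2_prod p q + \<kappa> * weighted_prod pt q = 0" if "q \<in> Y" for q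
    using coarse that unfolding galerkin_solution_def form_eqs \<kappa>_def[symmetric] by auto
  have fine_u: "\<alpha> * strain_prod us v + form_b D v ps = load D f v" if "v \<in> tensor V S" for v
    using fine that by (simp add: galerkin_solution_def form_eqs)
  have fine_p: "form_b D us q - \<kappa> * L2_prod pts q = 0" "- \<kappa> * L2_prod ps q + \<kappa> * weighted_prod pts q = 0"
    if "q \<in> tensor W S" for q
    using fine that unfolding galerkin_solution_def form_eqs \<kappa>_def[symmetric] by auto
  have proxy_u: "\<alpha> * grad_prod zu v = load D f v - \<alpha> * strain_prod u v - form_b D v p" if "v \<in> Z" for v
    using proxies(1) that by (simp add: represents_on_def res_u_def form_eqs)
  have proxy_p: "(1 / \<alpha> + \<kappa>) * L2_prod zp q = - form_b D u q + \<kappa> * L2_prod pt q"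
    "\<kappa> * L2_prod zt q = \<kappa> * L2_prod p q - \<kappa> * weighted_prod pt q" if "q \<in> T" for q
    using proxies(2,3) that unfolding represents_on_def res_p_def res_pt_def form_eqs \<kappa>_def[symmetric] by auto
  note bounds = enriched_error_bounds[where l = "load D f" and \<gamma> = \<gamma> and \<delta> = \<delta>
      and X = X and Z = Z and Y = Y and T = T and u = u and p = p and pt = pt and us = us and ps = ps and pts = pts
      and zu = zu and zp = zp and zt = zt,
      OF load inf_sup' \<gamma> sub \<delta> split_V split_W mem(1-3) coarse_u coarse_p mem(4-6) fine_u fine_p mem(7-9) proxy_u proxy_p]
  have e: "us - u \<in> tensor V S" "ps - p \<in> tensor W S" "pts - pt \<in> tensor W S"
    using mem sub V.sub W.sub by (auto intro!: subspace_diff)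
  have "triple_norm D \<alpha> \<beta> (us - u) (ps - p) (pts - pt) = sqrt (energy (us - u) (ps - p) (pts - pt))"
    unfolding energy_def unfolding \<kappa>_def using e VR WR by (intro triple_norm_eq) auto
  moreover have "eta_spatial D \<alpha> \<beta> zu zp zt = sqrt (energy zu zp zt)"
    unfolding energy_def unfolding \<kappa>_def using mem sub VR WR by (intro eta_spatial_eq[OF assms(1,2)]) auto
  ultimately show "const_C6 (CARD('d)) Emax * eta_spatial D \<alpha> \<beta> zu zp zt \<le> triple_norm D \<alpha> \<beta> (us - u) (ps - p) (pts - pt)"
    and "triple_norm D \<alpha> \<beta> (us - u) (ps - p) (pts - pt)
      \<le> const_C7 CK \<gamma> Emin Emax / sqrt \<delta> * eta_spatial D \<alpha> \<beta> zu zp zt"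
    using bounds by (simp_all add: const_C6_def)
qed

text \<open>Here \<open>S\<close> is fixed and the spatial factor is split. The larger CBS constant
  serves for the displacement and both pressures at once.\<close>

lemma spatial_enrichment:
  assumes pos: "0 < \<alpha>" "0 < \<beta>" and ne: "D \<noteq> {}" and korn: "korn_constant D \<Gamma> CK" and f: "f \<in> L2 (vol D)"
    and Vh: "finite_dim_space Vh" "Vh \<subseteq> H1_E0 D \<Gamma>" and Wh: "finite_dim_space Wh" "Wh \<subseteq> L2 (vol D)"
    and Vt: "finite_dim_space Vt" "Vt \<subseteq> H1_E0 D \<Gamma>" and Wt: "finite_dim_space Wt" "Wt \<subseteq> L2 (vol D)"
    and Vs: "Vs = sum_space Vh Vt" and Ws: "Ws = sum_space Wh Wt"
    and inf_sup: "inf_sup_stable D Vs Ws \<gamma>"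
    and cbs: "cbs_vector D Vh Vt \<gamma>1" "cbs_scalar D Wh Wt \<gamma>2" and S: "S \<subseteq> bounded_rv"
    and sol: "galerkin_solution D \<alpha> \<beta> E f (tensor Vh S) (tensor Wh S) u p pt"
      "galerkin_solution D \<alpha> \<beta> E f (tensor Vs S) (tensor Ws S) us ps pts"
    and proxies: "represents_on (form_a0 D \<alpha>) (res_u D \<alpha> E f u p) (tensor Vt S) zu"
      "represents_on (form_cbar D \<alpha> \<beta>) (res_p D \<alpha> \<beta> u pt) (tensor Wt S) zp"
      "represents_on (form_d0 D \<alpha> \<beta>) (res_pt D \<alpha> \<beta> E p pt) (tensor Wt S) zt"
  shows "const_C6 (CARD('d)) Emax * eta_spatial D \<alpha> \<beta> zu zp zt \<le> triple_norm D \<alpha> \<beta> (us - u) (ps - p) (pts - pt)"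
    and "triple_norm D \<alpha> \<beta> (us - u) (ps - p) (pts - pt)
      \<le> const_C7 CK \<gamma> Emin Emax / sqrt (1 - (max \<gamma>1 \<gamma>2)\<^sup>2) * eta_spatial D \<alpha> \<beta> zu zp zt"
proof -
  note subs = finite_dim_space_subspace[OF Vh(1)] finite_dim_space_subspace[OF Vt(1)]
    finite_dim_space_subspace[OF Wh(1)] finite_dim_space_subspace[OF Wt(1)]
  have Vs_fin: "finite_dim_space Vs"
    unfolding Vs by (rule finite_dim_sum_space[OF Vh(1) Vt(1)])
  have Ws_sub: "subspace Ws"
    unfolding Ws by (rule subspace_sum_space[OF subs(3,4)])
  have Vs_H1: "Vs \<subseteq> H1_E0 D \<Gamma>"
  proof
    fix v assume "v \<in> Vs"
    then obtain w z where "v = w + z" "w \<in> Vh" "z \<in> Vt"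
      unfolding Vs sum_space_def plus_fun_def by blast
    with Vh(2) Vt(2) show "v \<in> H1_E0 D \<Gamma>" by (auto intro: H1_E0_add)
  qed
  have Ws_L2: "Ws \<subseteq> L2 (vol D)"
    unfolding Ws by (rule sum_space_subset[OF subs(3) Wh(2) Wt(2) subspace_L2])
  note H1 = order_trans[OF Vh(2) H1_E0_subset] order_trans[OF Vt(2) H1_E0_subset] order_trans[OF Vs_H1 H1_E0_subset]
  have VsR: "tensor Vs S \<subseteq> random_H1" and WsR: "tensor Ws S \<subseteq> random_L2"
    using tensor_random_H1[OF H1(3) S] tensor_random_L2[OF Ws_L2 S] by auto
  let ?\<gamma> = "max \<gamma>1 \<gamma>2"
  have g: "0 \<le> \<gamma>1" "0 \<le> \<gamma>2" "\<gamma>1 < 1" "\<gamma>2 < 1"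
    using cbs by (auto simp: cbs_vector_def cbs_scalar_def)
  have \<gamma>: "\<gamma>1\<^sup>2 \<le> ?\<gamma>\<^sup>2" "\<gamma>2\<^sup>2 \<le> ?\<gamma>\<^sup>2" "0 < 1 - ?\<gamma>\<^sup>2"
    using g power_mono[of \<gamma>1 ?\<gamma> 2] power_mono[of \<gamma>2 ?\<gamma> 2] power_strict_mono[of ?\<gamma> 1 2] by auto
  have sub: "tensor Vh S \<subseteq> tensor Vs S" "tensor Vt S \<subseteq> tensor Vs S" "tensor Wh S \<subseteq> tensor Ws S" "tensor Wt S \<subseteq> tensor Ws S"
    unfolding Vs Ws
    by (rule tensor_mono[OF conjunct1[OF sum_space_upper[OF subs(1,2)]] order_refl]
        tensor_mono[OF conjunct2[OF sum_space_upper[OF subs(1,2)]] order_refl]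
        tensor_mono[OF conjunct1[OF sum_space_upper[OF subs(3,4)]] order_refl]
        tensor_mono[OF conjunct2[OF sum_space_upper[OF subs(3,4)]] order_refl])+
  have split_V: "\<exists>v0\<in>tensor Vh S. \<exists>z\<in>tensor Vt S. v = v0 + z \<and> (1 - ?\<gamma>\<^sup>2) * grad_prod z z \<le> grad_prod v v"
    if v: "v \<in> tensor Vs S" for v
  proof -
    obtain v0 z where v0: "v0 \<in> tensor Vh S" "z \<in> tensor Vt S" "v = v0 + z"
      using tensor_sum_space[OF subs(1,2) v[unfolded Vs]] by blast
    have "(1 - ?\<gamma>\<^sup>2) * grad_prod z z \<le> (1 - \<gamma>1\<^sup>2) * grad_prod z z"
      using \<gamma>(1) psd_form.nonneg[OF psd_form_grad_prod, of z] sub VsR v0 by (intro mult_right_mono) auto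
    also have "\<dots> \<le> grad_prod v v"
      unfolding v0(3) by (rule cbs_grad_prod[OF cbs(1) subs(1,2) H1(1,2) S v0(1,2)])
    finally show ?thesis using v0 by blast
  qed
  have split_W: "\<exists>q0\<in>tensor Wh S. \<exists>z\<in>tensor Wt S. q = q0 + z \<and> (1 - ?\<gamma>\<^sup>2) * L2_prod z z \<le> L2_prod q q"
    if q: "q \<in> tensor Ws S" for q
  proof -
    obtain q0 z where q0: "q0 \<in> tensor Wh S" "z \<in> tensor Wt S" "q = q0 + z"
      using tensor_sum_space[OF subs(3,4) q[unfolded Ws]] by blast
    have "(1 - ?\<gamma>\<^sup>2) * L2_prod z z \<le> (1 - \<gamma>2\<^sup>2) * L2_prod z z"
      using \<gamma>(2) psd_form.nonneg[OF psd_form_L2_prod, of z] sub WsR q0 by (intro mult_right_mono) auto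
    also have "\<dots> \<le> L2_prod q q"
      unfolding q0(3) by (rule cbs_L2_prod[OF cbs(2) subs(3,4) Wh(2) Wt(2) S q0(1,2)])
    finally show ?thesis using q0 by blast
  qed
  show "const_C6 (CARD('d)) Emax * eta_spatial D \<alpha> \<beta> zu zp zt \<le> triple_norm D \<alpha> \<beta> (us - u) (ps - p) (pts - pt)"
    and "triple_norm D \<alpha> \<beta> (us - u) (ps - p) (pts - pt)
      \<le> const_C7 CK \<gamma> Emin Emax / sqrt (1 - ?\<gamma>\<^sup>2) * eta_spatial D \<alpha> \<beta> zu zp zt"
    by (rule enrichment_bounds[OF pos ne korn f Vs_fin Vs_H1 Ws_sub Ws_L2 inf_sup S sub \<gamma>(3) split_V split_W sol proxies];
        assumption)+
qed

text \<open>The spatial pair is unchanged, so its own inf-sup constant enters. Old and new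
  polynomials are orthogonal, hence so are the two parts of a field, and no CBS factor
  appears.\<close>

lemma parametric_enrichment:
  assumes pos: "0 < \<alpha>" "0 < \<beta>" and ne: "D \<noteq> {}" and korn: "korn_constant D \<Gamma> CK" and f: "f \<in> L2 (vol D)"
    and Vh: "finite_dim_space Vh" "Vh \<subseteq> H1_E0 D \<Gamma>" and Wh: "finite_dim_space Wh" "Wh \<subseteq> L2 (vol D)"
    and inf_sup: "inf_sup_stable D Vh Wh \<gamma>"
    and \<Lambda>: "\<Lambda> \<subseteq> multi_indices" "finite \<Lambda>" and Q: "Q \<subseteq> multi_indices" "finite Q" and disj: "\<Lambda> \<inter> Q = {}"
    and sol: "galerkin_solution D \<alpha> \<beta> E f (tensor Vh (poly_space \<Lambda>)) (tensor Wh (poly_space \<Lambda>)) u p pt"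
      "galerkin_solution D \<alpha> \<beta> E f (tensor Vh (poly_space (\<Lambda> \<union> Q))) (tensor Wh (poly_space (\<Lambda> \<union> Q))) us ps pts"
    and proxies: "represents_on (form_a0 D \<alpha>) (res_u D \<alpha> E f u p) (tensor Vh (poly_space Q)) zu"
      "represents_on (form_d0 D \<alpha> \<beta>) (res_pt D \<alpha> \<beta> E p pt) (tensor Wh (poly_space Q)) zt"
  shows "const_C6 (CARD('d)) Emax * eta_parametric D \<alpha> \<beta> zu zt \<le> triple_norm D \<alpha> \<beta> (us - u) (ps - p) (pts - pt)"
    and "triple_norm D \<alpha> \<beta> (us - u) (ps - p) (pts - pt)
      \<le> const_C7 CK \<gamma> Emin Emax * eta_parametric D \<alpha> \<beta> zu zt"
proof -
  let ?S = "poly_space (\<Lambda> \<union> Q)"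
  note S = poly_space_bounded_rv
  note subs = finite_dim_space_subspace[OF Vh(1)] finite_dim_space_subspace[OF Wh(1)]
  note H1 = order_trans[OF Vh(2) H1_E0_subset]
  interpret V: psd_form random_H1 grad_prod by (rule psd_form_grad_prod)
  interpret W: psd_form random_L2 L2_prod by (rule psd_form_L2_prod)
  have VR: "tensor Vh (poly_space J) \<subseteq> random_H1" and WR: "tensor Wh (poly_space J) \<subseteq> random_L2" for J
    using tensor_random_H1[OF H1 S] tensor_random_L2[OF Wh(2) S] by auto
  have fin: "finite (\<Lambda> \<union> Q)" using \<Lambda> Q by simp
  have sub: "tensor Vh (poly_space \<Lambda>) \<subseteq> tensor Vh ?S" "tensor Vh (poly_space Q) \<subseteq> tensor Vh ?S"
    "tensor Wh (poly_space \<Lambda>) \<subseteq> tensor Wh ?S" "tensor Wh (poly_space Q) \<subseteq> tensor Wh ?S"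
    by (intro tensor_mono order_refl poly_space_mono[OF _ fin] Un_upper1 Un_upper2)+
  note orth = poly_space_orthogonal[OF \<Lambda>(1) Q(1) disj]
  have split_V: "\<exists>v0\<in>tensor Vh (poly_space \<Lambda>). \<exists>z\<in>tensor Vh (poly_space Q). v = v0 + z \<and> 1 * grad_prod z z \<le> grad_prod v v"
    if v: "v \<in> tensor Vh ?S" for v
  proof -
    obtain v0 z where v0: "v0 \<in> tensor Vh (poly_space \<Lambda>)" "z \<in> tensor Vh (poly_space Q)" "v = v0 + z"
      using tensor_poly_space_Un[OF subs(1) \<Lambda>(2) Q(2) disj v] by blast
    have mem: "v0 \<in> random_H1" "z \<in> random_H1" using v0 VR by auto
    have "grad_prod v v = grad_prod v0 v0 + 2 * grad_prod v0 z + grad_prod z z"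
      using V.expand[OF mem, of 1] unfolding v0(3) scaleR_one by simp
    moreover have "grad_prod v0 z = 0"
      by (rule grad_prod_orthogonal[OF H1 H1 S S orth v0(1,2)])
    ultimately have "1 * grad_prod z z \<le> grad_prod v v" using V.nonneg[OF mem(1)] by simp
    with v0 show ?thesis by blast
  qed
  have split_W: "\<exists>q0\<in>tensor Wh (poly_space \<Lambda>). \<exists>z\<in>tensor Wh (poly_space Q). q = q0 + z \<and> 1 * L2_prod z z \<le> L2_prod q q"
    if q: "q \<in> tensor Wh ?S" for q
  proof -
    obtain q0 z where q0: "q0 \<in> tensor Wh (poly_space \<Lambda>)" "z \<in> tensor Wh (poly_space Q)" "q = q0 + z"
      using tensor_poly_space_Un[OF subs(2) \<Lambda>(2) Q(2) disj q] by blast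
    have mem: "q0 \<in> random_L2" "z \<in> random_L2" using q0 WR by auto
    have "L2_prod q q = L2_prod q0 q0 + 2 * L2_prod q0 z + L2_prod z z"
      using W.expand[OF mem, of 1] unfolding q0(3) scaleR_one by simp
    moreover have "L2_prod q0 z = 0"
      by (rule L2_prod_orthogonal[OF Wh(2) Wh(2) S S orth q0(1,2)])
    ultimately have "1 * L2_prod z z \<le> L2_prod q q" using W.nonneg[OF mem(1)] by simp
    with q0 show ?thesis by blast
  qed
  have mem: "u \<in> tensor Vh (poly_space \<Lambda>)" "pt \<in> tensor Wh (poly_space \<Lambda>)"
    using sol by (auto simp: galerkin_solution_def)
  text \<open>The second residual vanishes on the new polynomials, which is why \<open>eta_parametric\<close> has no
    proxy for it.\<close>
  have res_p: "represents_on (form_cbar D \<alpha> \<beta>) (res_p D \<alpha> \<beta> u pt) (tensor Wh (poly_space Q)) 0"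
    unfolding represents_on_def
  proof (intro conjI ballI)
    show "0 \<in> tensor Wh (poly_space Q)"
      by (rule subspace_0[OF subspace_tensor[OF subs(2)]])
    fix q assume q: "q \<in> tensor Wh (poly_space Q)"
    then show "form_cbar D \<alpha> \<beta> 0 q = res_p D \<alpha> \<beta> u pt q"
      using form_b_orthogonal[OF H1 Wh(2) S S orth mem(1) q] L2_prod_orthogonal[OF Wh(2) Wh(2) S S orth mem(2) q]
        bilinear_on_zero_left[OF W.bil W.sub, of q] WR by (auto simp: res_p_def form_eqs)
  qed
  note bounds = enrichment_bounds[OF pos ne korn f Vh subs(2) Wh(2) inf_sup S sub zero_less_one split_V split_W sol
      proxies(1) res_p proxies(2)]
  then show "const_C6 (CARD('d)) Emax * eta_parametric D \<alpha> \<beta> zu zt \<le> triple_norm D \<alpha> \<beta> (us - u) (ps - p) (pts - pt)"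
    and "triple_norm D \<alpha> \<beta> (us - u) (ps - p) (pts - pt) \<le> const_C7 CK \<gamma> Emin Emax * eta_parametric D \<alpha> \<beta> zu zt"
    by (simp_all add: eta_spatial_0)
qed

end

theorem theorem5p1:
  fixes D \<Gamma>\<^sub>D \<Gamma>\<^sub>N :: "(real ^ 'd) set"
    and e :: "nat \<Rightarrow> real ^ 'd \<Rightarrow> real"
    and f :: "real ^ 'd \<Rightarrow> real ^ 'd"
    and Emin Emax e0min e0max \<nu> \<alpha> \<beta> CK \<gamma>h \<gamma>hs \<gamma>1 \<gamma>2 :: real
    and Vh Vt Vs :: "(real ^ 'd \<Rightarrow> real ^ 'd) set"
    and Wh Wt Ws :: "(real ^ 'd \<Rightarrow> real) set"
    and \<Lambda> Q :: "(nat \<Rightarrow> nat) set"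
    and E :: "real ^ 'd \<Rightarrow> (nat \<Rightarrow> real) \<Rightarrow> real"
    and u us ul zut zuQ :: "(nat \<Rightarrow> real) \<Rightarrow> real ^ 'd \<Rightarrow> real ^ 'd"
    and p pt ps pts pl ptl zp zpt zptQ :: "(nat \<Rightarrow> real) \<Rightarrow> real ^ 'd \<Rightarrow> real"
  assumes dim: "CARD('d) = 2 \<or> CARD('d) = 3"
    and dom: "lipschitz_polytopal_domain D"
    and bdry: "frontier D = \<Gamma>\<^sub>D \<union> \<Gamma>\<^sub>N" "\<Gamma>\<^sub>D \<inter> \<Gamma>\<^sub>N = {}" "\<Gamma>\<^sub>D \<noteq> {}" "\<Gamma>\<^sub>N \<noteq> {}"
    and E_def: "E = modulus e"
    and e_Linf: "\<And>k. e k \<in> Linf (vol D)"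
    and E_Linf: "(\<lambda>(x, y). E x y) \<in> Linf (vol D \<Otimes>\<^sub>M param_measure)"
    and E_bounds: "0 < Emin" "AE (x, y) in vol D \<Otimes>\<^sub>M param_measure. Emin \<le> E x y \<and> E x y \<le> Emax"
    and e0_bounds: "0 < e0min" "AE x in vol D. e0min \<le> e 0 x \<and> e 0 x \<le> e0max"
    and e_sum: "summable (\<lambda>k. Linf_norm (vol D) (e (Suc k)))"
      "1 / e0min * (\<Sum>k. Linf_norm (vol D) (e (Suc k))) < 1"
    and nu: "0 < \<nu>" "\<nu> < 1 / 2"
    and alpha_def: "\<alpha> = 1 / (1 + \<nu>)"
    and beta_def: "\<beta> = \<nu> / (1 - 2 * \<nu>)"
    and f_L2: "f \<in> L2 (vol D)"
    and korn: "korn_constant D \<Gamma>\<^sub>D CK"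
    and Vh: "finite_dim_space Vh" "Vh \<subseteq> H1_E0 D \<Gamma>\<^sub>D"
    and Wh: "finite_dim_space Wh" "Wh \<subseteq> L2 (vol D)"
    and Vt: "finite_dim_space Vt" "Vt \<subseteq> H1_E0 D \<Gamma>\<^sub>D" "trivial_intersection D Vh Vt"
    and Wt: "finite_dim_space Wt" "Wt \<subseteq> L2 (vol D)" "trivial_intersection D Wh Wt"
    and Vs_def: "Vs = sum_space Vh Vt"
    and Ws_def: "Ws = sum_space Wh Wt"
    and inf_sup: "inf_sup_stable D Vh Wh \<gamma>h"
    and inf_sup_enriched: "inf_sup_stable D Vs Ws \<gamma>hs"
    and cbs: "cbs_vector D Vh Vt \<gamma>1" "cbs_scalar D Wh Wt \<gamma>2"
    and index_sets: "\<Lambda> \<subseteq> multi_indices" "Q \<subseteq> multi_indices" "finite \<Lambda>" "finite Q" "\<Lambda> \<inter> Q = {}"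
    and sol: "galerkin_solution D \<alpha> \<beta> E f (tensor Vh (poly_space \<Lambda>)) (tensor Wh (poly_space \<Lambda>)) u p pt"
    and sol_spatial:
      "galerkin_solution D \<alpha> \<beta> E f (tensor Vs (poly_space \<Lambda>)) (tensor Ws (poly_space \<Lambda>)) us ps pts"
    and sol_parametric:
      "galerkin_solution D \<alpha> \<beta> E f (tensor Vh (poly_space (\<Lambda> \<union> Q))) (tensor Wh (poly_space (\<Lambda> \<union> Q)))
         ul pl ptl"
    and proxies_spatial:
      "represents_on (form_a0 D \<alpha>) (res_u D \<alpha> E f u p) (tensor Vt (poly_space \<Lambda>)) zut"
      "represents_on (form_cbar D \<alpha> \<beta>) (res_p D \<alpha> \<beta> u pt) (tensor Wt (poly_space \<Lambda>)) zp"
      "represents_on (form_d0 D \<alpha> \<beta>) (res_pt D \<alpha> \<beta> E p pt) (tensor Wt (poly_space \<Lambda>)) zpt"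
    and proxies_parametric:
      "represents_on (form_a0 D \<alpha>) (res_u D \<alpha> E f u p) (tensor Vh (poly_space Q)) zuQ"
      "represents_on (form_d0 D \<alpha> \<beta>) (res_pt D \<alpha> \<beta> E p pt) (tensor Wh (poly_space Q)) zptQ"
  shows
    "const_C6 (CARD('d)) Emax * eta_spatial D \<alpha> \<beta> zut zp zpt
        \<le> triple_norm D \<alpha> \<beta> (us - u) (ps - p) (pts - pt)
     \<and> triple_norm D \<alpha> \<beta> (us - u) (ps - p) (pts - pt)
        \<le> const_C7 CK \<gamma>hs Emin Emax / sqrt (1 - (max \<gamma>1 \<gamma>2)\<^sup>2) * eta_spatial D \<alpha> \<beta> zut zp zpt
     \<and> const_C6 (CARD('d)) Emax * eta_parametric D \<alpha> \<beta> zuQ zptQ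
        \<le> triple_norm D \<alpha> \<beta> (ul - u) (pl - p) (ptl - pt)
     \<and> triple_norm D \<alpha> \<beta> (ul - u) (pl - p) (ptl - pt)
        \<le> const_C7 CK (min \<gamma>h \<gamma>hs) Emin Emax * eta_parametric D \<alpha> \<beta> zuQ zptQ"
proof -
  have D: "D \<noteq> {}" "open D" "bounded D"
    using dom by (auto simp: lipschitz_polytopal_domain_def)
  interpret bounded_domain D
    by unfold_locales (rule D)+
  interpret elastic_domain D E Emin Emax
    by unfold_locales (use E_Linf E_bounds in \<open>auto simp: Linf_def\<close>)
  have pos: "0 < \<alpha>" "0 < \<beta>"
    using nu by (auto simp: alpha_def beta_def)
  \<comment> \<open>The minimum is an inf-sup constant of the original pair, the one on which the
    parametric enrichment is built.\<close>
  have inf_sup': "inf_sup_stable D Vh Wh (min \<gamma>h \<gamma>hs)"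
    by (rule inf_sup_stable_mono[OF inf_sup]) (use inf_sup inf_sup_enriched in \<open>auto simp: inf_sup_stable_def\<close>)
  note spatial_bounds = spatial_enrichment[OF pos D(1) korn f_L2 Vh Wh Vt(1,2) Wt(1,2) Vs_def Ws_def inf_sup_enriched cbs
      poly_space_bounded_rv sol sol_spatial proxies_spatial]
  note parameter_bounds = parametric_enrichment[OF pos D(1) korn f_L2 Vh Wh inf_sup' index_sets(1,3,2,4,5) sol sol_parametric
      proxies_parametric]
  show ?thesis
    by (intro conjI spatial_bounds parameter_bounds)
qed

end
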